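(* Let $B>0$, $0<T<\infty$, $M<\infty$, $s>d$, $c>0$, and let $k\ge2$ be an integer. Consider an entire function $\omega$ on $\mathbb{C}^d$ that is real-valued when restricted to $\mathbb{R}^d$, and let $U(t)$ be the Fourier multiplier operator with symbol $e^{-it\omega(\xi)}$. Let $N[u]=u^k$ (or any $k$-fold product involving complex conjugates of $u$). Let $u\in C([-T,T];H^s(\mathbb{R}^d))$ satisfy $$u(t_2)=U(t_2-t_1)u(t_1)-i\int_{t_1}^{t_2}U(t_2-\tau)N[u](\tau)\,d\tau\qquad\text{for any }t_1,t_2\in[-T,T]$$ and $\sup_{t\in[-T,T]}\|u(t)\|_{H^s}\le M$, and assume $\operatorname{supp}(u(t))\subseteq\{x\in\mathbb{R}^d:|x|<B\}$ for all $t\in[-T,T]$. Let $Q\gg B$. Suppose there exists a sequence $\{\xi_n\}\subseteq E_{Q,c}$ where for each $\xi_n$ there exists $\eta_n\in\mathbb{R}^d$ with $|\eta_n|\simeq|\xi_n|^{-1}$ such that $$(t_2(\xi_n)-t_1(\xi_n))\operatorname{Im}\omega(\xi_n+i\eta_n)>0,\qquad|\operatorname{Im}\omega(\xi_n+i\eta_n)|\gtrsim\frac{|\xi_n|}{T}$$ for all sufficiently large $n$, as $|\xi_n|\to\infty$ when $n\to\infty$. Then $u\equiv0$ on $[-T,T]\times\mathbb{R}^d$.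
   Context: For $z\in\mathbb{C}^d$, $|z|:=\max_{1\le j\le d}|z_j|$. The spatial Fourier transform is $\widehat f(\xi)=\int f(x)e^{-ix\cdot\xi}\,dx$. For $u$ as in the claim, define $$u^*(\xi)=\sup_{t\in[-T,T]}|\widehat{u(t)}(\xi)|,\qquad a(\xi)=\sup_{|\xi'|\ge|\xi|}u^*(\xi'),$$ $$E_{Q,c}=\Big\{\xi\in\mathbb{R}^d:\ a(\xi)>c\,\underbrace{a*\cdots*a}_{k}(\xi),\ \ a(\xi)>e^{-|\xi|/Q},\ \ a(\xi)=u^*(\xi)\Big\}.$$ For each $\xi\in\mathbb{R}^d$ there is $t_1=t_1(\xi)\in[-T,T]$ with $u^*(\xi)=|\widehat{u(t_1)}(\xi)|$; then $t_2=t_2(\xi)\in[-T,T]$ is taken such that $|t_2-t_1|\ge\epsilon_0T$, where $\epsilon_0\ll1$. Here $X\gg Y$ means that $X$ is sufficiently large relative to $Y$ (and $\epsilon_0\ll1$ that $\epsilon_0>0$ is sufficiently small), $X\gtrsim Y$ means $X\ge CY$ for some constant $C>0$ (independent of $n$), and $X\simeq Y$ means $X\gtrsim Y$ and $Y\gtrsim X$. *)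

theory Defs
  imports "HOL-Analysis.Analysis"
begin

text \<open>
  Points of \<open>\<real>\<^sup>d\<close> are vectors of type \<open>real ^ 'd\<close>, with \<open>d = CARD('d)\<close>, and \<open>\<bar>\<xi>\<bar>\<close> is the
  maximum norm \<^const>\<open>infnorm\<close>. Elements of \<open>L\<^sup>2\<close> and \<open>H\<^sup>s\<close> are represented by Borel functions,
  equality being equality almost everywhere.
\<close>

definition fourier :: "(real ^ 'd::finite \<Rightarrow> complex) \<Rightarrow> real ^ 'd \<Rightarrow> complex" where
  "fourier f \<xi> = (LINT x|lborel. f x * exp (- \<i> * of_real (x \<bullet> \<xi>)))"

definition square_integrable :: "(real ^ 'd::finite \<Rightarrow> complex) \<Rightarrow> bool" where
  "square_integrable f \<longleftrightarrow>
     f \<in> borel_measurable lborel \<and> integrable lborel (\<lambda>x. (cmod (f x))\<^sup>2)"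

text \<open>
  The Fourier--Plancherel transform on \<open>L\<^sup>2\<close>: \<open>F\<close> is the limit in the mean of the Fourier
  integrals over balls of radius \<open>R \<rightarrow> \<infinity>\<close>. It exists for every square integrable \<open>f\<close> and is
  unique almost everywhere.
\<close>

definition has_L2_fourier ::
    "(real ^ 'd::finite \<Rightarrow> complex) \<Rightarrow> (real ^ 'd \<Rightarrow> complex) \<Rightarrow> bool" where
  "has_L2_fourier f F \<longleftrightarrow> square_integrable f \<and> square_integrable F \<and>
     ((\<lambda>R. \<integral>\<^sup>+ \<xi>. ennreal ((cmod (fourier (\<lambda>x. indicator (cball 0 R) x *\<^sub>R f x) \<xi> - F \<xi>))\<^sup>2)
         \<partial>lborel) \<longlongrightarrow> 0) at_top"

definition sobolev_space :: "real \<Rightarrow> (real ^ 'd::finite \<Rightarrow> complex) set" where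
  "sobolev_space s = {f. \<exists>F. has_L2_fourier f F \<and>
     integrable lborel (\<lambda>\<xi>. (1 + (norm \<xi>)\<^sup>2) powr s * (cmod (F \<xi>))\<^sup>2)}"

text \<open>The choice of \<open>F\<close> is immaterial, because \<open>F\<close> is unique almost everywhere.\<close>

definition sobolev_norm :: "real \<Rightarrow> (real ^ 'd::finite \<Rightarrow> complex) \<Rightarrow> real" where
  "sobolev_norm s f = (let F = (SOME F. has_L2_fourier f F) in
     sqrt (LINT \<xi>|lborel. (1 + (norm \<xi>)\<^sup>2) powr s * (cmod (F \<xi>))\<^sup>2))"

definition sobolev_continuous_on ::
    "real \<Rightarrow> real set \<Rightarrow> (real \<Rightarrow> real ^ 'd::finite \<Rightarrow> complex) \<Rightarrow> bool" where
  "sobolev_continuous_on s S u \<longleftrightarrow>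
     (\<forall>t\<in>S. u t \<in> sobolev_space s) \<and>
     (\<forall>t\<in>S. ((\<lambda>t'. sobolev_norm s (\<lambda>x. u t' x - u t x)) \<longlongrightarrow> 0) (at t within S))"

text \<open>The \<open>H\<^sup>s\<close>-valued Riemann integral \<open>v = \<integral>\<^sub>a\<^sup>b w(\<tau>) d\<tau>\<close>, first for \<open>a \<le> b\<close>.\<close>

definition has_sobolev_integral_ordered ::
    "real \<Rightarrow> (real \<Rightarrow> real ^ 'd::finite \<Rightarrow> complex) \<Rightarrow> real \<Rightarrow> real \<Rightarrow> (real ^ 'd \<Rightarrow> complex) \<Rightarrow> bool" where
  "has_sobolev_integral_ordered s w a b v \<longleftrightarrow>
     (\<forall>\<tau>\<in>{a..b}. w \<tau> \<in> sobolev_space s) \<and> v \<in> sobolev_space s \<and>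
     (\<forall>\<epsilon>>0. \<exists>\<delta>>0. \<forall>p. p tagged_division_of {a..b} \<and> (\<forall>(\<tau>, J)\<in>p. measure lborel J < \<delta>) \<longrightarrow>
        sobolev_norm s (\<lambda>x. (\<Sum>(\<tau>, J)\<in>p. measure lborel J *\<^sub>R w \<tau> x) - v x) < \<epsilon>)"

definition has_sobolev_integral ::
    "real \<Rightarrow> (real \<Rightarrow> real ^ 'd::finite \<Rightarrow> complex) \<Rightarrow> real \<Rightarrow> real \<Rightarrow> (real ^ 'd \<Rightarrow> complex) \<Rightarrow> bool" where
  "has_sobolev_integral s w a b v \<longleftrightarrow>
     (if a \<le> b then has_sobolev_integral_ordered s w a b v
      else has_sobolev_integral_ordered s w b a (\<lambda>x. - v x))"

text \<open>The support of an almost-everywhere class (equivalently, of the associated distribution).\<close>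

definition ess_support :: "(real ^ 'd::finite \<Rightarrow> complex) \<Rightarrow> (real ^ 'd) set" where
  "ess_support f =
     {x. \<forall>V. open V \<and> x \<in> V \<longrightarrow> \<not> (AE y in lborel. y \<in> V \<longrightarrow> f y = 0)}"

definition complexify :: "real ^ 'd::finite \<Rightarrow> real ^ 'd \<Rightarrow> complex ^ 'd" where
  "complexify \<xi> \<eta> = (\<chi> j. Complex (\<xi> $ j) (\<eta> $ j))"

text \<open>Entire on \<open>\<complex>\<^sup>d\<close>: the Frechet derivative exists everywhere and is complex linear.\<close>

definition entire :: "(complex ^ 'd::finite \<Rightarrow> complex) \<Rightarrow> bool" where
  "entire \<omega> \<longleftrightarrow>
     (\<forall>z. \<exists>D. (\<omega> has_derivative D) (at z) \<and> (\<forall>c v. D (c *s v) = c * D v))"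

text \<open>\<open>g\<close> is the image of \<open>f\<close> under the Fourier multiplier operator with symbol \<open>m\<close>.\<close>

definition has_fourier_multiplier ::
    "(real ^ 'd::finite \<Rightarrow> complex) \<Rightarrow> (real ^ 'd \<Rightarrow> complex) \<Rightarrow> (real ^ 'd \<Rightarrow> complex) \<Rightarrow> bool" where
  "has_fourier_multiplier m f g \<longleftrightarrow>
     (\<exists>F. has_L2_fourier f F \<and> has_L2_fourier g (\<lambda>\<xi>. m \<xi> * F \<xi>))"

definition propagator_symbol ::
    "(complex ^ 'd::finite \<Rightarrow> complex) \<Rightarrow> real \<Rightarrow> real ^ 'd \<Rightarrow> complex" where
  "propagator_symbol \<omega> t \<xi> = exp (- \<i> * of_real t * \<omega> (complexify \<xi> 0))"

text \<open>A \<open>k\<close>-fold product of \<open>u\<close> in which \<open>j\<close> of the factors are conjugated.\<close>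

definition nonlinearity ::
    "nat \<Rightarrow> nat \<Rightarrow> (real ^ 'd::finite \<Rightarrow> complex) \<Rightarrow> real ^ 'd \<Rightarrow> complex" where
  "nonlinearity k j v x = v x ^ (k - j) * cnj (v x) ^ j"

text \<open>
  \<open>u(t\<^sub>2) = U(t\<^sub>2 - t\<^sub>1) u(t\<^sub>1) - \<i> \<integral> U(t\<^sub>2 - \<tau>) N[u](\<tau>) d\<tau>\<close> for all \<open>t\<^sub>1\<close>, \<open>t\<^sub>2\<close> in \<open>[-T, T]\<close>.
  Here \<open>v = U(t\<^sub>2 - t\<^sub>1) u(t\<^sub>1)\<close>, \<open>w(\<tau>) = U(t\<^sub>2 - \<tau>) N[u](\<tau>)\<close> and \<open>I\<close> is the integral of \<open>w\<close>
  from \<open>t\<^sub>1\<close> to \<open>t\<^sub>2\<close>; each of them is determined almost everywhere.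
\<close>

definition mild_solution ::
    "(complex ^ 'd::finite \<Rightarrow> complex) \<Rightarrow> ((real ^ 'd \<Rightarrow> complex) \<Rightarrow> real ^ 'd \<Rightarrow> complex) \<Rightarrow>
     real \<Rightarrow> real \<Rightarrow> (real \<Rightarrow> real ^ 'd \<Rightarrow> complex) \<Rightarrow> bool" where
  "mild_solution \<omega> N s T u \<longleftrightarrow>
     (\<forall>t\<^sub>1\<in>{-T..T}. \<forall>t\<^sub>2\<in>{-T..T}. \<exists>v w I.
        has_fourier_multiplier (propagator_symbol \<omega> (t\<^sub>2 - t\<^sub>1)) (u t\<^sub>1) v \<and>
        (\<forall>\<tau>\<in>closed_segment t\<^sub>1 t\<^sub>2.
           has_fourier_multiplier (propagator_symbol \<omega> (t\<^sub>2 - \<tau>)) (N (u \<tau>)) (w \<tau>)) \<and>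
        has_sobolev_integral s w t\<^sub>1 t\<^sub>2 I \<and>
        (AE x in lborel. u t\<^sub>2 x = v x - \<i> * I x))"

text \<open>
  The quantities below are nonnegative; suprema and convolutions are formed in \<open>[0, \<infinity>]\<close>.
\<close>

definition u_star ::
    "real \<Rightarrow> (real \<Rightarrow> real ^ 'd::finite \<Rightarrow> complex) \<Rightarrow> real ^ 'd \<Rightarrow> ennreal" where
  "u_star T u \<xi> = (SUP t\<in>{-T..T}. ennreal (cmod (fourier (u t) \<xi>)))"

definition u_majorant ::
    "real \<Rightarrow> (real \<Rightarrow> real ^ 'd::finite \<Rightarrow> complex) \<Rightarrow> real ^ 'd \<Rightarrow> ennreal" where
  "u_majorant T u \<xi> = (SUP \<xi>'\<in>{\<xi>'. infnorm \<xi>' \<ge> infnorm \<xi>}. u_star T u \<xi>')"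

definition convolution ::
    "(real ^ 'd::finite \<Rightarrow> ennreal) \<Rightarrow> (real ^ 'd \<Rightarrow> ennreal) \<Rightarrow> real ^ 'd \<Rightarrow> ennreal" where
  "convolution f g \<xi> = (\<integral>\<^sup>+ \<zeta>. f (\<xi> - \<zeta>) * g \<zeta> \<partial>lborel)"

text \<open>The convolution of \<open>k \<ge> 1\<close> copies of \<open>f\<close>.\<close>

definition convolution_power ::
    "nat \<Rightarrow> (real ^ 'd::finite \<Rightarrow> ennreal) \<Rightarrow> real ^ 'd \<Rightarrow> ennreal" where
  "convolution_power k f = (convolution f ^^ (k - 1)) f"

definition E_set ::
    "real \<Rightarrow> nat \<Rightarrow> (real \<Rightarrow> real ^ 'd::finite \<Rightarrow> complex) \<Rightarrow> real \<Rightarrow> real \<Rightarrow> (real ^ 'd) set" where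
  "E_set T k u Q c =
     {\<xi>. u_majorant T u \<xi> > ennreal c * convolution_power k (u_majorant T u) \<xi> \<and>
          u_majorant T u \<xi> > ennreal (exp (- infnorm \<xi> / Q)) \<and>
          u_majorant T u \<xi> = u_star T u \<xi>}"

end

theory Submission
  imports Defs "HOL-Complex_Analysis.Conformal_Mappings" "HOL-Probability.Characteristic_Functions"
    "HOL-Probability.Sinc_Integral"
begin

text \<open>
  The hypotheses are contradictory (for \<open>u = 0\<close> the set \<open>E\<^bsub>Q,c\<^esub>\<close> is empty). Put \<open>\<xi> = \<xi>\<^sub>n\<close>, \<open>\<eta> = \<eta>\<^sub>n\<close> and
  extend Duhamel's formula analytically to \<open>\<xi> + \<i>\<eta>\<close>. The free term has modulus
  \<open>exp ((t\<^sub>2 - t\<^sub>1) Im \<omega>(\<xi> + \<i>\<eta>)) \<bar>\<F>u(t\<^sub>1)(\<xi> + \<i>\<eta>)\<bar>\<close>, with an exponent of size at least \<open>\<epsilon>\<^sub>0 C\<^sub>3 \<bar>\<xi>\<bar>\<close>, while the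
  integral term gains a factor of order \<open>T / \<bar>\<xi>\<bar>\<close>. It remains to compare the values at \<open>\<xi> + \<i>\<eta>\<close>
  with \<open>a(\<xi>)\<close>. On a complex line \<open>z \<mapsto> \<F>u(\<xi> + z\<eta>)\<close> is of exponential type and bounded by \<open>a(\<xi>)\<close> on
  one of the two real half-lines, because \<open>\<bar>\<xi> + s\<eta>\<bar> \<ge> \<bar>\<xi>\<bar>\<close> there. Harmonic measure of the slit disc
  of radius about \<open>\<bar>\<xi>\<bar>\<^sup>2\<close>, together with \<open>a(\<xi>) > exp (- \<bar>\<xi>\<bar> / Q)\<close> and \<open>\<bar>\<eta>\<bar> \<le> C\<^sub>2 / \<bar>\<xi>\<bar>\<close>, bounds it by
  \<open>2 a(\<xi>)\<close> for \<open>\<bar>z\<bar> \<le> 9\<close> as soon as \<open>Q \<ge> K B\<close>, and Cauchy's estimate then gives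
  \<open>\<bar>\<F>u(\<xi> + \<i>\<eta>) - \<F>u(\<xi>)\<bar> \<le> a(\<xi>) / 4\<close>. In the nonlinear term only one factor of the convolution is
  shifted to the complex domain, so it is bounded by a multiple of \<open>a * \<dots> * a (\<xi>) + a(\<xi>)\<close>, hence of \<open>a(\<xi>)\<close>.
\<close>

section \<open>Harmonic measure estimates on half discs and slit discs\<close>

text \<open>The majorant controls only a half-line, because the maximum norm may drop in the
  opposite direction. Near the tip of a slit, harmonic measure at distance r in a disc of radius R
  is of order sqrt (r / R) rather than r / R. Write x for the norm of \<xi>. The logarithm of the
  ratio of the two bounds is of order x / Q as long as the exponential type, of order B / x, times R
  stays below x / Q. This permits R of order x^2 / (B Q), and (x / Q) / sqrt R is then of order sqrt
  (B / Q): independent of x, and small when Q is large against B. In the convolution, frequencies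
  \<zeta> beyond \<xi> occur, where a(\<zeta>) may be far below exp (- x / Q). There a(\<zeta>) is
  replaced by a(\<xi>), which is the origin of the second term in the bound for the nonlinearity.
  Duhamel's formula is an identity in H^s, with an integral that is a limit in norm, so it cannot
  simply be evaluated at a complex frequency. The integral is replaced by Riemann sums: the
  resulting defect is entire on each complex line, small on a real segment and bounded on a circle
  uniformly in the partition, so it stays small at \<xi> + i\<eta>.\<close>

lemma half_disc_bound:
  fixes h :: "complex \<Rightarrow> complex"
  assumes hol: "h holomorphic_on UNIV"
    and R: "R > 0" and m: "m \<ge> 0" and L: "L \<ge> 0"
    and diam: "\<And>x. \<bar>x\<bar> \<le> R \<Longrightarrow> cmod (h (of_real x)) \<le> m"
    and arc: "\<And>w. cmod w = R \<Longrightarrow> cmod (h w) \<le> m * exp L"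
    and w: "cmod w \<le> R" "Im w \<ge> 0"
  shows "cmod (h w) \<le> m * exp (L * ((cmod w / R)\<^sup>2 + 2 * (cmod w / R)))"
proof -
  \<comment> \<open>\<open>Re q\<close> is nonnegative on the diameter and at least 1 on the arc, so it majorizes the
    harmonic measure of the arc and yet vanishes at the centre.\<close>
  define q where "q = (\<lambda>z. (z / of_real R)\<^sup>2 - 2 * \<i> * (z / of_real R))"
  define f where "f = (\<lambda>z. h z * exp (- of_real L * q z))"
  define S where "S = {z. cmod z \<le> R \<and> Im z \<ge> 0}"
  have Req: "Re (q z) = (Re z / R)\<^sup>2 - (Im z / R)\<^sup>2 + 2 * (Im z / R)" for z
    by (simp add: q_def power2_eq_square diff_divide_distrib)
  have nf: "cmod (f z) = cmod (h z) * exp (- L * Re (q z))" for z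
    by (simp add: f_def norm_mult)
  have holf: "f holomorphic_on UNIV"
    unfolding f_def q_def using hol R by (intro holomorphic_intros) auto
  have comp: "compact S"
  proof -
    have "S = cball 0 R \<inter> {z. Im z \<ge> 0}" by (auto simp: S_def)
    moreover have "closed {z. Im z \<ge> 0}"
      using closed_halfspace_Im_ge by simp
    ultimately show ?thesis by (simp add: compact_Int_closed)
  qed
  have fr: "cmod (f z) \<le> m" if z: "z \<in> frontier S" for z
  proof -
    have zS: "z \<in> S" using z comp by (simp add: compact_imp_closed frontier_def)
    have "z \<notin> interior S" using z by (simp add: frontier_def)
    moreover have "{z. cmod z < R \<and> Im z > 0} \<subseteq> interior S"
    proof (rule interior_maximal)
      show "{z. cmod z < R \<and> Im z > 0} \<subseteq> S" by (auto simp: S_def)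
      have "{z. cmod z < R \<and> Im z > 0} = ball 0 R \<inter> {z. Im z > 0}" by auto
      then show "open {z. cmod z < R \<and> Im z > 0}"
        using open_halfspace_Im_gt[of 0] by (simp add: open_Int)
    qed
    ultimately have "\<not> (cmod z < R \<and> Im z > 0)" by blast
    then consider "cmod z = R" | "Im z = 0" using zS unfolding S_def by force
    then show ?thesis
    proof cases
      case 1
      have ns: "(Re z / R)\<^sup>2 + (Im z / R)\<^sup>2 = 1"
        using 1 R by (simp add: power_divide add_divide_distrib[symmetric] cmod_power2[symmetric])
      \<comment> \<open>On the arc, with \<open>y = Im z / R\<close>, one has
        \<open>Re (q z) = 1 + 2 * y * (1 - y)\<close>, which is at least 1 for
        \<open>0 \<le> y \<le> 1\<close>.\<close>
      have "0 \<le> Im z / R" "Im z / R \<le> 1"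
        using zS R abs_Im_le_cmod[of z] by (auto simp: S_def)
      then have "(Im z / R) * (Im z / R) \<le> Im z / R"
        using mult_left_le[of "Im z / R" "Im z / R"] by blast
      then have "Re (q z) \<ge> 1" using ns by (simp add: Req power2_eq_square)
      then have "L * 1 \<le> L * Re (q z)" using L by (intro mult_left_mono)
      then have "exp (- L * Re (q z)) \<le> exp (- L)" by simp
      then have "cmod (f z) \<le> (m * exp L) * exp (- L)"
        unfolding nf using arc[OF 1] m by (intro mult_mono) auto
      then show ?thesis by (simp add: mult.assoc exp_add[symmetric])
    next
      case 2
      then have zr: "z = of_real (Re z)" by (simp add: complex_eq_iff)
      have "\<bar>Re z\<bar> \<le> R" using abs_Re_le_cmod[of z] zS by (simp add: S_def)
      then have 1: "cmod (h z) \<le> m" using diam zr by metis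
      have "L * Re (q z) \<ge> 0" using 2 L by (simp add: Req)
      then have "cmod (f z) \<le> m * 1"
        unfolding nf using 1 m by (intro mult_mono) auto
      then show ?thesis by simp
    qed
  qed
  have "cmod (f w) \<le> m"
  proof (rule maximum_modulus_frontier[of f S])
    show "f holomorphic_on interior S" using holf holomorphic_on_subset by blast
    show "continuous_on (closure S) f" using holf holomorphic_on_imp_continuous_on
        continuous_on_subset by blast
    show "bounded S" using comp compact_imp_bounded by blast
    show "w \<in> S" using w by (simp add: S_def)
  qed (use fr in auto)
  then have 1: "cmod (h w) * exp (- L * Re (q w)) \<le> m" by (simp add: nf)
  have "cmod (h w) = cmod (h w) * exp (- L * Re (q w)) * exp (L * Re (q w))"
    by (simp add: mult.assoc exp_add[symmetric])
  also have "\<dots> \<le> m * exp (L * Re (q w))" using 1 by (intro mult_right_mono) auto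
  also have "\<dots> \<le> m * exp (L * ((cmod w / R)\<^sup>2 + 2 * (cmod w / R)))"
  proof -
    have "(Re w / R)\<^sup>2 \<le> (cmod w / R)\<^sup>2"
      using abs_Re_le_cmod[of w] R by (simp add: power_divide divide_right_mono abs_le_square_iff[symmetric])
    moreover have "Im w / R \<le> cmod w / R" using abs_Im_le_cmod[of w] R by (simp add: divide_right_mono)
    ultimately have "Re (q w) \<le> (cmod w / R)\<^sup>2 + 2 * (cmod w / R)"
      unfolding Req using zero_le_power2[of "Im w / R"] by linarith
    then show ?thesis using m L by (simp add: mult_left_mono)
  qed
  finally show ?thesis .
qed

lemma slit_bound:
  fixes g :: "complex \<Rightarrow> complex"
  assumes hol: "g holomorphic_on UNIV"
    and R: "R > 0" and m: "m \<ge> 0" and L: "L \<ge> 0"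
    and slit: "\<And>x. 0 \<le> x \<Longrightarrow> cmod (g (of_real x)) \<le> m"
    and circ: "\<And>z. cmod z = R \<Longrightarrow> cmod (g z) \<le> m * exp L"
    and z: "cmod z \<le> R"
  shows "cmod (g z) \<le> m * exp (L * (cmod z / R + 2 * sqrt (cmod z / R)))"
proof -
  \<comment> \<open>\<open>w \<mapsto> w\<^sup>2\<close> opens the slit disc into a half disc.\<close>
  define h where "h = (\<lambda>w. g (w\<^sup>2))"
  obtain w where w: "w\<^sup>2 = z" "Im w \<ge> 0"
  proof (cases "Im (csqrt z) \<ge> 0")
    case True then show ?thesis using that[of "csqrt z"] by simp
  next
    case False then show ?thesis using that[of "- csqrt z"] by simp
  qed
  have cw: "cmod w = sqrt (cmod z)" using w by (metis norm_power norm_ge_zero real_sqrt_unique)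
  have "cmod (h w) \<le> m * exp (L * ((cmod w / sqrt R)\<^sup>2 + 2 * (cmod w / sqrt R)))"
  proof (rule half_disc_bound)
    have "(\<lambda>w::complex. w\<^sup>2) holomorphic_on UNIV" by (intro holomorphic_intros)
    then show "h holomorphic_on UNIV"
      using holomorphic_on_compose_gen[of "\<lambda>w. w\<^sup>2" UNIV g UNIV] hol
      by (simp add: o_def h_def)
    show "cmod (h (of_real x)) \<le> m" for x
      using slit[of "x\<^sup>2"] by (simp add: h_def)
    show "cmod (h w) \<le> m * exp L" if "cmod w = sqrt R" for w
      using circ[of "w\<^sup>2"] that R by (simp add: h_def norm_power)
  qed (use R m L w cw z in auto)
  then show ?thesis
    using R by (simp add: h_def w cw power_divide real_sqrt_divide)
qed

text \<open>\<open>small\<close> keeps the exponential factor of the slit estimate below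
  \<open>exp (1/2) \<le> 2\<close> on the disc of radius 9. Circles of radius 8 about points of the
  unit disc stay inside that disc, so Cauchy's estimate bounds the derivative by
  \<open>2 * m / 8 = m / 4\<close>.\<close>

lemma slit_variation:
  fixes g :: "complex \<Rightarrow> complex"
  assumes hol: "g holomorphic_on UNIV"
    and R: "R \<ge> 9" and m: "m \<ge> 0" and L: "L \<ge> 0"
    and slit: "\<And>x. 0 \<le> x \<Longrightarrow> cmod (g (of_real x)) \<le> m"
    and circ: "\<And>z. cmod z = R \<Longrightarrow> cmod (g z) \<le> m * exp L"
    and small: "L * (9 / R + 2 * sqrt (9 / R)) \<le> 1 / 2"
  shows "cmod z \<le> 9 \<Longrightarrow> cmod (g z) \<le> 2 * m"
    and "cmod (z - w) \<le> 1 \<Longrightarrow> cmod z \<le> 1 \<Longrightarrow> cmod w \<le> 1 \<Longrightarrow> cmod (g z - g w) \<le> m / 4"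
proof -
  have e2: "exp (1/2::real) \<le> 2"
    using exp_bound[of "1/2"] by (simp add: power2_eq_square)
  have bd: "cmod (g z) \<le> 2 * m" if z: "cmod z \<le> 9" for z
  proof -
    have "cmod (g z) \<le> m * exp (L * (cmod z / R + 2 * sqrt (cmod z / R)))"
      using assms z by (intro slit_bound) auto
    also have "\<dots> \<le> m * exp (L * (9 / R + 2 * sqrt (9 / R)))"
      using z R m L by (intro mult_left_mono iffD2[OF exp_le_cancel_iff] add_mono real_sqrt_le_mono divide_right_mono) auto
    also have "\<dots> \<le> m * exp (1/2)" using small m by (intro mult_left_mono) auto
    also have "\<dots> \<le> m * 2" using e2 m by (intro mult_left_mono) auto
    finally show ?thesis by simp
  qed
  then show "cmod z \<le> 9 \<Longrightarrow> cmod (g z) \<le> 2 * m" .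
  have der: "cmod (deriv g z) \<le> m / 4" if z: "cmod z \<le> 1" for z
  proof -
    have "cmod ((deriv ^^ 1) g z) \<le> fact 1 * (2 * m) / 8 ^ 1"
    proof (rule Cauchy_inequality)
      show "cmod (g y) \<le> 2 * m" if "cmod (z - y) = 8" for y
        using norm_triangle_ineq4[of z "z - y"] that z by (intro bd) simp
      show "continuous_on (cball z 8) g"
        using hol holomorphic_on_imp_continuous_on continuous_on_subset by blast
      show "g holomorphic_on ball z 8" using hol holomorphic_on_subset by blast
    qed simp
    then show ?thesis by simp
  qed
  show "cmod (g z - g w) \<le> m / 4" if "cmod (z - w) \<le> 1" "cmod z \<le> 1" "cmod w \<le> 1"
  proof -
    have "cmod (g z - g w) \<le> (m / 4) * cmod (z - w)"
    proof (rule field_differentiable_bound[of "cball 0 1"])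
      show "(g has_field_derivative deriv g y) (at y within cball 0 1)" for y
        using hol holomorphic_derivI[of g UNIV y] by (simp add: has_field_derivative_at_within)
    qed (use der that in auto)
    also have "\<dots> \<le> (m / 4) * 1" using that m by (intro mult_left_mono) auto
    finally show ?thesis by simp
  qed
qed

text \<open>At \<open>\<i>\<close> in the half disc of radius 5 the exponent is
  \<open>1/25 + 2/5 = 0.44\<close>, below \<open>1/2\<close>, so the geometric mean of the two
  bounds is an upper bound. A function that is arbitrarily small on the segment and merely bounded
  on the circle is thus arbitrarily small at \<open>\<i>\<close>.\<close>

lemma two_constants_bound:
  fixes h :: "complex \<Rightarrow> complex"
  assumes hol: "h holomorphic_on UNIV"
    and m: "m > 0" and mA: "m \<le> A"
    and diam: "\<And>x. \<bar>x\<bar> \<le> 5 \<Longrightarrow> cmod (h (of_real x)) \<le> m"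
    and arc: "\<And>w. cmod w = 5 \<Longrightarrow> cmod (h w) \<le> A"
  shows "cmod (h \<i>) \<le> sqrt (m * A)"
proof -
  define L where "L = ln (A / m)"
  have L: "L \<ge> 0" using m mA by (simp add: L_def)
  have eL: "exp L = A / m" using m mA by (simp add: L_def)
  have "cmod (h \<i>) \<le> m * exp (L * ((cmod \<i> / 5)\<^sup>2 + 2 * (cmod \<i> / 5)))"
    using assms L eL by (intro half_disc_bound) auto
  also have "\<dots> \<le> m * exp (L * (1 / 2))"
    using m L by (intro mult_left_mono iffD2[OF exp_le_cancel_iff]) (auto simp: power2_eq_square)
  also have "exp (L * (1/2)) = sqrt (A / m)"
  proof -
    have "(exp (L * (1/2)))\<^sup>2 = A / m" by (simp add: eL exp_double[symmetric])
    then show ?thesis by (metis exp_ge_zero real_sqrt_unique)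
  qed
  also have "m * sqrt (A / m) = sqrt (m * A)"
    using m mA by (simp add: real_sqrt_divide real_sqrt_mult field_simps)
  finally show ?thesis .
qed

section \<open>Gaussians and Fourier inversion\<close>

text \<open>\<open>lborel\<close> is the image of a product of one-dimensional measures. There are
  two uses: the Gaussian times an exponential, and a product of factors
  \<open>1 / (1 + t\<^sup>2)\<close> that dominates the Sobolev weight.\<close>

lemma lborel_prod_Basis:
  fixes f :: "'a::euclidean_space \<Rightarrow> real \<Rightarrow> complex"
  assumes int: "\<And>b. b \<in> Basis \<Longrightarrow> integrable lborel (f b)"
  shows lborel_integrable_prod: "integrable lborel (\<lambda>x::'a. \<Prod>b\<in>Basis. f b (x \<bullet> b))"
    and lborel_integral_prod: "(LINT x::'a|lborel. (\<Prod>b\<in>Basis. f b (x \<bullet> b))) = (\<Prod>b\<in>Basis. integral\<^sup>L lborel (f b))"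
proof -
  interpret product_sigma_finite "\<lambda>b::'a. lborel :: real measure" by standard
  have m[measurable]: "f b \<in> borel_measurable borel" if "b \<in> Basis" for b
    using int[OF that] by simp
  have m1: "(\<lambda>x::'a. \<Prod>b\<in>Basis. f b (x \<bullet> b)) \<in> borel_measurable borel"
    by measurable
  have m2: "(\<lambda>f. \<Sum>b\<in>Basis. f b *\<^sub>R b :: 'a) \<in> Pi\<^sub>M Basis (\<lambda>b. lborel) \<rightarrow>\<^sub>M borel"
    by measurable
  have eq: "(\<Prod>b\<in>Basis. f b ((\<Sum>b\<in>Basis. y b *\<^sub>R b :: 'a) \<bullet> b)) = (\<Prod>b\<in>Basis. f b (y b))" for y :: "'a \<Rightarrow> real"
    by (intro prod.cong refl) (simp add: inner_sum_left_Basis)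
  have D: "(lborel :: 'a measure) = distr (Pi\<^sub>M Basis (\<lambda>b. lborel)) borel (\<lambda>f. \<Sum>b\<in>Basis. f b *\<^sub>R b)"
    unfolding lborel_eq_real by (rule lborel_def)
  show "integrable lborel (\<lambda>x::'a. \<Prod>b\<in>Basis. f b (x \<bullet> b))"
    unfolding D integrable_distr_eq[OF m2 m1] eq
    by (rule product_integrable_prod) (use int in auto)
  show "(LINT x::'a|lborel. (\<Prod>b\<in>Basis. f b (x \<bullet> b))) = (\<Prod>b\<in>Basis. integral\<^sup>L lborel (f b))"
    unfolding D integral_distr[OF m2 m1] eq
    by (rule product_integral_prod) (use int in auto)
qed

section \<open>Changes of variable and Fubini's theorem for bounded kernels\<close>

lemma lborel_integral_affine:
  fixes f :: "'a::euclidean_space \<Rightarrow> 'b::{banach, second_countable_topology}"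
  assumes [measurable]: "f \<in> borel_measurable borel" and c: "c \<noteq> 0"
  shows "(LINT x|lborel. f x) = \<bar>c\<bar> ^ DIM('a) *\<^sub>R (LINT x|lborel. f (t + c *\<^sub>R x))"
    and "integrable lborel f \<longleftrightarrow> integrable lborel (\<lambda>x. f (t + c *\<^sub>R x))"
proof -
  have eq: "lborel = density (distr lborel borel (\<lambda>x::'a. t + c *\<^sub>R x)) (\<lambda>_. ennreal (\<bar>c\<bar>^DIM('a)))"
    using lborel_affine[OF c, of t] by (simp add: ennreal_power)
  show "(LINT x|lborel. f x) = \<bar>c\<bar> ^ DIM('a) *\<^sub>R (LINT x|lborel. f (t + c *\<^sub>R x))"
    by (subst eq, subst integral_density) (auto simp: integral_distr)
  show "integrable lborel f \<longleftrightarrow> integrable lborel (\<lambda>x. f (t + c *\<^sub>R x))"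
  proof -
    have "integrable lborel f \<longleftrightarrow> integrable lborel (\<lambda>x. \<bar>c\<bar> ^ DIM('a) *\<^sub>R f (t + c *\<^sub>R x))"
      by (subst eq, subst integrable_density) (auto simp: integrable_distr_eq)
    also have "\<dots> \<longleftrightarrow> integrable lborel (\<lambda>x. f (t + c *\<^sub>R x))"
      using integrable_scaleR_right[of "inverse (\<bar>c\<bar> ^ DIM('a))" lborel "\<lambda>x. \<bar>c\<bar> ^ DIM('a) *\<^sub>R f (t + c *\<^sub>R x)"] c
      by auto
    finally show ?thesis .
  qed
qed

lemma lborel_integral_translate:
  fixes f :: "'a::euclidean_space \<Rightarrow> 'b::{banach, second_countable_topology}"
  assumes "f \<in> borel_measurable borel"
  shows "(LINT x|lborel. f (t + x)) = (LINT x|lborel. f x)"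
    and "integrable lborel (\<lambda>x. f (t + x)) \<longleftrightarrow> integrable lborel f"
  using lborel_integral_affine[OF assms, of 1 t] by simp_all

lemma lborel_integral_reflect:
  fixes f :: "'a::euclidean_space \<Rightarrow> 'b::{banach, second_countable_topology}"
  assumes "f \<in> borel_measurable borel"
  shows "(LINT x|lborel. f (t - x)) = (LINT x|lborel. f x)"
    and "integrable lborel (\<lambda>x. f (t - x)) \<longleftrightarrow> integrable lborel f"
  using lborel_integral_affine[OF assms, of "-1" t] by simp_all

text \<open>In the inversion theorem and in the transform of a product, the double integrals pair
  two integrable weights with a kernel of modulus at most 1, an exponential or a Gaussian.
  Domination by \<open>C\<close> times the tensor product settles all of these exchanges at
  once.\<close>

lemma integrable_kernel:
  fixes f g :: "'a::euclidean_space \<Rightarrow> complex"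
  assumes f: "integrable lborel f" and g: "integrable lborel g"
    and k[measurable]: "(\<lambda>(x, y). k x y) \<in> borel_measurable (borel \<Otimes>\<^sub>M borel)"
    and bd: "\<And>x y. cmod (k x y) \<le> C"
  shows "integrable (lborel \<Otimes>\<^sub>M lborel) (\<lambda>(x, y). f x * g y * k x y)"
proof -
  have [measurable]: "f \<in> borel_measurable borel" "g \<in> borel_measurable borel"
    using f g by auto
  have C: "C \<ge> 0" using bd[of undefined undefined] norm_ge_zero order_trans by blast
  have "integrable (lborel \<Otimes>\<^sub>M lborel) (\<lambda>(x, y). f x * g y)"
  proof (rule lborel_pair.Fubini_integrable)
    show "integrable lborel (\<lambda>x. LINT y|lborel. norm (case (x, y) of (x, y) \<Rightarrow> f x * g y))"
      using f by (simp add: norm_mult)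
  qed (use g in auto)
  then have 1: "integrable (lborel \<Otimes>\<^sub>M lborel) (\<lambda>(x, y). C *\<^sub>R (f x * g y))"
    using integrable_scaleR_right[of C "lborel \<Otimes>\<^sub>M lborel" "\<lambda>(x, y). f x * g y"]
    unfolding case_prod_beta by blast
  show ?thesis
  proof (rule Bochner_Integration.integrable_bound[OF 1])
    show "AE p in lborel \<Otimes>\<^sub>M lborel. norm (case p of (x, y) \<Rightarrow> f x * g y * k x y) \<le> norm (case p of (x, y) \<Rightarrow> C *\<^sub>R (f x * g y))"
      using bd C by (intro AE_I2) (auto simp: norm_mult mult.commute[of C] intro!: mult_left_mono)
    have "(\<lambda>(x, y). k x y) \<in> borel_measurable (lborel \<Otimes>\<^sub>M lborel)"
      using k by simp
    then show "(\<lambda>(x, y). f x * g y * k x y) \<in> borel_measurable (lborel \<Otimes>\<^sub>M lborel)"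
      by (simp add: case_prod_beta)
  qed
qed

lemma fubini_kernel:
  fixes f g :: "'a::euclidean_space \<Rightarrow> complex"
  assumes f: "integrable lborel f" and g: "integrable lborel g"
    and k: "(\<lambda>(x, y). k x y) \<in> borel_measurable (borel \<Otimes>\<^sub>M borel)"
    and bd: "\<And>x y. cmod (k x y) \<le> C"
  shows "(LINT x|lborel. f x * (LINT y|lborel. g y * k x y)) = (LINT y|lborel. g y * (LINT x|lborel. f x * k x y))"
proof -
  have "(LINT x|lborel. f x * (LINT y|lborel. g y * k x y)) = (LINT x|lborel. (LINT y|lborel. f x * g y * k x y))"
    by (simp only: mult.assoc integral_mult_right_zero)
  also have "\<dots> = (LINT y|lborel. (LINT x|lborel. f x * g y * k x y))"
    using lborel_pair.Fubini_integral[OF integrable_kernel[OF assms]] by simp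
  also have "\<dots> = (LINT y|lborel. g y * (LINT x|lborel. f x * k x y))"
    by (simp only: mult.assoc mult.left_commute[of "f _"] integral_mult_right_zero)
  finally show ?thesis .
qed

lemma integrable_times_bounded:
  fixes f :: "'a::euclidean_space \<Rightarrow> complex"
  assumes f: "integrable lborel f" and k: "k \<in> borel_measurable borel" and bd: "\<And>x. cmod (k x) \<le> C"
  shows "integrable lborel (\<lambda>x. f x * k x)"
proof (rule Bochner_Integration.integrable_bound)
  show "integrable lborel (\<lambda>x. C *\<^sub>R f x)" using f by simp
  have C: "C \<ge> 0" using bd[of undefined] norm_ge_zero order_trans by blast
  show "AE x in lborel. norm (f x * k x) \<le> norm (C *\<^sub>R f x)"
    using bd C by (intro AE_I2) (auto simp: norm_mult mult.commute[of C] intro!: mult_left_mono)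
qed (use f k in simp)

section \<open>Fourier integrals of integrable functions\<close>

lemma integrable_fourier_kernel:
  fixes f :: "real ^ 'd::finite \<Rightarrow> complex"
  assumes "integrable lborel f"
  shows "integrable lborel (\<lambda>x. f x * exp (- \<i> * of_real (x \<bullet> \<xi>)))"
  by (rule integrable_times_bounded[OF assms, where C=1]) auto

lemma continuous_fourier:
  fixes f :: "real ^ 'd::finite \<Rightarrow> complex"
  assumes f: "integrable lborel f"
  shows "continuous_on UNIV (fourier f)"
  unfolding continuous_on_def
proof (intro ballI)
  fix \<xi> :: "real ^ 'd"
  show "(fourier f \<longlongrightarrow> fourier f \<xi>) (at \<xi> within UNIV)"
    unfolding tendsto_at_iff_sequentially
  proof (intro allI impI)
    fix X :: "nat \<Rightarrow> real ^ 'd" assume X: "X \<longlonglongrightarrow> \<xi>"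
    show "((fourier f) \<circ> X) \<longlonglongrightarrow> fourier f \<xi>"
      unfolding fourier_def o_def
    proof (rule integral_dominated_convergence[where w="\<lambda>x. cmod (f x)"])
      show "AE x in lborel. (\<lambda>i. f x * exp (- \<i> * of_real (x \<bullet> X i))) \<longlonglongrightarrow> f x * exp (- \<i> * of_real (x \<bullet> \<xi>))"
        by (intro AE_I2 tendsto_intros X)
    qed (use f in \<open>auto simp: norm_mult\<close>)
  qed
qed

lemma fourier_measurable [measurable]:
  fixes f :: "real ^ 'd::finite \<Rightarrow> complex"
  assumes "integrable lborel f"
  shows "fourier f \<in> borel_measurable borel"
  using continuous_fourier[OF assms] by (rule borel_measurable_continuous_onI)

lemma fourier_bound:
  fixes f :: "real ^ 'd::finite \<Rightarrow> complex"
  shows "cmod (fourier f \<xi>) \<le> (LINT x|lborel. cmod (f x))"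
  unfolding fourier_def by (rule order_trans[OF integral_norm_bound]) (simp add: norm_mult)

section \<open>The Gaussian, its transform, and uniqueness of Fourier transforms\<close>

definition gaussian :: "real ^ 'd::finite \<Rightarrow> complex" where
  "gaussian x = of_real (exp (- (norm x)\<^sup>2 / 2))"

text \<open>Read off from the characteristic function of the standard normal distribution, taken at
  \<open>- t\<close> because \<open>char\<close> uses the exponential with positive sign;
  \<open>sqrt (2 * pi)\<close> undoes the normalization of the density.\<close>

lemma gaussian_1d:
  shows "integrable lborel (\<lambda>x. of_real (exp (- x\<^sup>2 / 2)) * exp (- \<i> * of_real (x * t)) :: complex)"
    and "(LINT x|lborel. of_real (exp (- x\<^sup>2 / 2)) * exp (- \<i> * of_real (x * t))) = complex_of_real (sqrt (2 * pi) * exp (- t\<^sup>2 / 2))"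
proof -
  have i0: "integrable lborel (\<lambda>x. std_normal_density x)"
    by (rule integrable_normal_density) simp
  have e: "exp (- x\<^sup>2 / 2) = sqrt (2 * pi) * std_normal_density x" for x :: real
    by (simp add: std_normal_density_def)
  have i1: "integrable lborel (\<lambda>x. exp (- x\<^sup>2 / 2) :: real)"
    unfolding e using i0 by simp
  then have i2: "integrable lborel (\<lambda>x. complex_of_real (exp (- x\<^sup>2 / 2)))"
    by (rule integrable_of_real)
  show "integrable lborel (\<lambda>x. of_real (exp (- x\<^sup>2 / 2)) * exp (- \<i> * of_real (x * t)) :: complex)"
    by (rule integrable_times_bounded[OF i2, where C=1]) auto
  have "complex_of_real (exp (- ((- t)\<^sup>2) / 2)) = char std_normal_distribution (- t)"
    by (simp add: char_std_normal_distribution)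
  also have "\<dots> = (LINT x|lborel. std_normal_density x *\<^sub>R iexp (- t * x))"
    unfolding char_def by (subst integral_density) (auto simp: normal_density_nonneg)
  finally have "complex_of_real (sqrt (2 * pi) * exp (- t\<^sup>2 / 2)) = of_real (sqrt (2 * pi)) * (LINT x|lborel. std_normal_density x *\<^sub>R iexp (- t * x))"
    by simp
  also have "\<dots> = (LINT x|lborel. of_real (sqrt (2 * pi)) * (std_normal_density x *\<^sub>R iexp (- t * x)))"
    by (simp only: integral_mult_right_zero)
  also have "\<dots> = (LINT x|lborel. of_real (exp (- x\<^sup>2 / 2)) * exp (- \<i> * of_real (x * t)))"
    unfolding e by (intro Bochner_Integration.integral_cong refl) (simp add: scaleR_conv_of_real mult_ac)
  finally show "(LINT x|lborel. of_real (exp (- x\<^sup>2 / 2)) * exp (- \<i> * of_real (x * t))) = complex_of_real (sqrt (2 * pi) * exp (- t\<^sup>2 / 2))"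
    by simp
qed

lemma gaussian_prod:
  "gaussian x * exp (- \<i> * of_real (x \<bullet> \<xi>)) =
    (\<Prod>b\<in>Basis. of_real (exp (- (x \<bullet> b)\<^sup>2 / 2)) * exp (- \<i> * of_real ((x \<bullet> b) * (\<xi> \<bullet> b))))"
proof -
  have "(norm x)\<^sup>2 = (\<Sum>b\<in>Basis. (x \<bullet> b)\<^sup>2)"
    unfolding power2_norm_eq_inner by (subst euclidean_inner) (simp add: power2_eq_square)
  then have 1: "gaussian x = (\<Prod>b\<in>Basis. of_real (exp (- (x \<bullet> b)\<^sup>2 / 2)))"
    by (simp add: gaussian_def exp_sum[symmetric] sum_negf sum_divide_distrib flip: of_real_prod)
  have 2: "exp (- \<i> * complex_of_real (x \<bullet> \<xi>)) = (\<Prod>b\<in>Basis. exp (- \<i> * of_real ((x \<bullet> b) * (\<xi> \<bullet> b))))"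
    by (simp add: exp_sum[symmetric] euclidean_inner[of x \<xi>] sum_negf sum_distrib_left)
  show ?thesis by (simp only: 1 2 prod.distrib)
qed

text \<open>The total mass of \<open>gaussian\<close>, whose square is the constant of Fourier
  inversion. The type argument only transmits the dimension.\<close>

definition gauss_mass :: "'d::finite itself \<Rightarrow> real" where
  "gauss_mass _ = sqrt (2 * pi) ^ CARD('d)"

text \<open>Allows the factor \<open>1 / (gauss_mass TYPE('d))\<^sup>2\<close> to be dropped from
  upper bounds for inverse transforms and for transforms of products.\<close>

lemma gauss_mass_ge_1: "gauss_mass TYPE('d::finite) \<ge> 1"
proof -
  have "sqrt (2 * pi) \<ge> 1" using pi_gt3 by (intro real_le_rsqrt) simp
  then show ?thesis by (simp add: gauss_mass_def)
qed

lemma integrable_gaussian_kernel: "integrable lborel (\<lambda>x::real^'d::finite. gaussian x * exp (- \<i> * of_real (x \<bullet> \<xi>)))"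
  unfolding gaussian_prod
  by (rule lborel_integrable_prod[where f="\<lambda>b t. of_real (exp (- t\<^sup>2 / 2)) * exp (- \<i> * of_real (t * (\<xi> \<bullet> b)))"])
    (rule gaussian_1d)

lemma integrable_gaussian: "integrable lborel (gaussian :: real^'d::finite \<Rightarrow> complex)"
  using integrable_gaussian_kernel[of 0] by simp

lemma gaussian_measurable [measurable]: "(gaussian :: real^'d::finite \<Rightarrow> complex) \<in> borel_measurable borel"
  using borel_measurable_integrable[OF integrable_gaussian] by simp

lemma fourier_gaussian:
  "fourier gaussian (\<xi> :: real ^ 'd::finite) = of_real (gauss_mass TYPE('d)) * gaussian \<xi>"
proof -
  have "fourier gaussian \<xi> = (\<Prod>b\<in>Basis. LINT t|lborel. of_real (exp (- t\<^sup>2 / 2)) * exp (- \<i> * of_real (t * (\<xi> \<bullet> b))))"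
    unfolding fourier_def gaussian_prod
    by (rule lborel_integral_prod[where f="\<lambda>b t. of_real (exp (- t\<^sup>2 / 2)) * exp (- \<i> * of_real (t * (\<xi> \<bullet> b)))"])
      (rule gaussian_1d)
  also have "\<dots> = (\<Prod>b\<in>Basis. complex_of_real (sqrt (2 * pi)) * of_real (exp (- (\<xi> \<bullet> b)\<^sup>2 / 2)))"
    by (intro prod.cong refl, subst gaussian_1d(2)) simp
  also have "\<dots> = of_real (sqrt (2 * pi)) ^ CARD('d) * (\<Prod>b\<in>Basis. of_real (exp (- (\<xi> \<bullet> b)\<^sup>2 / 2)))"
    by (simp add: prod.distrib)
  also have "\<dots> = of_real (gauss_mass TYPE('d)) * gaussian \<xi>"
    using gaussian_prod[of \<xi> 0] by (simp add: gauss_mass_def)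
  finally show ?thesis .
qed

text \<open>Lebesgue's differentiation theorem: off a negligible set, \<open>H x\<close> is the
  limit of averages over the shrinking cubes with corner \<open>x\<close>, and all these averages
  vanish.\<close>

lemma AE_eq_0_of_cbox_integrals:
  fixes H :: "'a::euclidean_space \<Rightarrow> complex"
  assumes H: "integrable lborel H"
    and zero: "\<And>a b. (LINT x|lborel. indicator (cbox a b) x *\<^sub>R H x) = 0"
  shows "AE x in lborel. H x = 0"
proof -
  have si: "set_integrable lborel (cbox a b) H" for a b
    unfolding set_integrable_def using H by (intro integrable_mult_indicator) auto
  have io: "H integrable_on cbox a b" for a b
    using si by (rule set_borel_integral_eq_integral)
  have iz: "integral (cbox a b) H = 0" for a b
    using set_borel_integral_eq_integral(2)[OF si] zero by (simp add: set_lebesgue_integral_def)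
  obtain N where N: "negligible N"
    "\<And>x e. \<lbrakk>x \<notin> N; 0 < e\<rbrakk> \<Longrightarrow> \<exists>d>0. \<forall>h. 0 < h \<and> h < d \<longrightarrow>
        norm (integral (cbox x (x + h *\<^sub>R One)) H /\<^sub>R h ^ DIM('a) - H x) < e"
    using integrable_ccontinuous_explicit[OF io] by metis
  have "H x = 0" if xN: "x \<notin> N" for x
  proof (rule ccontr)
    assume "H x \<noteq> 0"
    then obtain d where d: "d > 0" "\<forall>h. 0 < h \<and> h < d \<longrightarrow>
        norm (integral (cbox x (x + h *\<^sub>R One)) H /\<^sub>R h ^ DIM('a) - H x) < norm (H x)"
      using N(2)[OF xN, of "norm (H x)"] by auto
    then show False using d(2)[rule_format, of "d/2"] by (simp add: iz)
  qed
  then have "AE x in lebesgue. H x = 0"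
    using N(1) unfolding negligible_iff_null_sets by (intro AE_I'[of N]) auto
  then show ?thesis by (simp add: AE_completion_iff)
qed

lemma AE_not_in_cbox_boundary: "AE x in lborel. x \<notin> cbox a b - box a (b :: 'a::euclidean_space)"
proof -
  have "cbox a b - box a b \<in> null_sets (completion lborel)"
    using negligible_frontier_interval negligible_iff_null_sets by blast
  then have "cbox a b - box a b \<in> null_sets lborel"
    by (subst (asm) null_sets_completion_iff) auto
  then show ?thesis by (rule AE_not_in)
qed

text \<open>The Gaussian is a multiple of its own transform, so by Fubini the integral of
  \<open>H\<close> against any translated and dilated Gaussian is a superposition of values of
  \<open>fourier H\<close>, hence zero. Averaging the centre over a box and shrinking the width
  recovers, up to the factor \<kappa>, the integral of \<open>H\<close> over the box.\<close>

lemma fourier_eq_0_imp_AE_0: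
  fixes H :: "real ^ 'd::finite \<Rightarrow> complex"
  assumes H: "integrable lborel H" and zero: "\<And>\<xi>. fourier H \<xi> = 0"
  shows "AE x in lborel. H x = 0"
proof (rule AE_eq_0_of_cbox_integrals[OF H])
  fix a b :: "real ^ 'd"
  define K where "K = cbox a b"
  define \<kappa> where "\<kappa> = complex_of_real (gauss_mass TYPE('d))"
  have \<kappa>: "\<kappa> \<noteq> 0" using gauss_mass_ge_1[where 'd='d] by (auto simp: \<kappa>_def)
  have Hm[measurable]: "H \<in> borel_measurable borel" using H by simp
  have Km[measurable]: "K \<in> sets borel" by (simp add: K_def)
  have gi: "(LINT y|lborel. gaussian (y :: real ^ 'd)) = \<kappa>"
    using fourier_gaussian[of "0 :: real ^ 'd"] by (simp add: fourier_def \<kappa>_def gaussian_def)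
  have gb: "cmod (gaussian x) \<le> 1" for x :: "real ^ 'd" by (simp add: gaussian_def)
  \<comment> \<open>\<open>P n / \<kappa>\<close> is the convolution of the indicator of \<open>K\<close> with a Gaussian of width \<open>1 / (n + 1)\<close>.\<close>
  define P where "P = (\<lambda>n x. LINT y|lborel. indicator K (x + inverse (real (Suc n)) *\<^sub>R y) *\<^sub>R gaussian y)"
  have PH: "(LINT x|lborel. H x * P n x) = 0" for n
  proof -
    define r where "r = real (Suc n)"
    have r: "r > 0" by (simp add: r_def)
    have inner: "(LINT x|lborel. H x * gaussian (r *\<^sub>R (y - x))) = 0" for y
    proof -
      have "gaussian (r *\<^sub>R (y - x)) = (1 / \<kappa>) * (LINT z|lborel. gaussian z * exp (- \<i> * of_real (z \<bullet> (r *\<^sub>R (y - x)))))" for x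
        using fourier_gaussian[of "r *\<^sub>R (y - x)"] \<kappa> by (simp add: fourier_def \<kappa>_def)
      then have "(LINT x|lborel. H x * gaussian (r *\<^sub>R (y - x))) =
          (LINT x|lborel. (1 / \<kappa>) * (H x * (LINT z|lborel. gaussian z * exp (- \<i> * of_real (z \<bullet> (r *\<^sub>R (y - x)))))))"
        by (simp add: mult.left_commute)
      also have "\<dots> = (1 / \<kappa>) * (LINT x|lborel. H x * (LINT z|lborel. gaussian z * exp (- \<i> * of_real (z \<bullet> (r *\<^sub>R (y - x))))))"
        by (rule integral_mult_right_zero)
      also have "(LINT x|lborel. H x * (LINT z|lborel. gaussian z * exp (- \<i> * of_real (z \<bullet> (r *\<^sub>R (y - x)))))) =
          (LINT z|lborel. gaussian z * (LINT x|lborel. H x * exp (- \<i> * of_real (z \<bullet> (r *\<^sub>R (y - x))))))"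
        by (rule fubini_kernel[OF H integrable_gaussian, where C=1]) (auto simp: split_beta)
      also have "\<dots> = (LINT z|lborel. gaussian (z :: real ^ 'd) * 0)"
      proof (intro Bochner_Integration.integral_cong refl arg_cong2[where f="(*)"])
        fix z
        have "H x * exp (- \<i> * of_real (z \<bullet> (r *\<^sub>R (y - x)))) =
            exp (- \<i> * of_real (r * (z \<bullet> y))) * (H x * exp (- \<i> * of_real (x \<bullet> (- r *\<^sub>R z))))" for x
          by (simp add: inner_diff_right inner_commute exp_add[symmetric] algebra_simps)
        then have "(LINT x|lborel. H x * exp (- \<i> * of_real (z \<bullet> (r *\<^sub>R (y - x))))) =
            exp (- \<i> * of_real (r * (z \<bullet> y))) * fourier H (- r *\<^sub>R z)"
          unfolding fourier_def by (simp only: integral_mult_right_zero)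
        then show "(LINT x|lborel. H x * exp (- \<i> * of_real (z \<bullet> (r *\<^sub>R (y - x))))) = 0"
          by (simp only: zero mult_zero_right)
      qed
      finally show ?thesis by simp
    qed
    have "P n x = of_real (r ^ CARD('d)) * (LINT y|lborel. indicator K y * gaussian (r *\<^sub>R (y - x)))" for x
    proof -
      have "P n x = (LINT y|lborel. (\<lambda>y. indicator K y * gaussian (r *\<^sub>R (y - x))) (x + inverse r *\<^sub>R y))"
        unfolding P_def r_def[symmetric]
        using r by (intro Bochner_Integration.integral_cong refl) (simp add: indicator_def)
      then show ?thesis
        using r lborel_integral_affine(1)[of "\<lambda>y. indicator K y * gaussian (r *\<^sub>R (y - x))" "inverse r" x]
        by (simp add: scaleR_conv_of_real[where 'a=complex] power_inverse field_simps)
    qed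
    then have "(LINT x|lborel. H x * P n x) =
        (LINT x|lborel. of_real (r ^ CARD('d)) * (H x * (LINT y|lborel. indicator K y * gaussian (r *\<^sub>R (y - x)))))"
      by (simp only: mult.left_commute)
    also have "\<dots> = of_real (r ^ CARD('d)) * (LINT x|lborel. H x * (LINT y|lborel. indicator K y * gaussian (r *\<^sub>R (y - x))))"
      by (rule integral_mult_right_zero)
    also have "(LINT x|lborel. H x * (LINT y|lborel. indicator K y * gaussian (r *\<^sub>R (y - x)))) =
        (LINT y|lborel. indicator K y * (LINT x|lborel. H x * gaussian (r *\<^sub>R (y - x))))"
    proof (rule fubini_kernel[OF H, where C=1])
      have "integrable lborel (indicator K :: _ \<Rightarrow> real)"
        using emeasure_lborel_cbox_finite[of a b] by (intro integrable_real_indicator) (auto simp: K_def)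
      then have "integrable lborel (\<lambda>x. complex_of_real (indicator K x))" by (rule integrable_of_real)
      also have "(\<lambda>x. complex_of_real (indicator K x)) = indicator K"
        by (auto simp: indicator_def)
      finally show "integrable lborel (indicator K :: _ \<Rightarrow> complex)" .
    qed (auto simp: gb split_beta)
    also have "\<dots> = 0" by (simp only: inner mult_zero_right integral_zero)
    finally show ?thesis by simp
  qed
  have Pb: "cmod (P n x) \<le> (LINT y|lborel. cmod (gaussian (y :: real ^ 'd)))" for n x
    unfolding P_def
  proof (rule order_trans[OF integral_norm_bound])
    show "(LINT y|lborel. cmod (indicat_real K (x + inverse (real (Suc n)) *\<^sub>R y) *\<^sub>R gaussian y))
       \<le> (LINT y|lborel. cmod (gaussian (y :: real ^ 'd)))"
      using integrable_gaussian by (intro integral_mono_AE' AE_I2) (auto simp: indicator_def)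
  qed
  have lim0: "(\<lambda>n. x + inverse (real (Suc n)) *\<^sub>R y) \<longlonglongrightarrow> x" for x y :: "real ^ 'd"
    using tendsto_add[OF tendsto_const tendsto_scaleR[OF LIMSEQ_inverse_real_of_nat tendsto_const], of x y]
    by simp
  have "(\<lambda>n. LINT x|lborel. H x * P n x) \<longlonglongrightarrow> (LINT x|lborel. H x * (indicator K x *\<^sub>R \<kappa>))"
  proof (rule integral_dominated_convergence[where w="\<lambda>x. cmod (H x) * (LINT y|lborel. cmod (gaussian (y :: real ^ 'd)))"])
    \<comment> \<open>Off the boundary of the box the indicator is locally constant, hence
      eventually constant along the shrinking displacements.\<close>
    show "AE x in lborel. (\<lambda>n. H x * P n x) \<longlonglongrightarrow> H x * (indicator K x *\<^sub>R \<kappa>)"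
      using AE_not_in_cbox_boundary[of a b]
    proof eventually_elim
      case (elim x)
      have "(\<lambda>n. P n x) \<longlonglongrightarrow> (LINT y|lborel. indicator K x *\<^sub>R gaussian (y :: real ^ 'd))"
        unfolding P_def
      proof (rule integral_dominated_convergence[where w="\<lambda>y. cmod (gaussian y)"])
        show "AE y in lborel. (\<lambda>n. indicator K (x + inverse (real (Suc n)) *\<^sub>R y) *\<^sub>R gaussian y) \<longlonglongrightarrow> indicator K x *\<^sub>R gaussian y"
        proof (intro AE_I2)
          fix y :: "real ^ 'd"
          have "\<forall>\<^sub>F n in sequentially. indicator K (x + inverse (real (Suc n)) *\<^sub>R y) = (indicator K x :: real)"
          proof (cases "x \<in> K")
            case True
            then have "x \<in> box a b" using elim by (auto simp: K_def)
            then have "\<forall>\<^sub>F n in sequentially. x + inverse (real (Suc n)) *\<^sub>R y \<in> box a b"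
              using topological_tendstoD[OF lim0 open_box] by blast
            then show ?thesis
              using True box_subset_cbox[of a b] by (auto simp: K_def elim!: eventually_mono)
          next
            case False
            have "open (- K)" by (simp add: K_def closed_cbox open_Compl)
            then have "\<forall>\<^sub>F n in sequentially. x + inverse (real (Suc n)) *\<^sub>R y \<in> - K"
              using topological_tendstoD[OF lim0, of "-K" x y] False by blast
            then show ?thesis using False by (auto elim!: eventually_mono)
          qed
          then show "(\<lambda>n. indicator K (x + inverse (real (Suc n)) *\<^sub>R y) *\<^sub>R gaussian y) \<longlonglongrightarrow> indicator K x *\<^sub>R gaussian y"
            by (intro tendsto_eventually) (auto elim!: eventually_mono)
        qed
      qed (use integrable_gaussian in \<open>auto simp: indicator_def\<close>)
      also have "(LINT y|lborel. indicator K x *\<^sub>R gaussian (y :: real ^ 'd)) = indicator K x *\<^sub>R \<kappa>"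
        by (simp add: gi)
      finally show ?case by (intro tendsto_mult tendsto_const)
    qed
    show "(\<lambda>x. H x * P n x) \<in> borel_measurable lborel" for n
      unfolding P_def by measurable
    show "AE x in lborel. cmod (H x * P n x) \<le> cmod (H x) * (LINT y|lborel. cmod (gaussian (y :: real ^ 'd)))" for n
      using Pb by (intro AE_I2) (simp add: norm_mult mult_left_mono)
  qed (use H in auto)
  then have "(LINT x|lborel. H x * (indicator K x *\<^sub>R \<kappa>)) = 0"
    unfolding PH by (simp add: LIMSEQ_const_iff)
  also have "(\<lambda>x. H x * (indicator K x *\<^sub>R \<kappa>)) = (\<lambda>x. (indicator K x *\<^sub>R H x) * \<kappa>)"
    by (simp add: fun_eq_iff)
  finally have "(LINT x|lborel. indicator K x *\<^sub>R H x) * \<kappa> = 0"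
    unfolding integral_mult_left_zero .
  then show "(LINT x|lborel. indicator (cbox a b) x *\<^sub>R H x) = 0"
    using \<kappa> by (simp add: K_def)
qed

section \<open>Fourier inversion\<close>

definition inv_fourier :: "(real ^ 'd::finite \<Rightarrow> complex) \<Rightarrow> real ^ 'd \<Rightarrow> complex" where
  "inv_fourier F x = of_real (1 / (gauss_mass TYPE('d))\<^sup>2) * (LINT \<xi>|lborel. F \<xi> * exp (\<i> * of_real (x \<bullet> \<xi>)))"

text \<open>Uniqueness is applied to the difference of the two sides times a Gaussian. Writing the
  Gaussian as a transform on one side and exchanging integrals on the other, both weighted
  transforms at \<theta> become \<open>1 / \<kappa>\<close> times the integral of
  \<open>fourier f\<close> against a Gaussian centred at \<theta>.\<close>

theorem fourier_inversion:
  fixes f :: "real ^ 'd::finite \<Rightarrow> complex"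
  assumes f: "integrable lborel f" and F: "integrable lborel (fourier f)"
  shows "AE x in lborel. f x = inv_fourier (fourier f) x"
proof -
  define \<kappa> where "\<kappa> = complex_of_real (gauss_mass TYPE('d))"
  have \<kappa>: "\<kappa> \<noteq> 0" using gauss_mass_ge_1[where 'd='d] by (auto simp: \<kappa>_def)
  define g where "g = inv_fourier (fourier f)"
  have [measurable]: "f \<in> borel_measurable borel" "fourier f \<in> borel_measurable borel" using f F by auto
  have g0: "gaussian x \<noteq> 0" for x :: "real ^ 'd" by (simp add: gaussian_def)
  have gsym: "gaussian (x - y) = gaussian (y - x)" for x y :: "real ^ 'd" by (simp add: gaussian_def norm_minus_commute)
  have gm[measurable]: "g \<in> borel_measurable borel"
    unfolding g_def inv_fourier_def by measurable
  have gb: "cmod (gaussian x) \<le> 1" for x :: "real ^ 'd" by (simp add: gaussian_def)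
  define C where "C = cmod (of_real (1 / (gauss_mass TYPE('d))\<^sup>2)) * (LINT \<xi>|lborel. cmod (fourier f \<xi>))"
  have gC: "cmod (g x) \<le> C" for x
    unfolding g_def inv_fourier_def C_def norm_mult
    by (intro mult_left_mono order_trans[OF integral_norm_bound]) (simp_all add: norm_mult)
  have i1: "integrable lborel (\<lambda>x. f x * gaussian x)"
    by (rule integrable_times_bounded[OF f _ gb]) simp
  have i2: "integrable lborel (\<lambda>x. gaussian x * g x)"
    by (rule integrable_times_bounded[OF integrable_gaussian _ gC]) simp
  \<comment> \<open>The Gaussian weight makes the difference integrable, since \<open>g\<close> is only known to be bounded.\<close>
  define H where "H = (\<lambda>x. f x * gaussian x - gaussian x * g x)"
  have "AE x in lborel. H x = 0"
  proof (rule fourier_eq_0_imp_AE_0)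
    show "integrable lborel H" unfolding H_def using i1 i2 by simp
    fix \<theta> :: "real ^ 'd"
    have "fourier H \<theta> = fourier (\<lambda>x. f x * gaussian x) \<theta> - fourier (\<lambda>x. gaussian x * g x) \<theta>"
      unfolding fourier_def H_def left_diff_distrib
      by (intro Bochner_Integration.integral_diff integrable_fourier_kernel i1 i2)
    also have "fourier (\<lambda>x. f x * gaussian x) \<theta> =
        (LINT x|lborel. (1 / \<kappa>) * (f x * (LINT z|lborel. gaussian z * exp (- \<i> * of_real (x \<bullet> (\<theta> + z))))))"
      unfolding fourier_def
    proof (intro Bochner_Integration.integral_cong refl)
      fix x
      have "gaussian x * exp (- \<i> * of_real (x \<bullet> \<theta>)) = (1 / \<kappa>) * ((LINT z|lborel. gaussian z * exp (- \<i> * of_real (z \<bullet> x))) * exp (- \<i> * of_real (x \<bullet> \<theta>)))"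
        using fourier_gaussian[of x] \<kappa> by (simp add: fourier_def \<kappa>_def)
      also have "(LINT z|lborel. gaussian z * exp (- \<i> * of_real (z \<bullet> x))) * exp (- \<i> * of_real (x \<bullet> \<theta>)) =
          (LINT z|lborel. gaussian z * exp (- \<i> * of_real (x \<bullet> (\<theta> + z))))"
        by (subst integral_mult_left_zero[symmetric])
          (simp add: inner_add_right inner_commute exp_add[symmetric] algebra_simps)
      finally show "f x * gaussian x * exp (- \<i> * of_real (x \<bullet> \<theta>)) =
          (1 / \<kappa>) * (f x * (LINT z|lborel. gaussian z * exp (- \<i> * of_real (x \<bullet> (\<theta> + z)))))"
        by (simp only: mult.assoc mult.left_commute)
    qed
    also have "\<dots> = (1 / \<kappa>) * (LINT x|lborel. f x * (LINT z|lborel. gaussian z * exp (- \<i> * of_real (x \<bullet> (\<theta> + z)))))"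
      by (rule integral_mult_right_zero)
    also have "(LINT x|lborel. f x * (LINT z|lborel. gaussian z * exp (- \<i> * of_real (x \<bullet> (\<theta> + z))))) =
        (LINT z|lborel. gaussian z * fourier f (\<theta> + z))"
      unfolding fourier_def
      by (rule fubini_kernel[OF f integrable_gaussian, where C=1]) (auto simp: split_beta)
    also have "fourier (\<lambda>x. gaussian x * g x) \<theta> = (LINT x|lborel. (1 / \<kappa>\<^sup>2) * (gaussian x * (LINT \<xi>|lborel. fourier f \<xi> * exp (- \<i> * of_real (x \<bullet> (\<theta> - \<xi>))))))"
      unfolding fourier_def[of "\<lambda>x. gaussian x * g x"]
    proof (intro Bochner_Integration.integral_cong refl)
      fix x
      have "g x * exp (- \<i> * of_real (x \<bullet> \<theta>)) = (1 / \<kappa>\<^sup>2) * ((LINT \<xi>|lborel. fourier f \<xi> * exp (\<i> * of_real (x \<bullet> \<xi>))) * exp (- \<i> * of_real (x \<bullet> \<theta>)))"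
        by (simp add: g_def inv_fourier_def \<kappa>_def)
      also have "(LINT \<xi>|lborel. fourier f \<xi> * exp (\<i> * of_real (x \<bullet> \<xi>))) * exp (- \<i> * of_real (x \<bullet> \<theta>)) =
          (LINT \<xi>|lborel. fourier f \<xi> * exp (- \<i> * of_real (x \<bullet> (\<theta> - \<xi>))))"
        by (subst integral_mult_left_zero[symmetric])
          (simp add: inner_diff_right exp_add[symmetric] algebra_simps)
      finally show "gaussian x * g x * exp (- \<i> * of_real (x \<bullet> \<theta>)) =
          (1 / \<kappa>\<^sup>2) * (gaussian x * (LINT \<xi>|lborel. fourier f \<xi> * exp (- \<i> * of_real (x \<bullet> (\<theta> - \<xi>)))))"
        by (simp add: mult_ac)
    qed
    also have "\<dots> = (1 / \<kappa>\<^sup>2) * (LINT x|lborel. gaussian x * (LINT \<xi>|lborel. fourier f \<xi> * exp (- \<i> * of_real (x \<bullet> (\<theta> - \<xi>)))))"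
      by (rule integral_mult_right_zero)
    also have "(LINT x|lborel. gaussian x * (LINT \<xi>|lborel. fourier f \<xi> * exp (- \<i> * of_real (x \<bullet> (\<theta> - \<xi>))))) =
        (LINT \<xi>|lborel. fourier f \<xi> * fourier gaussian (\<theta> - \<xi>))"
      unfolding fourier_def[of gaussian]
      by (rule fubini_kernel[OF integrable_gaussian F, where C=1]) (auto simp: split_beta)
    also have "\<dots> = (LINT \<xi>|lborel. \<kappa> * (fourier f \<xi> * gaussian (\<xi> - \<theta>)))"
      unfolding fourier_gaussian \<kappa>_def[symmetric] by (simp add: gsym[of \<theta>] mult_ac)
    also have "\<dots> = \<kappa> * (LINT \<xi>|lborel. fourier f \<xi> * gaussian (\<xi> - \<theta>))"
      by (rule integral_mult_right_zero)
    also have "(LINT \<xi>|lborel. fourier f \<xi> * gaussian (\<xi> - \<theta>)) = (LINT z|lborel. fourier f (\<theta> + z) * gaussian z)"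
      using lborel_integral_translate(1)[of "\<lambda>\<xi>. fourier f \<xi> * gaussian (\<xi> - \<theta>)" \<theta>] by simp
    finally show "fourier H \<theta> = 0"
      using \<kappa> by (simp add: power2_eq_square mult.commute)
  qed
  then show ?thesis
    by eventually_elim (use g0 in \<open>auto simp: H_def g_def\<close>)
qed

section \<open>Compactly supported functions and complex frequencies\<close>

text \<open>Integrability is bundled with the support condition so that the Fourier integral
  converges at complex frequencies as well.\<close>

definition supported_in :: "real \<Rightarrow> (real ^ 'd::finite \<Rightarrow> complex) \<Rightarrow> bool" where
  "supported_in B f \<longleftrightarrow> integrable lborel f \<and> (AE x in lborel. infnorm x \<ge> B \<longrightarrow> f x = 0)"

text \<open>\<open>fourier (twist f \<eta> z) \<xi>\<close> is the value at \<open>\<xi> + z\<eta>\<close> of the analytic extension of \<open>fourier f\<close>.\<close>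

definition twist :: "(real ^ 'd::finite \<Rightarrow> complex) \<Rightarrow> real ^ 'd \<Rightarrow> complex \<Rightarrow> real ^ 'd \<Rightarrow> complex" where
  "twist f \<eta> z x = f x * exp (- \<i> * z * of_real (x \<bullet> \<eta>))"

lemma infnorm_attained: "\<exists>i. infnorm (x :: real ^ 'd::finite) = \<bar>x $ i\<bar>"
proof -
  have "infnorm x \<in> (\<lambda>i. \<bar>x \<bullet> i\<bar>) ` Basis"
    unfolding infnorm_Max by (rule Max_in) auto
  then show ?thesis by (auto simp: Basis_vec_def inner_axis)
qed

text \<open>The dual of the maximum norm is the sum norm. Bounding the latter by
  \<open>CARD('d)\<close> times the maximum is what brings the dimension into the final
  constant.\<close>

lemma inner_le_infnorm: "\<bar>x \<bullet> y\<bar> \<le> real CARD('d) * infnorm x * infnorm (y :: real ^ 'd::finite)"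
proof -
  have "\<bar>x \<bullet> y\<bar> \<le> (\<Sum>i\<in>UNIV. \<bar>x $ i\<bar> * \<bar>y $ i\<bar>)"
    unfolding inner_vec_def by (rule order_trans[OF sum_abs]) (simp add: abs_mult)
  also have "\<dots> \<le> (\<Sum>i\<in>(UNIV :: 'd set). infnorm x * infnorm y)"
    by (intro sum_mono mult_mono component_le_infnorm_cart) (auto simp: infnorm_pos_le)
  finally show ?thesis by simp
qed

lemma infnorm_measurable [measurable]: "infnorm \<in> borel_measurable (borel :: (real ^ 'd::finite) measure)"
  by (intro borel_measurable_continuous_onI continuous_on_infnorm) (rule continuous_on_id)

lemma supported_inner_bound:
  assumes "supported_in B f"
  shows "AE x in lborel. f x = 0 \<or> \<bar>x \<bullet> \<eta>\<bar> \<le> real CARD('d) * B * infnorm (\<eta> :: real ^ 'd::finite)"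
proof -
  have "AE x in lborel. infnorm x \<ge> B \<longrightarrow> f x = 0" using assms by (simp add: supported_in_def)
  then show ?thesis
  proof eventually_elim
    case (elim x)
    show ?case
    proof (cases "f x = 0")
      case False
      then have "infnorm x \<le> B" using elim by linarith
      then have "real CARD('d) * infnorm x * infnorm \<eta> \<le> real CARD('d) * B * infnorm \<eta>"
        by (intro mult_right_mono mult_left_mono) (auto simp: infnorm_pos_le)
      then show ?thesis using inner_le_infnorm[of x \<eta>] by linarith
    qed simp
  qed
qed

lemma twist_bound:
  fixes f :: "real ^ 'd::finite \<Rightarrow> complex"
  assumes "supported_in B f"
  shows "AE x in lborel. cmod (twist f \<eta> z x) \<le> cmod (f x) * exp (real CARD('d) * B * infnorm \<eta> * \<bar>Im z\<bar>)"
  using supported_inner_bound[OF assms, of \<eta>]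
proof eventually_elim
  case (elim x)
  show ?case
  proof (cases "f x = 0")
    case False
    have "Im z * (x \<bullet> \<eta>) \<le> \<bar>Im z\<bar> * \<bar>x \<bullet> \<eta>\<bar>" by (simp flip: abs_mult)
    also have "\<dots> \<le> \<bar>Im z\<bar> * (real CARD('d) * B * infnorm \<eta>)"
      using False elim by (intro mult_left_mono) auto
    finally show ?thesis by (simp add: twist_def norm_mult mult_left_mono mult_ac)
  qed (simp add: twist_def)
qed

lemma twist_integrable:
  fixes f :: "real ^ 'd::finite \<Rightarrow> complex"
  assumes f: "supported_in B f"
  shows "integrable lborel (twist f \<eta> z)"
proof -
  have fi: "integrable lborel f" using f by (simp add: supported_in_def)
  then have [measurable]: "f \<in> borel_measurable borel" by simp
  show ?thesis
  proof (rule Bochner_Integration.integrable_bound)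
    show "integrable lborel (\<lambda>x. cmod (f x) * exp (real CARD('d) * B * infnorm \<eta> * \<bar>Im z\<bar>))"
      using fi by simp
    show "twist f \<eta> z \<in> borel_measurable lborel"
      unfolding twist_def[abs_def] by simp
    show "AE x in lborel. norm (twist f \<eta> z x) \<le> norm (cmod (f x) * exp (real CARD('d) * B * infnorm \<eta> * \<bar>Im z\<bar>))"
      using twist_bound[OF f] by simp
  qed
qed

text \<open>The easy half of the Paley-Wiener theorem along a complex line: the growth depends on
  \<open>Im z\<close> only, with exponential type
  \<open>real CARD('d) * B * infnorm \<eta>\<close>.\<close>

lemma fourier_twist_bound:
  fixes f :: "real ^ 'd::finite \<Rightarrow> complex"
  assumes f: "supported_in B f" and A: "(LINT x|lborel. cmod (f x)) \<le> A"
  shows "cmod (fourier (twist f \<eta> z) \<xi>) \<le> A * exp (real CARD('d) * B * infnorm \<eta> * \<bar>Im z\<bar>)"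
proof -
  have fi: "integrable lborel f" using f by (simp add: supported_in_def)
  have "cmod (fourier (twist f \<eta> z) \<xi>) \<le> (LINT x|lborel. cmod (twist f \<eta> z x))" by (rule fourier_bound)
  also have "\<dots> \<le> (LINT x|lborel. cmod (f x) * exp (real CARD('d) * B * infnorm \<eta> * \<bar>Im z\<bar>))"
    using twist_bound[OF f] fi twist_integrable[OF f] by (intro integral_mono_AE) auto
  also have "\<dots> = (LINT x|lborel. cmod (f x)) * exp (real CARD('d) * B * infnorm \<eta> * \<bar>Im z\<bar>)" by simp
  also have "\<dots> \<le> A * exp (real CARD('d) * B * infnorm \<eta> * \<bar>Im z\<bar>)" using A by (intro mult_right_mono) auto
  finally show ?thesis .
qed

lemma fourier_twist_real:
  "fourier (twist f \<eta> (of_real s)) \<xi> = fourier f (\<xi> + s *\<^sub>R \<eta>)"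
  unfolding fourier_def twist_def
  by (intro Bochner_Integration.integral_cong refl)
    (simp add: inner_add_right exp_add[symmetric] algebra_simps)

text \<open>Differentiation under the integral sign. Wherever \<open>F\<close> does not vanish the
  frequency \<open>y\<close> is bounded by \<open>Y\<close>, so difference quotients taken within
  distance 1 of \<open>z\<close> are dominated by \<open>Y * exp ((cmod z + 1) * Y)\<close> times
  the modulus of \<open>F\<close>.\<close>

lemma holomorphic_exponential_integral:
  fixes F :: "'a::euclidean_space \<Rightarrow> complex" and y :: "'a \<Rightarrow> real"
  assumes F: "integrable lborel F" and y[measurable]: "y \<in> borel_measurable borel"
    and Y: "AE x in lborel. F x = 0 \<or> \<bar>y x\<bar> \<le> Y"
  shows "(\<lambda>z. LINT x|lborel. F x * exp (- \<i> * z * of_real (y x))) holomorphic_on UNIV"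
proof -
  have [measurable]: "F \<in> borel_measurable borel" using F by simp
  define G where "G = (\<lambda>z x. F x * exp (- \<i> * z * of_real (y x)))"
  have [measurable]: "G z \<in> borel_measurable borel" for z
    unfolding G_def by measurable
  have expb: "cmod (exp (- \<i> * z * of_real r)) \<le> exp (cmod z * Y)" if "\<bar>r\<bar> \<le> Y" for z r
  proof -
    have "Im z * r \<le> \<bar>Im z\<bar> * \<bar>r\<bar>" by (simp flip: abs_mult)
    also have "\<dots> \<le> cmod z * Y" using that abs_Im_le_cmod by (intro mult_mono) auto
    finally show ?thesis by simp
  qed
  have Gi: "integrable lborel (G z)" for z
  proof (rule Bochner_Integration.integrable_bound)
    show "integrable lborel (\<lambda>x. cmod (F x) * exp (cmod z * Y))" using F by simp
    show "AE x in lborel. norm (G z x) \<le> norm (cmod (F x) * exp (cmod z * Y))"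
      using Y
    proof eventually_elim
      case (elim x)
      show ?case
      proof (cases "F x = 0")
        case False
        then show ?thesis
          using elim mult_left_mono[OF expb[of "y x" z], of "cmod (F x)"] by (simp add: G_def norm_mult)
      qed (simp add: G_def)
    qed
  qed simp
  have "((\<lambda>z. LINT x|lborel. G z x) has_field_derivative (LINT x|lborel. F x * (- \<i> * of_real (y x)) * exp (- \<i> * z * of_real (y x)))) (at z)" for z
    unfolding has_field_derivative_iff tendsto_at_iff_sequentially
  proof (intro allI impI)
    fix X :: "nat \<Rightarrow> complex" assume X0: "\<forall>i. X i \<in> UNIV - {z}" and X: "X \<longlonglongrightarrow> z"
    have X1: "\<forall>\<^sub>F n in sequentially. cmod (X n - z) < 1"
      using tendstoD[OF X, of 1] by (simp add: dist_norm)
    then obtain n0 where n0: "\<And>n. n \<ge> n0 \<Longrightarrow> cmod (X n - z) < 1" by (auto simp: eventually_sequentially)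
    \<comment> \<open>Dropping the first \<open>n0\<close> terms puts the whole sequence into the
      unit ball about \<open>z\<close>, where the dominating function is valid.\<close>
    define W where "W = (\<lambda>n. X (n + n0))"
    have W: "W \<longlonglongrightarrow> z" "\<And>n. cmod (W n - z) < 1" "\<And>n. W n \<noteq> z"
      using X n0 X0 by (auto simp: W_def LIMSEQ_ignore_initial_segment)
    have "(\<lambda>n. LINT x|lborel. (G (W n) x - G z x) / (W n - z)) \<longlonglongrightarrow>
        (LINT x|lborel. F x * (- \<i> * of_real (y x)) * exp (- \<i> * z * of_real (y x)))"
    proof (rule integral_dominated_convergence[where w="\<lambda>x. cmod (F x) * (Y * exp ((cmod z + 1) * Y))"])
      show "AE x in lborel. (\<lambda>n. (G (W n) x - G z x) / (W n - z)) \<longlonglongrightarrow> F x * (- \<i> * of_real (y x)) * exp (- \<i> * z * of_real (y x))"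
      proof (intro AE_I2)
        fix x
        have "((\<lambda>z. G z x) has_field_derivative F x * (- \<i> * of_real (y x)) * exp (- \<i> * z * of_real (y x))) (at z)"
          unfolding G_def by (auto intro!: derivative_eq_intros)
        then have "((\<lambda>w. (G w x - G z x) / (w - z)) \<longlongrightarrow> F x * (- \<i> * of_real (y x)) * exp (- \<i> * z * of_real (y x))) (at z)"
          by (simp add: has_field_derivative_iff)
        then show "(\<lambda>n. (G (W n) x - G z x) / (W n - z)) \<longlonglongrightarrow> F x * (- \<i> * of_real (y x)) * exp (- \<i> * z * of_real (y x))"
          unfolding tendsto_at_iff_sequentially using W by (auto simp: o_def)
      qed
      show "AE x in lborel. cmod ((G (W n) x - G z x) / (W n - z)) \<le> cmod (F x) * (Y * exp ((cmod z + 1) * Y))" for n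
        using Y
      proof eventually_elim
        case (elim x)
        show ?case
        proof (cases "F x = 0")
          case False
          then have yY: "\<bar>y x\<bar> \<le> Y" using elim by simp
          have "cmod (exp (- \<i> * W n * of_real (y x)) - exp (- \<i> * z * of_real (y x))) \<le> (Y * exp ((cmod z + 1) * Y)) * cmod (W n - z)"
          proof (rule field_differentiable_bound[of "ball z 1"])
            fix w assume "w \<in> ball z 1"
            then have "cmod w \<le> cmod z + 1"
              using norm_triangle_ineq2[of w z] by (simp add: dist_norm norm_minus_commute)
            then have "exp (cmod w * Y) \<le> exp ((cmod z + 1) * Y)" using yY by (simp add: mult_right_mono)
            then show "cmod (- \<i> * of_real (y x) * exp (- \<i> * w * of_real (y x))) \<le> Y * exp ((cmod z + 1) * Y)"
              unfolding norm_mult using expb[OF yY, of w] yY by (intro mult_mono) auto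
          qed (use W(2)[of n] in \<open>auto intro!: derivative_eq_intros simp: dist_norm norm_minus_commute\<close>)
          then have "cmod (F x) * (cmod (exp (- \<i> * W n * of_real (y x)) - exp (- \<i> * z * of_real (y x))) / cmod (W n - z)) \<le> cmod (F x) * (Y * exp ((cmod z + 1) * Y))"
            using W(3)[of n] by (intro mult_left_mono) (auto simp: divide_le_eq)
          moreover have "(G (W n) x - G z x) / (W n - z) = F x * ((exp (- \<i> * W n * of_real (y x)) - exp (- \<i> * z * of_real (y x))) / (W n - z))"
            by (simp add: G_def right_diff_distrib)
          ultimately show ?thesis by (simp only: norm_mult norm_divide)
        qed (simp add: G_def)
      qed
    qed (use F in auto)
    also have "(\<lambda>n. LINT x|lborel. (G (W n) x - G z x) / (W n - z)) =
        (\<lambda>n. ((LINT x|lborel. G (W n) x) - (LINT x|lborel. G z x)) / (W n - z))"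
      using Gi by simp
    finally have "(\<lambda>n. ((\<lambda>w. ((LINT x|lborel. G w x) - (LINT x|lborel. G z x)) / (w - z)) \<circ> X) (n + n0)) \<longlonglongrightarrow>
        (LINT x|lborel. F x * (- \<i> * of_real (y x)) * exp (- \<i> * z * of_real (y x)))"
      by (simp add: W_def o_def)
    then show "((\<lambda>w. ((LINT x|lborel. G w x) - (LINT x|lborel. G z x)) / (w - z)) \<circ> X) \<longlonglongrightarrow>
        (LINT x|lborel. F x * (- \<i> * of_real (y x)) * exp (- \<i> * z * of_real (y x)))"
      by (rule LIMSEQ_offset)
  qed
  then have "(\<lambda>z. LINT x|lborel. G z x) holomorphic_on UNIV"
    unfolding holomorphic_on_open[OF open_UNIV] by blast
  then show ?thesis by (simp only: G_def)
qed

lemma fourier_twist_holomorphic: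
  fixes f :: "real ^ 'd::finite \<Rightarrow> complex"
  assumes f: "supported_in B f"
  shows "(\<lambda>z. fourier (twist f \<eta> z) \<xi>) holomorphic_on UNIV"
proof -
  have fi: "integrable lborel f" using f by (simp add: supported_in_def)
  have "(\<lambda>z. LINT x|lborel. (f x * exp (- \<i> * of_real (x \<bullet> \<xi>))) * exp (- \<i> * z * of_real (x \<bullet> \<eta>))) holomorphic_on UNIV"
  proof (rule holomorphic_exponential_integral)
    show "AE x in lborel. f x * exp (- \<i> * of_real (x \<bullet> \<xi>)) = 0 \<or> \<bar>x \<bullet> \<eta>\<bar> \<le> real CARD('d) * B * infnorm \<eta>"
      using supported_inner_bound[OF f, of \<eta>] by eventually_elim auto
  qed (use integrable_fourier_kernel[OF fi] in auto)
  then show ?thesis by (simp add: fourier_def twist_def mult_ac)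
qed

lemma AE_bound_of_fourier:
  fixes f :: "real ^ 'd::finite \<Rightarrow> complex"
  assumes f: "integrable lborel f" and F: "integrable lborel (fourier f)"
  shows "AE x in lborel. cmod (f x) \<le> (LINT \<xi>|lborel. cmod (fourier f \<xi>))"
  using fourier_inversion[OF f F]
proof eventually_elim
  case (elim x)
  have "cmod (f x) \<le> 1 * (LINT \<xi>|lborel. cmod (fourier f \<xi>))"
    unfolding elim inv_fourier_def norm_mult
  proof (intro mult_mono)
    show "cmod (of_real (1 / (gauss_mass TYPE('d))\<^sup>2)) \<le> 1"
      using gauss_mass_ge_1[where 'd='d] unfolding norm_of_real by (simp add: one_le_power)
    show "cmod (LINT \<xi>|lborel. fourier f \<xi> * exp (\<i> * of_real (x \<bullet> \<xi>))) \<le> (LINT \<xi>|lborel. cmod (fourier f \<xi>))"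
      by (rule order_trans[OF integral_norm_bound]) (simp add: norm_mult)
  qed auto
  then show ?case by simp
qed

lemma integrable_mult_of_fourier:
  fixes f g :: "real ^ 'd::finite \<Rightarrow> complex"
  assumes f: "integrable lborel f" and g: "integrable lborel g" and G: "integrable lborel (fourier g)"
  shows "integrable lborel (\<lambda>x. f x * g x)"
proof (rule Bochner_Integration.integrable_bound)
  show "integrable lborel (\<lambda>x. (LINT \<xi>|lborel. cmod (fourier g \<xi>)) *\<^sub>R f x)" using f by simp
  show "AE x in lborel. norm (f x * g x) \<le> norm ((LINT \<xi>|lborel. cmod (fourier g \<xi>)) *\<^sub>R f x)"
    using AE_bound_of_fourier[OF g G]
    by eventually_elim (auto simp: norm_mult mult.commute[of "cmod (f _)"] intro!: mult_right_mono)
  show "(\<lambda>x. f x * g x) \<in> borel_measurable lborel"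
    using f g by (intro borel_measurable_times borel_measurable_integrable)
qed

text \<open>\<open>g\<close> is replaced by its inverse transform under the integral and the
  integrals are exchanged. Integrability of the transform is asked of \<open>g\<close> alone, so
  that a factor shifted to complex frequencies can later play the part of \<open>f\<close>.\<close>

lemma fourier_mult:
  fixes f g :: "real ^ 'd::finite \<Rightarrow> complex"
  assumes f: "integrable lborel f" and g: "integrable lborel g" and G: "integrable lborel (fourier g)"
  shows "fourier (\<lambda>x. f x * g x) \<xi> =
    of_real (1 / (gauss_mass TYPE('d))\<^sup>2) * (LINT \<zeta>|lborel. fourier g \<zeta> * fourier f (\<xi> - \<zeta>))"
proof -
  define c where "c = complex_of_real (1 / (gauss_mass TYPE('d))\<^sup>2)"
  have [measurable]: "f \<in> borel_measurable borel" "g \<in> borel_measurable borel" "fourier g \<in> borel_measurable borel"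
    using f g G by auto
  have [measurable]: "inv_fourier (fourier g) \<in> borel_measurable borel"
    unfolding inv_fourier_def[abs_def] by measurable
  have "fourier (\<lambda>x. f x * g x) \<xi> = (LINT x|lborel. f x * inv_fourier (fourier g) x * exp (- \<i> * of_real (x \<bullet> \<xi>)))"
    unfolding fourier_def[of _ \<xi>] using fourier_inversion[OF g G]
    by (intro integral_cong_AE) (auto elim!: eventually_mono)
  also have "\<dots> = (LINT x|lborel. c * (f x * (LINT \<zeta>|lborel. fourier g \<zeta> * exp (- \<i> * of_real (x \<bullet> (\<xi> - \<zeta>))))))"
  proof (intro Bochner_Integration.integral_cong refl)
    fix x
    have "(LINT \<zeta>|lborel. fourier g \<zeta> * exp (\<i> * of_real (x \<bullet> \<zeta>))) * exp (- \<i> * of_real (x \<bullet> \<xi>)) =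
        (LINT \<zeta>|lborel. fourier g \<zeta> * exp (- \<i> * of_real (x \<bullet> (\<xi> - \<zeta>))))"
      by (subst integral_mult_left_zero[symmetric])
        (simp add: inner_diff_right exp_add[symmetric] algebra_simps)
    then show "f x * inv_fourier (fourier g) x * exp (- \<i> * of_real (x \<bullet> \<xi>)) = c * (f x * (LINT \<zeta>|lborel. fourier g \<zeta> * exp (- \<i> * of_real (x \<bullet> (\<xi> - \<zeta>)))))"
      by (simp add: inv_fourier_def c_def mult_ac)
  qed
  also have "\<dots> = c * (LINT x|lborel. f x * (LINT \<zeta>|lborel. fourier g \<zeta> * exp (- \<i> * of_real (x \<bullet> (\<xi> - \<zeta>)))))"
    by (rule integral_mult_right_zero)
  also have "(LINT x|lborel. f x * (LINT \<zeta>|lborel. fourier g \<zeta> * exp (- \<i> * of_real (x \<bullet> (\<xi> - \<zeta>))))) =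
      (LINT \<zeta>|lborel. fourier g \<zeta> * fourier f (\<xi> - \<zeta>))"
    unfolding fourier_def[of f]
    by (rule fubini_kernel[OF f G, where C=1]) (auto simp: split_beta)
  finally show ?thesis by (simp add: c_def)
qed

section \<open>Products and convolutions\<close>

definition band_volume :: "'d::finite itself \<Rightarrow> real \<Rightarrow> real" where
  "band_volume _ B = measure lborel {x :: real ^ 'd. infnorm x < B}"

lemma infnorm_ball_finite: "emeasure lborel {x :: real ^ 'd::finite. infnorm x < B} < \<infinity>"
proof -
  have "{x :: real ^ 'd. infnorm x < B} \<subseteq> cball 0 (sqrt (real CARD('d)) * B)"
  proof
    fix x :: "real ^ 'd" assume "x \<in> {x. infnorm x < B}"
    then have "sqrt (real CARD('d)) * infnorm x \<le> sqrt (real CARD('d)) * B"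
      by (intro mult_left_mono) auto
    then show "x \<in> cball 0 (sqrt (real CARD('d)) * B)"
    proof -
      assume "sqrt (real CARD('d)) * infnorm x \<le> sqrt (real CARD('d)) * B"
      moreover have "norm x \<le> sqrt (real CARD('d)) * infnorm x" using norm_le_infnorm[of x] by simp
      ultimately have "norm x \<le> sqrt (real CARD('d)) * B" by linarith
      then show ?thesis by simp
    qed
  qed
  then have "emeasure lborel {x :: real ^ 'd. infnorm x < B} \<le> emeasure lborel (cball (0 :: real ^ 'd) (sqrt (real CARD('d)) * B))"
    by (intro emeasure_mono) auto
  then show ?thesis using emeasure_lborel_cball_finite order_le_less_trans by blast
qed

text \<open>By inversion \<open>f\<close> is bounded by \<open>L\<close>, and it lives on a cube of
  finite volume. The resulting bound on the integral of \<open>f\<close> is the constant in front of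
  the exponential growth at complex frequencies.\<close>

lemma L1_bound_of_fourier:
  fixes f :: "real ^ 'd::finite \<Rightarrow> complex"
  assumes f: "supported_in B f" and F: "integrable lborel (fourier f)"
    and L: "(LINT \<xi>|lborel. cmod (fourier f \<xi>)) \<le> L"
  shows "(LINT x|lborel. cmod (f x)) \<le> L * band_volume TYPE('d) B"
proof -
  define S where "S = {x :: real ^ 'd. infnorm x < B}"
  have fi: "integrable lborel f" using f by (simp add: supported_in_def)
  have sup: "AE x in lborel. infnorm x \<ge> B \<longrightarrow> f x = 0" using f by (simp add: supported_in_def)
  have Si: "integrable lborel (indicator S :: _ \<Rightarrow> real)"
    using infnorm_ball_finite[of B] unfolding S_def by (intro integrable_real_indicator) auto
  have "(LINT x|lborel. cmod (f x)) \<le> (LINT x|lborel. L * indicator S x)"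
  proof (rule integral_mono_AE)
    show "AE x in lborel. cmod (f x) \<le> L * indicator S x"
      using AE_bound_of_fourier[OF fi F] sup
    proof eventually_elim
      case (elim x)
      then show ?case using L by (cases "x \<in> S") (auto simp: S_def indicator_def)
    qed
  qed (use fi Si in auto)
  also have "\<dots> = L * band_volume TYPE('d) B"
    using Si by (simp add: band_volume_def S_def)
  finally show ?thesis .
qed

lemma band_volume_nonneg [simp]: "band_volume t B \<ge> 0"
  by (simp add: band_volume_def)

lemma supported_in_mult:
  fixes f g :: "real ^ 'd::finite \<Rightarrow> complex"
  assumes f: "supported_in B f" and g: "supported_in B g" and G: "integrable lborel (fourier g)"
  shows "supported_in B (\<lambda>x. f x * g x)"
  unfolding supported_in_def
proof
  show "integrable lborel (\<lambda>x. f x * g x)"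
    using f g G by (intro integrable_mult_of_fourier) (auto simp: supported_in_def)
  have "AE x in lborel. infnorm x \<ge> B \<longrightarrow> f x = 0" using f by (simp add: supported_in_def)
  then show "AE x in lborel. infnorm x \<ge> B \<longrightarrow> f x * g x = 0" by eventually_elim auto
qed

lemma norm_fourier_mult_le:
  fixes f g :: "real ^ 'd::finite \<Rightarrow> complex"
  assumes f: "integrable lborel f" and g: "integrable lborel g" and G: "integrable lborel (fourier g)"
  shows "cmod (fourier (\<lambda>x. f x * g x) \<xi>) \<le> (LINT \<zeta>|lborel. cmod (fourier f (\<xi> - \<zeta>)) * cmod (fourier g \<zeta>))"
    and "integrable lborel (\<lambda>\<zeta>. cmod (fourier f (\<xi> - \<zeta>)) * cmod (fourier g \<zeta>))"
proof -
  have Fm[measurable]: "fourier f \<in> borel_measurable borel" using fourier_measurable[OF f] .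
  have i: "integrable lborel (\<lambda>\<zeta>. fourier g \<zeta> * fourier f (\<xi> - \<zeta>))"
    by (rule integrable_times_bounded[OF G _ fourier_bound]) simp
  then show "integrable lborel (\<lambda>\<zeta>. cmod (fourier f (\<xi> - \<zeta>)) * cmod (fourier g \<zeta>))"
    using integrable_norm[OF i] by (simp add: norm_mult mult.commute)
  have "cmod (fourier (\<lambda>x. f x * g x) \<xi>) \<le> 1 * (LINT \<zeta>|lborel. cmod (fourier f (\<xi> - \<zeta>)) * cmod (fourier g \<zeta>))"
    unfolding fourier_mult[OF assms] norm_mult
  proof (intro mult_mono)
    show "cmod (of_real (1 / (gauss_mass TYPE('d))\<^sup>2)) \<le> 1"
      using gauss_mass_ge_1[where 'd='d] unfolding norm_of_real by (simp add: one_le_power)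
    show "cmod (LINT \<zeta>|lborel. fourier g \<zeta> * fourier f (\<xi> - \<zeta>)) \<le> (LINT \<zeta>|lborel. cmod (fourier f (\<xi> - \<zeta>)) * cmod (fourier g \<zeta>))"
      by (rule order_trans[OF integral_norm_bound]) (simp add: norm_mult mult.commute)
  qed auto
  then show "cmod (fourier (\<lambda>x. f x * g x) \<xi>) \<le> (LINT \<zeta>|lborel. cmod (fourier f (\<xi> - \<zeta>)) * cmod (fourier g \<zeta>))"
    by simp
qed

lemma norm_fourier_mult_le_nn:
  fixes f g :: "real ^ 'd::finite \<Rightarrow> complex"
  assumes f: "integrable lborel f" and g: "integrable lborel g" and G: "integrable lborel (fourier g)"
  shows "ennreal (cmod (fourier (\<lambda>x. f x * g x) \<xi>)) \<le>
    (\<integral>\<^sup>+ \<zeta>. ennreal (cmod (fourier f (\<xi> - \<zeta>))) * ennreal (cmod (fourier g \<zeta>)) \<partial>lborel)"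
proof -
  have "ennreal (cmod (fourier (\<lambda>x. f x * g x) \<xi>)) \<le> ennreal (LINT \<zeta>|lborel. cmod (fourier f (\<xi> - \<zeta>)) * cmod (fourier g \<zeta>))"
    using norm_fourier_mult_le(1)[OF assms] by (rule ennreal_leI)
  also have "\<dots> = (\<integral>\<^sup>+ \<zeta>. ennreal (cmod (fourier f (\<xi> - \<zeta>)) * cmod (fourier g \<zeta>)) \<partial>lborel)"
    by (rule nn_integral_eq_integral[symmetric]) (use norm_fourier_mult_le(2)[OF assms] in auto)
  finally show ?thesis by (simp add: ennreal_mult)
qed

text \<open>Young's inequality for the convolution of two integrable functions; it keeps products
  inside the class of functions with integrable transform.\<close>

lemma fourier_mult_integrable:
  fixes f g :: "real ^ 'd::finite \<Rightarrow> complex"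
  assumes f: "integrable lborel f" and F: "integrable lborel (fourier f)"
    and g: "integrable lborel g" and G: "integrable lborel (fourier g)"
  shows "integrable lborel (fourier (\<lambda>x. f x * g x))"
    and "(LINT \<xi>|lborel. cmod (fourier (\<lambda>x. f x * g x) \<xi>)) \<le>
      (LINT \<xi>|lborel. cmod (fourier f \<xi>)) * (LINT \<xi>|lborel. cmod (fourier g \<xi>))"
proof -
  have [measurable]: "fourier f \<in> borel_measurable borel" "fourier g \<in> borel_measurable borel" using F G by auto
  have fg: "integrable lborel (\<lambda>x. f x * g x)" by (rule integrable_mult_of_fourier[OF f g G])
  note [measurable] = fourier_measurable[OF fg]
  have t: "(LINT \<xi>|lborel. cmod (fourier f (\<xi> - \<zeta>))) = (LINT \<xi>|lborel. cmod (fourier f \<xi>))"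
    "integrable lborel (\<lambda>\<xi>. fourier f (\<xi> - \<zeta>))" for \<zeta>
    using lborel_integral_translate(1)[of "\<lambda>\<xi>. cmod (fourier f \<xi>)" "-\<zeta>"] lborel_integral_translate(2)[of "fourier f" "-\<zeta>"] F
    by (simp_all add: add.commute[of "-\<zeta>"])
  have ip: "integrable (lborel \<Otimes>\<^sub>M lborel) (\<lambda>(\<zeta>, \<xi>). cmod (fourier f (\<xi> - \<zeta>)) * cmod (fourier g \<zeta>))"
  proof (rule lborel_pair.Fubini_integrable)
    show "integrable lborel (\<lambda>\<zeta>. LINT \<xi>|lborel. norm (case (\<zeta>, \<xi>) of (\<zeta>, \<xi>) \<Rightarrow> cmod (fourier f (\<xi> - \<zeta>)) * cmod (fourier g \<zeta>)))"
      using G by (simp add: t)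
  qed (use t in auto)
  have i2: "integrable lborel (\<lambda>\<xi>. LINT \<zeta>|lborel. cmod (fourier f (\<xi> - \<zeta>)) * cmod (fourier g \<zeta>))"
    by (rule lborel_pair.integrable_snd[OF ip])
  show i3: "integrable lborel (fourier (\<lambda>x. f x * g x))"
  proof (rule Bochner_Integration.integrable_bound[OF i2])
    show "AE \<xi> in lborel. norm (fourier (\<lambda>x. f x * g x) \<xi>) \<le> norm (LINT \<zeta>|lborel. cmod (fourier f (\<xi> - \<zeta>)) * cmod (fourier g \<zeta>))"
      using norm_fourier_mult_le(1)[OF f g G] by (auto intro!: AE_I2 order_trans[OF _ abs_ge_self])
  qed simp
  have "(LINT \<xi>|lborel. cmod (fourier (\<lambda>x. f x * g x) \<xi>)) \<le> (LINT \<xi>|lborel. LINT \<zeta>|lborel. cmod (fourier f (\<xi> - \<zeta>)) * cmod (fourier g \<zeta>))"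
    using i2 i3 norm_fourier_mult_le(1)[OF f g G] by (intro integral_mono) auto
  also have "\<dots> = (LINT \<zeta>|lborel. LINT \<xi>|lborel. cmod (fourier f (\<xi> - \<zeta>)) * cmod (fourier g \<zeta>))"
    by (rule lborel_pair.Fubini_integral[OF ip])
  also have "\<dots> = (LINT \<xi>|lborel. cmod (fourier f \<xi>)) * (LINT \<xi>|lborel. cmod (fourier g \<xi>))"
    by (simp add: t)
  finally show "(LINT \<xi>|lborel. cmod (fourier (\<lambda>x. f x * g x) \<xi>)) \<le>
      (LINT \<xi>|lborel. cmod (fourier f \<xi>)) * (LINT \<xi>|lborel. cmod (fourier g \<xi>))" .
qed

lemma convolution_power_Suc: "m \<ge> 1 \<Longrightarrow> convolution_power (Suc m) f = Defs.convolution f (convolution_power m f)"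
  unfolding convolution_power_def by (cases m) auto

text \<open>Each step multiplies the product so far by the new factor from the left. This matches
  the recursion of \<open>convolution_power\<close>, so neither commutativity nor associativity of
  the convolution of the possibly nonmeasurable \<open>a\<close> enters.\<close>

lemma product_fourier:
  fixes f :: "nat \<Rightarrow> real ^ 'd::finite \<Rightarrow> complex"
  assumes m: "m \<ge> 1"
    and sup: "\<And>i. supported_in B (f i)" and F: "\<And>i. integrable lborel (fourier (f i))"
    and L: "\<And>i. (LINT \<xi>|lborel. cmod (fourier (f i) \<xi>)) \<le> L"
    and a: "\<And>i \<xi>. ennreal (cmod (fourier (f i) \<xi>)) \<le> a \<xi>"
  shows "supported_in B (\<lambda>x. \<Prod>i<m. f i x) \<and> integrable lborel (fourier (\<lambda>x. \<Prod>i<m. f i x)) \<and>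
    (LINT \<xi>|lborel. cmod (fourier (\<lambda>x. \<Prod>i<m. f i x) \<xi>)) \<le> L ^ m \<and>
    (\<forall>\<xi>. ennreal (cmod (fourier (\<lambda>x. \<Prod>i<m. f i x) \<xi>)) \<le> convolution_power m a \<xi>)"
  using m
proof (induction m rule: dec_induct)
  case base
  then show ?case using sup F L a by (simp add: convolution_power_def)
next
  case (step m)
  let ?g = "\<lambda>x. \<Prod>i<m. f i x"
  have eq: "(\<lambda>x. \<Prod>i<Suc m. f i x) = (\<lambda>x. f m x * ?g x)"
    by (simp add: fun_eq_iff mult.commute)
  have fi: "integrable lborel (f m)" using sup by (simp add: supported_in_def)
  have gi: "integrable lborel ?g" using step by (simp add: supported_in_def)
  have G: "integrable lborel (fourier ?g)" using step by simp
  show ?case unfolding eq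
  proof (intro conjI allI)
    show "supported_in B (\<lambda>x. f m x * ?g x)" using step sup by (intro supported_in_mult) auto
    show "integrable lborel (fourier (\<lambda>x. f m x * ?g x))" by (rule fourier_mult_integrable[OF fi F gi G])
    have "(LINT \<xi>|lborel. cmod (fourier (\<lambda>x. f m x * ?g x) \<xi>)) \<le> (LINT \<xi>|lborel. cmod (fourier (f m) \<xi>)) * (LINT \<xi>|lborel. cmod (fourier ?g \<xi>))"
      by (rule fourier_mult_integrable[OF fi F gi G])
    also have "\<dots> \<le> L * L ^ m"
    proof (intro mult_mono)
      have "0 \<le> (LINT \<xi>|lborel. cmod (fourier (f m) \<xi>))" by simp
      then show "0 \<le> L" using L order_trans by blast
    qed (use L step in auto)
    finally show "(LINT \<xi>|lborel. cmod (fourier (\<lambda>x. f m x * ?g x) \<xi>)) \<le> L ^ Suc m" by simp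
    show "ennreal (cmod (fourier (\<lambda>x. f m x * ?g x) \<xi>)) \<le> convolution_power (Suc m) a \<xi>" for \<xi>
    proof -
      have "ennreal (cmod (fourier (\<lambda>x. f m x * ?g x) \<xi>)) \<le>
        (\<integral>\<^sup>+ \<zeta>. ennreal (cmod (fourier (f m) (\<xi> - \<zeta>))) * ennreal (cmod (fourier ?g \<zeta>)) \<partial>lborel)"
        by (rule norm_fourier_mult_le_nn[OF fi gi G])
      also have "\<dots> \<le> convolution_power (Suc m) a \<xi>"
        unfolding convolution_power_Suc[OF step(1)] Defs.convolution_def
        using a step by (intro nn_integral_mono mult_mono) auto
      finally show ?thesis .
    qed
  qed
qed

text \<open>The exponential of a twist can be attached to a single factor, here the one with index
  \<open>m\<close>. The summand \<open>2 * \<alpha>\<close> in \<open>tw\<close> covers frequencies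
  where \<open>a\<close> is too small to absorb the growth of the continuation; integrated against
  the transform of the other \<open>m\<close> factors it costs
  \<open>2 * \<alpha> * L ^ m\<close>.\<close>

lemma fourier_twist_product_bound:
  fixes f :: "nat \<Rightarrow> real ^ 'd::finite \<Rightarrow> complex"
  assumes m: "m \<ge> 1"
    and sup: "\<And>i. supported_in B (f i)" and F: "\<And>i. integrable lborel (fourier (f i))"
    and L: "\<And>i. (LINT \<xi>|lborel. cmod (fourier (f i) \<xi>)) \<le> L"
    and a: "\<And>i \<xi>. ennreal (cmod (fourier (f i) \<xi>)) \<le> a \<xi>"
    and \<alpha>: "\<alpha> \<ge> 0"
    and tw: "\<And>\<zeta>. ennreal (cmod (fourier (twist (f m) \<eta> z) \<zeta>)) \<le> 2 * a \<zeta> + ennreal (2 * \<alpha>)"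
  shows "ennreal (cmod (fourier (twist (\<lambda>x. \<Prod>i<Suc m. f i x) \<eta> z) \<xi>)) \<le>
    2 * convolution_power (Suc m) a \<xi> + ennreal (2 * \<alpha> * L ^ m)"
proof -
  let ?g = "\<lambda>x. \<Prod>i<m. f i x"
  note g = product_fourier[where f=f, OF m sup F L a]
  have gi: "integrable lborel ?g" using g by (simp add: supported_in_def)
  have G: "integrable lborel (fourier ?g)" using g by simp
  have [measurable]: "fourier ?g \<in> borel_measurable borel" using G by simp
  have ti: "integrable lborel (twist (f m) \<eta> z)" using sup by (rule twist_integrable)
  note [measurable] = fourier_measurable[OF ti]
  \<comment> \<open>\<open>a\<close> need not be measurable, so the integral is split through the measurable minorant \<open>P\<close>.\<close>
  define P where "P = (\<lambda>\<zeta>. max 0 (cmod (fourier (twist (f m) \<eta> z) \<zeta>) - 2 * \<alpha>) / 2)"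
  have [measurable]: "P \<in> borel_measurable borel" unfolding P_def by measurable
  have Pn: "P \<zeta> \<ge> 0" for \<zeta> by (simp add: P_def)
  have Pa: "ennreal (P \<zeta>) \<le> a \<zeta>" for \<zeta>
  proof (cases "a \<zeta>")
    case (real r)
    then have "ennreal (cmod (fourier (twist (f m) \<eta> z) \<zeta>)) \<le> ennreal (2 * r + 2 * \<alpha>)"
      using tw[of \<zeta>] \<alpha> by (simp add: ennreal_plus ennreal_mult flip: ennreal_numeral)
    then have "cmod (fourier (twist (f m) \<eta> z) \<zeta>) \<le> 2 * r + 2 * \<alpha>" using real \<alpha> by (simp add: ennreal_le_iff del: ennreal_plus)
    then show ?thesis using real by (auto simp: P_def intro!: ennreal_leI)
  qed simp
  have eq: "twist (\<lambda>x. \<Prod>i<Suc m. f i x) \<eta> z = (\<lambda>x. twist (f m) \<eta> z x * ?g x)"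
    by (simp add: twist_def fun_eq_iff mult_ac)
  have "ennreal (cmod (fourier (twist (\<lambda>x. \<Prod>i<Suc m. f i x) \<eta> z) \<xi>)) \<le>
      (\<integral>\<^sup>+ \<zeta>. ennreal (cmod (fourier (twist (f m) \<eta> z) (\<xi> - \<zeta>))) * ennreal (cmod (fourier ?g \<zeta>)) \<partial>lborel)"
    unfolding eq by (rule norm_fourier_mult_le_nn[OF ti gi G])
  also have "\<dots> \<le> (\<integral>\<^sup>+ \<zeta>. 2 * (ennreal (P (\<xi> - \<zeta>)) * ennreal (cmod (fourier ?g \<zeta>))) + ennreal (2 * \<alpha>) * ennreal (cmod (fourier ?g \<zeta>)) \<partial>lborel)"
  proof (intro nn_integral_mono)
    fix \<zeta>
    have "cmod (fourier (twist (f m) \<eta> z) (\<xi> - \<zeta>)) \<le> 2 * P (\<xi> - \<zeta>) + 2 * \<alpha>" by (simp add: P_def)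
    then have "ennreal (cmod (fourier (twist (f m) \<eta> z) (\<xi> - \<zeta>))) \<le> ennreal (2 * P (\<xi> - \<zeta>) + 2 * \<alpha>)" by (rule ennreal_leI)
    also have "\<dots> = 2 * ennreal (P (\<xi> - \<zeta>)) + ennreal (2 * \<alpha>)"
      using \<alpha> Pn[of "\<xi> - \<zeta>"] by (simp add: ennreal_mult)
    finally show "ennreal (cmod (fourier (twist (f m) \<eta> z) (\<xi> - \<zeta>))) * ennreal (cmod (fourier ?g \<zeta>)) \<le>
        2 * (ennreal (P (\<xi> - \<zeta>)) * ennreal (cmod (fourier ?g \<zeta>))) + ennreal (2 * \<alpha>) * ennreal (cmod (fourier ?g \<zeta>))"
      by (simp only: mult.assoc[symmetric] distrib_right[symmetric]) (intro mult_right_mono, auto)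
  qed
  also have "\<dots> = 2 * (\<integral>\<^sup>+ \<zeta>. ennreal (P (\<xi> - \<zeta>)) * ennreal (cmod (fourier ?g \<zeta>)) \<partial>lborel) + ennreal (2 * \<alpha>) * (\<integral>\<^sup>+ \<zeta>. ennreal (cmod (fourier ?g \<zeta>)) \<partial>lborel)"
    by (subst nn_integral_add) (auto simp: nn_integral_cmult)
  also have "\<dots> \<le> 2 * convolution_power (Suc m) a \<xi> + ennreal (2 * \<alpha>) * ennreal (L ^ m)"
  proof (intro add_mono mult_left_mono)
    show "(\<integral>\<^sup>+ \<zeta>. ennreal (P (\<xi> - \<zeta>)) * ennreal (cmod (fourier ?g \<zeta>)) \<partial>lborel) \<le> convolution_power (Suc m) a \<xi>"
      unfolding convolution_power_Suc[OF m] Defs.convolution_def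
      using g Pa by (intro nn_integral_mono mult_mono) auto
    show "(\<integral>\<^sup>+ \<zeta>. ennreal (cmod (fourier ?g \<zeta>)) \<partial>lborel) \<le> ennreal (L ^ m)"
      using g G by (subst nn_integral_eq_integral) (auto intro!: ennreal_leI)
  qed auto
  also have "ennreal (2 * \<alpha>) * ennreal (L ^ m) = ennreal (2 * \<alpha> * L ^ m)"
    using \<alpha> by (simp add: ennreal_mult')
  finally show ?thesis .
qed

section \<open>The Fourier transform on square integrable functions and Sobolev spaces\<close>

lemma square_integrable_cutoff:
  fixes f :: "real ^ 'd::finite \<Rightarrow> complex"
  assumes f: "square_integrable f" and S[measurable]: "S \<in> sets borel" and fin: "emeasure lborel S < \<infinity>"
  shows "integrable lborel (\<lambda>x. indicator S x *\<^sub>R f x)"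
proof -
  have [measurable]: "f \<in> borel_measurable borel" and i: "integrable lborel (\<lambda>x. (cmod (f x))\<^sup>2)"
    using f by (auto simp: square_integrable_def)
  have Si: "integrable lborel (indicator S :: _ \<Rightarrow> real)"
    using fin by (intro integrable_real_indicator) auto
  show ?thesis
  proof (rule Bochner_Integration.integrable_bound)
    show "integrable lborel (\<lambda>x. indicator S x + (cmod (f x))\<^sup>2)" using Si i by simp
    have "r \<le> 1 + r\<^sup>2" if "r \<ge> 0" for r :: real
      using sum_squares_ge_zero[of "r - 1/2" 0] by (simp add: power2_eq_square algebra_simps)
    then show "AE x in lborel. norm (indicator S x *\<^sub>R f x) \<le> norm (indicator S x + (cmod (f x))\<^sup>2)"
      by (intro AE_I2) (auto simp: indicator_def)
  qed simp
qed

lemma square_integrable_cutoff_cball: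
  fixes f :: "real ^ 'd::finite \<Rightarrow> complex"
  assumes "square_integrable f"
  shows "integrable lborel (\<lambda>x. indicator (cball 0 R) x *\<^sub>R f x)"
  by (rule square_integrable_cutoff[OF assms]) (use emeasure_lborel_cball_finite in auto)

lemma square_integrable_supported:
  fixes f :: "real ^ 'd::finite \<Rightarrow> complex"
  assumes f: "square_integrable f" and s: "AE x in lborel. infnorm x \<ge> B \<longrightarrow> f x = 0"
  shows "supported_in B f"
  unfolding supported_in_def
proof
  have "integrable lborel (\<lambda>x. indicator {x. infnorm x < B} x *\<^sub>R f x)"
    by (rule square_integrable_cutoff[OF f _ infnorm_ball_finite]) simp
  moreover have "AE x in lborel. indicator {x. infnorm x < B} x *\<^sub>R f x = f x"
    using s by eventually_elim (auto simp: indicator_def)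
  ultimately show "integrable lborel f"
    using f by (subst (asm) integrable_cong_AE) (auto simp: square_integrable_def)
qed (rule s)

text \<open>The complement of the support is a union of open sets on which \<open>f\<close> vanishes
  almost everywhere; by Lindelof countably many of them suffice, so the exceptional sets add up to a
  null set.\<close>

lemma ess_support_AE:
  assumes "ess_support f \<subseteq> {x. infnorm x < B}"
  shows "AE x in lborel. infnorm x \<ge> B \<longrightarrow> f x = 0"
proof -
  define \<F> where "\<F> = {V. open V \<and> (AE y in lborel. y \<in> V \<longrightarrow> f y = 0)}"
  obtain \<G> where G: "\<G> \<subseteq> \<F>" "countable \<G>" "\<Union>\<G> = \<Union>\<F>"
    using Lindelof[of \<F>] by (auto simp: \<F>_def)
  have "AE y in lborel. \<forall>V\<in>\<G>. y \<in> V \<longrightarrow> f y = 0"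
    using G by (subst AE_ball_countable) (auto simp: \<F>_def)
  then show ?thesis
  proof eventually_elim
    case (elim x)
    show ?case
    proof
      assume "B \<le> infnorm x"
      then have "x \<notin> ess_support f" using assms by fastforce
      then obtain V where "V \<in> \<F>" "x \<in> V" unfolding ess_support_def \<F>_def by blast
      then show "f x = 0" using G elim by blast
    qed
  qed
qed

section \<open>Linearity and uniqueness of the Plancherel transform\<close>

abbreviation cutoff :: "real \<Rightarrow> (real ^ 'd::finite \<Rightarrow> complex) \<Rightarrow> real ^ 'd \<Rightarrow> complex" where
  "cutoff R f \<equiv> (\<lambda>x. indicator (cball 0 R) x *\<^sub>R f x)"

lemma cutoff_fourier_measurable:
  assumes "square_integrable f"
  shows "fourier (cutoff R f) \<in> borel_measurable borel"
  by (rule fourier_measurable[OF square_integrable_cutoff_cball[OF assms]])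

lemma norm_add_sq_le: "(norm (x + y))\<^sup>2 \<le> 2 * (norm x)\<^sup>2 + 2 * (norm (y :: 'a::real_normed_vector))\<^sup>2"
proof -
  have "(norm (x + y))\<^sup>2 \<le> (norm x + norm y)\<^sup>2" by (intro power_mono norm_triangle_ineq) auto
  also have "\<dots> \<le> 2 * (norm x)\<^sup>2 + 2 * (norm y)\<^sup>2"
    using sum_squares_bound[of "norm x" "norm y"] unfolding power2_sum by linarith
  finally show ?thesis .
qed

lemma nn_integral_sq_add_le:
  fixes F G :: "'a \<Rightarrow> complex"
  assumes [measurable]: "F \<in> borel_measurable M" "G \<in> borel_measurable M"
  shows "(\<integral>\<^sup>+ x. ennreal ((cmod (F x + G x))\<^sup>2) \<partial>M) \<le>
    2 * (\<integral>\<^sup>+ x. ennreal ((cmod (F x))\<^sup>2) \<partial>M) + 2 * (\<integral>\<^sup>+ x. ennreal ((cmod (G x))\<^sup>2) \<partial>M)"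
proof -
  have "(\<integral>\<^sup>+ x. ennreal ((cmod (F x + G x))\<^sup>2) \<partial>M) \<le> (\<integral>\<^sup>+ x. 2 * ennreal ((cmod (F x))\<^sup>2) + 2 * ennreal ((cmod (G x))\<^sup>2) \<partial>M)"
  proof (intro nn_integral_mono)
    fix x
    have "ennreal ((cmod (F x + G x))\<^sup>2) \<le> ennreal (2 * (cmod (F x))\<^sup>2 + 2 * (cmod (G x))\<^sup>2)"
      by (intro ennreal_leI norm_add_sq_le)
    then show "ennreal ((cmod (F x + G x))\<^sup>2) \<le> 2 * ennreal ((cmod (F x))\<^sup>2) + 2 * ennreal ((cmod (G x))\<^sup>2)"
      by (simp add: ennreal_mult)
  qed
  also have "\<dots> = 2 * (\<integral>\<^sup>+ x. ennreal ((cmod (F x))\<^sup>2) \<partial>M) + 2 * (\<integral>\<^sup>+ x. ennreal ((cmod (G x))\<^sup>2) \<partial>M)"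
    by (subst nn_integral_add) (auto simp: nn_integral_cmult)
  finally show ?thesis .
qed

lemma square_integrable_add:
  assumes f: "square_integrable f" and g: "square_integrable g"
  shows "square_integrable (\<lambda>x. f x + g x)"
  unfolding square_integrable_def
proof
  show m: "(\<lambda>x. f x + g x) \<in> borel_measurable lborel" using f g by (auto simp: square_integrable_def)
  show "integrable lborel (\<lambda>x. (cmod (f x + g x))\<^sup>2)"
  proof (rule Bochner_Integration.integrable_bound)
    show "integrable lborel (\<lambda>x. 2 * (cmod (f x))\<^sup>2 + 2 * (cmod (g x))\<^sup>2)"
      using f g by (simp add: square_integrable_def)
    show "AE x in lborel. norm ((cmod (f x + g x))\<^sup>2) \<le> norm (2 * (cmod (f x))\<^sup>2 + 2 * (cmod (g x))\<^sup>2)"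
      using norm_add_sq_le[of "f _" "g _"] by simp
  qed (use m in measurable)
qed

lemma square_integrable_cmult:
  assumes f: "square_integrable f"
  shows "square_integrable (\<lambda>x. c * f x)"
  using f by (auto simp: square_integrable_def norm_mult power_mult_distrib)

lemma has_L2_fourier_add:
  fixes f g :: "real ^ 'd::finite \<Rightarrow> complex"
  assumes f: "has_L2_fourier f F" and g: "has_L2_fourier g G"
  shows "has_L2_fourier (\<lambda>x. f x + g x) (\<lambda>x. F x + G x)"
  unfolding has_L2_fourier_def
proof (intro conjI)
  have sf: "square_integrable f" and sF: "square_integrable F" and sg: "square_integrable g" and sG: "square_integrable G"
    using f g by (auto simp: has_L2_fourier_def)
  show "square_integrable (\<lambda>x. f x + g x)" "square_integrable (\<lambda>x. F x + G x)"
    using sf sg sF sG by (auto intro: square_integrable_add)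
  let ?e = "\<lambda>f F R. \<integral>\<^sup>+ \<xi>. ennreal ((cmod (fourier (cutoff R f) \<xi> - F \<xi>))\<^sup>2) \<partial>lborel"
  have [measurable]: "F \<in> borel_measurable borel" "G \<in> borel_measurable borel"
    using sF sG by (auto simp: square_integrable_def)
  note [measurable] = cutoff_fourier_measurable[OF sf] cutoff_fourier_measurable[OF sg]
  have le: "?e (\<lambda>x. f x + g x) (\<lambda>x. F x + G x) R \<le> 2 * ?e f F R + 2 * ?e g G R" for R
  proof -
    have "fourier (cutoff R (\<lambda>x. f x + g x)) \<xi> = fourier (cutoff R f) \<xi> + fourier (cutoff R g) \<xi>" for \<xi>
      unfolding fourier_def scaleR_add_right distrib_right
      by (intro Bochner_Integration.integral_add integrable_fourier_kernel square_integrable_cutoff_cball sf sg)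
    then have "?e (\<lambda>x. f x + g x) (\<lambda>x. F x + G x) R =
        (\<integral>\<^sup>+ \<xi>. ennreal ((cmod ((fourier (cutoff R f) \<xi> - F \<xi>) + (fourier (cutoff R g) \<xi> - G \<xi>)))\<^sup>2) \<partial>lborel)"
      by (simp add: add_diff_add)
    also have "\<dots> \<le> 2 * ?e f F R + 2 * ?e g G R" by (rule nn_integral_sq_add_le) measurable
    finally show ?thesis .
  qed
  have "((\<lambda>R. 2 * ?e f F R + 2 * ?e g G R) \<longlongrightarrow> 2 * 0 + 2 * 0) at_top"
    using f g by (intro tendsto_add ennreal_tendsto_cmult) (auto simp: has_L2_fourier_def)
  then have "((\<lambda>R. 2 * ?e f F R + 2 * ?e g G R) \<longlongrightarrow> 0) at_top" by (simp only: mult_zero_right add_0_left)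
  then show "(?e (\<lambda>x. f x + g x) (\<lambda>x. F x + G x) \<longlongrightarrow> 0) at_top"
    by (rule tendsto_sandwich[OF always_eventually always_eventually tendsto_const, rotated 2])
      (simp_all only: le zero_le simp_thms)
qed

lemma has_L2_fourier_cmult:
  fixes f :: "real ^ 'd::finite \<Rightarrow> complex"
  assumes f: "has_L2_fourier f F"
  shows "has_L2_fourier (\<lambda>x. c * f x) (\<lambda>x. c * F x)"
  unfolding has_L2_fourier_def
proof (intro conjI)
  have sf: "square_integrable f" and sF: "square_integrable F"
    using f by (auto simp: has_L2_fourier_def)
  show "square_integrable (\<lambda>x. c * f x)" "square_integrable (\<lambda>x. c * F x)"
    using sf sF by (auto intro: square_integrable_cmult)
  let ?e = "\<lambda>f F R. \<integral>\<^sup>+ \<xi>. ennreal ((cmod (fourier (cutoff R f) \<xi> - F \<xi>))\<^sup>2) \<partial>lborel"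
  have [measurable]: "F \<in> borel_measurable borel"
    using sF by (auto simp: square_integrable_def)
  note [measurable] = cutoff_fourier_measurable[OF sf]
  have "?e (\<lambda>x. c * f x) (\<lambda>x. c * F x) R = ennreal ((cmod c)\<^sup>2) * ?e f F R" for R
  proof -
    have "fourier (cutoff R (\<lambda>x. c * f x)) \<xi> = c * fourier (cutoff R f) \<xi>" for \<xi>
      unfolding fourier_def by (subst integral_mult_right_zero[symmetric]) (simp add: mult_ac)
    then have "?e (\<lambda>x. c * f x) (\<lambda>x. c * F x) R =
        (\<integral>\<^sup>+ \<xi>. ennreal ((cmod c)\<^sup>2) * ennreal ((cmod (fourier (cutoff R f) \<xi> - F \<xi>))\<^sup>2) \<partial>lborel)"
      by (simp add: right_diff_distrib[symmetric] norm_mult power_mult_distrib ennreal_mult)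
    also have "\<dots> = ennreal ((cmod c)\<^sup>2) * ?e f F R" by (rule nn_integral_cmult) measurable
    finally show ?thesis .
  qed
  moreover have "((\<lambda>R. ennreal ((cmod c)\<^sup>2) * ?e f F R) \<longlongrightarrow> ennreal ((cmod c)\<^sup>2) * 0) at_top"
    using f by (intro ennreal_tendsto_cmult) (auto simp: has_L2_fourier_def)
  ultimately show "(?e (\<lambda>x. c * f x) (\<lambda>x. c * F x) \<longlongrightarrow> 0) at_top" by simp
qed

text \<open>The mild equation holds only almost everywhere in \<open>x\<close>; this is how it is
  carried to the frequency side.\<close>

lemma has_L2_fourier_cong_AE:
  fixes f g :: "real ^ 'd::finite \<Rightarrow> complex"
  assumes f: "has_L2_fourier f F" and g: "g \<in> borel_measurable borel" and eq: "AE x in lborel. f x = g x"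
  shows "has_L2_fourier g F"
proof -
  have sf: "square_integrable f" using f by (auto simp: has_L2_fourier_def)
  have [measurable]: "f \<in> borel_measurable borel" using sf by (simp add: square_integrable_def)
  note [measurable] = g
  have "integrable lborel (\<lambda>x. (cmod (g x))\<^sup>2)"
    using sf unfolding square_integrable_def
    by (subst integrable_cong_AE[where g="\<lambda>x. (cmod (f x))\<^sup>2"]) (use eq in auto)
  then have sg: "square_integrable g" by (simp add: square_integrable_def)
  have "fourier (cutoff R g) = fourier (cutoff R f)" for R
    unfolding fourier_def
  proof (intro ext integral_cong_AE)
    fix \<xi>
    show "AE x in lborel. cutoff R g x * exp (- \<i> * of_real (x \<bullet> \<xi>)) = cutoff R f x * exp (- \<i> * of_real (x \<bullet> \<xi>))"
      using eq by eventually_elim simp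
  qed (rule borel_measurable_integrable[OF integrable_fourier_kernel[OF square_integrable_cutoff_cball[OF sg]]]
      borel_measurable_integrable[OF integrable_fourier_kernel[OF square_integrable_cutoff_cball[OF sf]]])+
  then show ?thesis using f sg by (simp add: has_L2_fourier_def)
qed

text \<open>By linearity \<open>F - G\<close> is a transform of the zero function, whose truncations
  all have transform zero. The mean-square error is then independent of \<open>R\<close>, and it
  tends to 0.\<close>

lemma has_L2_fourier_unique:
  fixes f :: "real ^ 'd::finite \<Rightarrow> complex"
  assumes f: "has_L2_fourier f F" and g: "has_L2_fourier f G"
  shows "AE \<xi> in lborel. F \<xi> = G \<xi>"
proof -
  have d: "has_L2_fourier (\<lambda>x. f x + (-1) * f x) (\<lambda>x. F x + (-1) * G x)"
    by (intro has_L2_fourier_add has_L2_fourier_cmult f g)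
  have [measurable]: "F \<in> borel_measurable borel" "G \<in> borel_measurable borel"
    using f g by (auto simp: has_L2_fourier_def square_integrable_def)
  have "((\<lambda>R::real. \<integral>\<^sup>+ \<xi>. ennreal ((cmod (F \<xi> - G \<xi>))\<^sup>2) \<partial>lborel) \<longlongrightarrow> 0) at_top"
    using d by (simp add: has_L2_fourier_def fourier_def norm_minus_commute)
  then have "(\<integral>\<^sup>+ \<xi>. ennreal ((cmod (F \<xi> - G \<xi>))\<^sup>2) \<partial>lborel) = 0"
    by (simp add: tendsto_const_iff)
  then show ?thesis by (subst (asm) nn_integral_0_iff_AE) (auto elim!: eventually_mono)
qed

text \<open>Truncation to a ball has no effect once the ball contains the cube of half side
  \<open>B\<close>, so the limit in the mean is that of a constant family. The factor
  \<open>sqrt (real CARD('d))\<close> compares the Euclidean norm of the truncation with the maximum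
  norm of the support.\<close>

lemma has_L2_fourier_supported:
  fixes f :: "real ^ 'd::finite \<Rightarrow> complex"
  assumes f: "has_L2_fourier f F" and s: "supported_in B f"
  shows "AE \<xi> in lborel. F \<xi> = fourier f \<xi>"
proof -
  let ?e = "\<lambda>R. \<integral>\<^sup>+ \<xi>. ennreal ((cmod (fourier (cutoff R f) \<xi> - F \<xi>))\<^sup>2) \<partial>lborel"
  have fi: "integrable lborel f" using s by (simp add: supported_in_def)
  have sf: "square_integrable f" using f by (simp add: has_L2_fourier_def)
  have [measurable]: "F \<in> borel_measurable borel" "f \<in> borel_measurable borel"
    using f by (auto simp: has_L2_fourier_def square_integrable_def)
  note [measurable] = fourier_measurable[OF fi]
  have "fourier (cutoff R f) = fourier f" if R: "R \<ge> sqrt (real CARD('d)) * B" for R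
    unfolding fourier_def
  proof (intro ext integral_cong_AE)
    fix \<xi>
    have "AE x in lborel. infnorm x \<ge> B \<longrightarrow> f x = 0" using s by (simp add: supported_in_def)
    then show "AE x in lborel. cutoff R f x * exp (- \<i> * of_real (x \<bullet> \<xi>)) = f x * exp (- \<i> * of_real (x \<bullet> \<xi>))"
    proof eventually_elim
      case (elim x)
      show ?case
      proof (cases "f x = 0")
        case False
        then have "infnorm x \<le> B" using elim by linarith
        then have "sqrt (real CARD('d)) * infnorm x \<le> sqrt (real CARD('d)) * B" by (intro mult_left_mono) auto
        moreover have "norm x \<le> sqrt (real CARD('d)) * infnorm x" using norm_le_infnorm[of x] by simp
        ultimately have "x \<in> cball 0 R" using R by (simp only: mem_cball dist_0_norm)
        then show ?thesis by simp
      qed simp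
    qed
  qed (rule borel_measurable_integrable[OF integrable_fourier_kernel[OF square_integrable_cutoff_cball[OF sf]]]
      borel_measurable_integrable[OF integrable_fourier_kernel[OF fi]])+
  then have ev: "\<forall>\<^sub>F R in at_top. ?e R = (\<integral>\<^sup>+ \<xi>. ennreal ((cmod (fourier f \<xi> - F \<xi>))\<^sup>2) \<partial>lborel)"
    by (intro eventually_mono[OF eventually_ge_at_top[of "sqrt (real CARD('d)) * B"]]) simp
  have lim: "(?e \<longlongrightarrow> 0) at_top" using f by (simp add: has_L2_fourier_def)
  have "((\<lambda>R::real. \<integral>\<^sup>+ \<xi>. ennreal ((cmod (fourier f \<xi> - F \<xi>))\<^sup>2) \<partial>lborel) \<longlongrightarrow> 0) at_top"
    by (rule iffD1[OF tendsto_cong[OF ev] lim])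
  then have "(\<integral>\<^sup>+ \<xi>. ennreal ((cmod (fourier f \<xi> - F \<xi>))\<^sup>2) \<partial>lborel) = 0"
    by (simp add: tendsto_const_iff)
  then show ?thesis by (subst (asm) nn_integral_0_iff_AE) (auto elim!: eventually_mono)
qed

section \<open>Sobolev spaces on the frequency side\<close>

abbreviation sobolev_density :: "real \<Rightarrow> (real ^ 'd::finite \<Rightarrow> complex) \<Rightarrow> real ^ 'd \<Rightarrow> real" where
  "sobolev_density s F \<equiv> (\<lambda>\<xi>. (1 + (norm \<xi>)\<^sup>2) powr s * (cmod (F \<xi>))\<^sup>2)"

text \<open>Carrying an explicit transform \<open>F\<close> makes sums and multiples computable,
  whereas \<open>sobolev_norm\<close> is defined through an unspecified choice.\<close>

definition has_sobolev_fourier :: "real \<Rightarrow> (real ^ 'd::finite \<Rightarrow> complex) \<Rightarrow> (real ^ 'd \<Rightarrow> complex) \<Rightarrow> bool" where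
  "has_sobolev_fourier s f F \<longleftrightarrow> has_L2_fourier f F \<and> integrable lborel (sobolev_density s F)"

lemma sobolev_density_cong_AE:
  fixes F G :: "real ^ 'd::finite \<Rightarrow> complex"
  assumes [measurable]: "F \<in> borel_measurable borel" "G \<in> borel_measurable borel" and eq: "AE \<xi> in lborel. F \<xi> = G \<xi>"
  shows "integrable lborel (sobolev_density s F) \<longleftrightarrow> integrable lborel (sobolev_density s G)"
    and "integral\<^sup>L lborel (sobolev_density s F) = integral\<^sup>L lborel (sobolev_density s G)"
proof -
  have d: "AE \<xi> in lborel. sobolev_density s F \<xi> = sobolev_density s G \<xi>"
    using eq by eventually_elim simp
  show "integrable lborel (sobolev_density s F) \<longleftrightarrow> integrable lborel (sobolev_density s G)"
    by (rule integrable_cong_AE[OF _ _ d]) measurable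
  show "integral\<^sup>L lborel (sobolev_density s F) = integral\<^sup>L lborel (sobolev_density s G)"
    by (rule integral_cong_AE[OF _ _ d]) measurable
qed

lemma has_L2_fourier_measurable: "has_L2_fourier f F \<Longrightarrow> F \<in> borel_measurable borel"
  "has_L2_fourier f F \<Longrightarrow> f \<in> borel_measurable borel"
  by (simp_all add: has_L2_fourier_def square_integrable_def)

lemma sobolev_space_fourier:
  assumes "f \<in> sobolev_space s" "has_L2_fourier f F"
  shows "has_sobolev_fourier s f F"
proof -
  obtain G where G: "has_L2_fourier f G" "integrable lborel (sobolev_density s G)"
    using assms(1) by (auto simp: sobolev_space_def)
  then show ?thesis
    using sobolev_density_cong_AE(1)[of G F s] has_L2_fourier_unique[OF G(1) assms(2)] assms(2)
    by (simp add: has_sobolev_fourier_def has_L2_fourier_measurable)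
qed

lemma sobolev_norm_eq:
  assumes "has_L2_fourier f F"
  shows "sobolev_norm s f = sqrt (integral\<^sup>L lborel (sobolev_density s F))"
proof -
  define G where "G = (SOME F. has_L2_fourier f F)"
  have G: "has_L2_fourier f G" unfolding G_def by (rule someI[of "has_L2_fourier f", OF assms])
  then have "integral\<^sup>L lborel (sobolev_density s G) = integral\<^sup>L lborel (sobolev_density s F)"
    using sobolev_density_cong_AE(2)[of G F s] has_L2_fourier_unique[OF G assms] assms
    by (simp add: has_L2_fourier_measurable)
  then show ?thesis by (simp add: sobolev_norm_def G_def[symmetric] Let_def)
qed

lemma has_sobolev_fourier_add:
  fixes f g :: "real ^ 'd::finite \<Rightarrow> complex"
  assumes f: "has_sobolev_fourier s f F" and g: "has_sobolev_fourier s g G"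
  shows "has_sobolev_fourier s (\<lambda>x. f x + g x) (\<lambda>x. F x + G x)"
  unfolding has_sobolev_fourier_def
proof
  show "has_L2_fourier (\<lambda>x. f x + g x) (\<lambda>x. F x + G x)"
    using f g by (auto simp: has_sobolev_fourier_def intro: has_L2_fourier_add)
  have [measurable]: "F \<in> borel_measurable borel" "G \<in> borel_measurable borel"
    using f g by (auto simp: has_sobolev_fourier_def has_L2_fourier_measurable)
  show "integrable lborel (sobolev_density s (\<lambda>x. F x + G x))"
  proof (rule Bochner_Integration.integrable_bound)
    show "integrable lborel (\<lambda>x. 2 * sobolev_density s F x + 2 * sobolev_density s G x)"
      using f g by (simp add: has_sobolev_fourier_def)
    have "sobolev_density s (\<lambda>x. F x + G x) x \<le> 2 * sobolev_density s F x + 2 * sobolev_density s G x" for x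
      using mult_left_mono[OF norm_add_sq_le[of "F x" "G x"], of "(1 + (norm x)\<^sup>2) powr s"] by (simp add: algebra_simps)
    then show "AE x in lborel. norm (sobolev_density s (\<lambda>x. F x + G x) x) \<le> norm (2 * sobolev_density s F x + 2 * sobolev_density s G x)"
      by (intro AE_I2) (auto intro: order_trans[OF _ abs_ge_self])
  qed measurable
qed

lemma has_sobolev_fourier_cmult:
  fixes f :: "real ^ 'd::finite \<Rightarrow> complex"
  assumes f: "has_sobolev_fourier s f F"
  shows "has_sobolev_fourier s (\<lambda>x. c * f x) (\<lambda>x. c * F x)"
  unfolding has_sobolev_fourier_def
proof
  show "has_L2_fourier (\<lambda>x. c * f x) (\<lambda>x. c * F x)"
    using f by (auto simp: has_sobolev_fourier_def intro: has_L2_fourier_cmult)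
  have "integrable lborel (\<lambda>\<xi>. (cmod c)\<^sup>2 * sobolev_density s F \<xi>)"
    using f by (intro integrable_mult_right) (simp add: has_sobolev_fourier_def)
  then show "integrable lborel (sobolev_density s (\<lambda>x. c * F x))"
    by (simp only: norm_mult power_mult_distrib mult.left_commute)
qed

lemma has_L2_fourier_zero: "has_L2_fourier (\<lambda>x. 0) (\<lambda>x. 0)"
  by (simp add: has_L2_fourier_def square_integrable_def fourier_def)

lemma has_sobolev_fourier_sum:
  fixes f :: "'i \<Rightarrow> real ^ 'd::finite \<Rightarrow> complex"
  assumes "finite I" "\<And>i. i \<in> I \<Longrightarrow> has_sobolev_fourier s (f i) (F i)"
  shows "has_sobolev_fourier s (\<lambda>x. \<Sum>i\<in>I. f i x) (\<lambda>x. \<Sum>i\<in>I. F i x)"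
  using assms
proof (induction I rule: finite_induct)
  case empty
  then show ?case using has_L2_fourier_zero by (simp add: has_sobolev_fourier_def)
next
  case (insert i I)
  then show ?case by (simp add: has_sobolev_fourier_add)
qed

lemma sobolev_norm_L2_bound:
  fixes f :: "real ^ 'd::finite \<Rightarrow> complex"
  assumes f: "has_sobolev_fourier s f F" and s: "s \<ge> 0" and n: "sobolev_norm s f < e"
  shows "(\<integral>\<^sup>+ \<xi>. ennreal ((cmod (F \<xi>))\<^sup>2) \<partial>lborel) \<le> ennreal (e\<^sup>2)"
proof -
  have [measurable]: "F \<in> borel_measurable borel"
    using f by (auto simp: has_sobolev_fourier_def has_L2_fourier_measurable)
  have i: "integrable lborel (sobolev_density s F)" using f by (simp add: has_sobolev_fourier_def)
  have "(\<integral>\<^sup>+ \<xi>. ennreal ((cmod (F \<xi>))\<^sup>2) \<partial>lborel) \<le> (\<integral>\<^sup>+ \<xi>. ennreal (sobolev_density s F \<xi>) \<partial>lborel)"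
  proof (intro nn_integral_mono ennreal_leI)
    fix \<xi> :: "real ^ 'd"
    have "1 \<le> (1 + (norm \<xi>)\<^sup>2) powr s" using s by (intro ge_one_powr_ge_zero) auto
    then show "(cmod (F \<xi>))\<^sup>2 \<le> sobolev_density s F \<xi>" by (simp add: mult_le_cancel_right1)
  qed
  also have "\<dots> = ennreal (integral\<^sup>L lborel (sobolev_density s F))"
    by (rule nn_integral_eq_integral[OF i]) simp
  also have "\<dots> \<le> ennreal (e\<^sup>2)"
  proof (rule ennreal_leI)
    have "integral\<^sup>L lborel (sobolev_density s F) \<ge> 0" by simp
    moreover have "sqrt (integral\<^sup>L lborel (sobolev_density s F)) < e"
      using n sobolev_norm_eq[of f F s] f by (simp add: has_sobolev_fourier_def)
    ultimately show "integral\<^sup>L lborel (sobolev_density s F) \<le> e\<^sup>2"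
      using sqrt_le_D[of _ e] by simp
  qed
  finally show ?thesis .
qed

lemma integrable_inverse_one_plus_square: "integrable lborel (\<lambda>x::real. inverse (1 + x\<^sup>2))"
  using integrable_inverse_1_plus_square unfolding set_integrable_def einterval_eq indicator_UNIV scaleR_one .

text \<open>For \<open>s > d\<close> one factor \<open>1 / (1 + (norm \<xi>)\<^sup>2)\<close> can be
  spent on each of the d coordinates, and there it is at most the one-dimensional integrable
  weight.\<close>

lemma integrable_bessel_weight:
  assumes s: "s > real CARD('d::finite)"
  shows "integrable lborel (\<lambda>\<xi> :: real ^ 'd. (1 + (norm \<xi>)\<^sup>2) powr (- s))"
proof (rule Bochner_Integration.integrable_bound)
  have "integrable lborel (\<lambda>x. complex_of_real (inverse (1 + x\<^sup>2)))"
    using integrable_inverse_one_plus_square by (rule integrable_of_real)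
  then have "integrable lborel (\<lambda>\<xi> :: real ^ 'd. \<Prod>b\<in>Basis. complex_of_real (inverse (1 + (\<xi> \<bullet> b)\<^sup>2)))"
    using lborel_integrable_prod[where f="\<lambda>b x. complex_of_real (inverse (1 + x\<^sup>2))"] by blast
  then have "integrable lborel (\<lambda>\<xi> :: real ^ 'd. cmod (\<Prod>b\<in>Basis. complex_of_real (inverse (1 + (\<xi> \<bullet> b)\<^sup>2))))"
    by (rule integrable_norm)
  also have "(\<lambda>\<xi> :: real ^ 'd. cmod (\<Prod>b\<in>Basis. complex_of_real (inverse (1 + (\<xi> \<bullet> b)\<^sup>2)))) =
      (\<lambda>\<xi>. \<Prod>b\<in>Basis. inverse (1 + (\<xi> \<bullet> b)\<^sup>2))"
    unfolding prod_norm[symmetric] norm_of_real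
    by (intro ext prod.cong refl abs_of_nonneg) (simp add: add_nonneg_nonneg)
  finally show "integrable lborel (\<lambda>\<xi> :: real ^ 'd. \<Prod>b\<in>Basis. inverse (1 + (\<xi> \<bullet> b)\<^sup>2))" .
  show "AE \<xi> in lborel. norm ((1 + (norm \<xi>)\<^sup>2) powr (- s)) \<le> norm (\<Prod>b\<in>Basis. inverse (1 + ((\<xi> :: real ^ 'd) \<bullet> b)\<^sup>2))"
  proof (intro AE_I2)
    fix \<xi> :: "real ^ 'd"
    have "(1 + (norm \<xi>)\<^sup>2) powr (- s) \<le> (1 + (norm \<xi>)\<^sup>2) powr (- real CARD('d))"
      using s by (intro powr_mono) auto
    also have "\<dots> = (\<Prod>b\<in>(Basis :: (real ^ 'd) set). inverse (1 + (norm \<xi>)\<^sup>2))"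
      by (simp add: powr_minus powr_realpow add_pos_nonneg power_inverse)
    also have "\<dots> \<le> (\<Prod>b\<in>Basis. inverse (1 + (\<xi> \<bullet> b)\<^sup>2))"
    proof (intro prod_mono conjI le_imp_inverse_le)
      fix b :: "real ^ 'd" assume "b \<in> Basis"
      then have "\<bar>\<xi> \<bullet> b\<bar> \<le> norm \<xi>" by (rule Basis_le_norm)
      then show "1 + (\<xi> \<bullet> b)\<^sup>2 \<le> 1 + (norm \<xi>)\<^sup>2" by (simp add: abs_le_square_iff[symmetric])
    qed (auto simp: add_pos_nonneg)
    finally show "norm ((1 + (norm \<xi>)\<^sup>2) powr (- s)) \<le> norm (\<Prod>b\<in>Basis. inverse (1 + (\<xi> \<bullet> b)\<^sup>2))" by simp
  qed
qed measurable

text \<open>Pointwise, \<open>r \<le> w * r\<^sup>2 + 1 / w\<close> with \<open>w\<close> the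
  Sobolev weight and \<open>r\<close> the modulus of the transform; this takes the place of
  Cauchy-Schwarz. The bound depends on \<open>f\<close> only through \<open>M\<close>, hence is
  uniform in time when applied to the solution.\<close>

lemma sobolev_fourier_L1:
  fixes f :: "real ^ 'd::finite \<Rightarrow> complex"
  assumes f: "f \<in> sobolev_space s" and sup: "supported_in B f" and s: "s > real CARD('d)" and M: "sobolev_norm s f \<le> M"
  shows "integrable lborel (fourier f)"
    and "(LINT \<xi>|lborel. cmod (fourier f \<xi>)) \<le> M\<^sup>2 + (LINT \<xi>|lborel. (1 + (norm (\<xi> :: real ^ 'd))\<^sup>2) powr (- s))"
proof -
  have fi: "integrable lborel f" using sup by (simp add: supported_in_def)
  note m[measurable] = fourier_measurable[OF fi]
  obtain F where F: "has_L2_fourier f F" using f by (auto simp: sobolev_space_def)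
  have Fm: "F \<in> borel_measurable borel" using F by (rule has_L2_fourier_measurable)
  have eq: "AE \<xi> in lborel. F \<xi> = fourier f \<xi>" by (rule has_L2_fourier_supported[OF F sup])
  have i: "integrable lborel (sobolev_density s (fourier f))"
    using sobolev_space_fourier[OF f F] sobolev_density_cong_AE(1)[OF Fm m eq] by (simp add: has_sobolev_fourier_def)
  have "sqrt (integral\<^sup>L lborel (sobolev_density s (fourier f))) \<le> M"
    using M sobolev_norm_eq[OF F] sobolev_density_cong_AE(2)[OF Fm m eq] by simp
  then have iM: "integral\<^sup>L lborel (sobolev_density s (fourier f)) \<le> M\<^sup>2" by (rule sqrt_le_D)
  have b: "cmod (fourier f \<xi>) \<le> sobolev_density s (fourier f) \<xi> + (1 + (norm \<xi>)\<^sup>2) powr (- s)" for \<xi>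
  proof -
    define w r where "w = (1 + (norm \<xi>)\<^sup>2) powr s" and "r = cmod (fourier f \<xi>)"
    have w: "w > 0" using add_pos_nonneg[of 1 "(norm \<xi>)\<^sup>2"] by (simp add: w_def)
    have "0 \<le> (w * r - 1/2)\<^sup>2" by simp
    then have "w * r \<le> w * (w * r\<^sup>2) + 1" by (simp add: power2_eq_square algebra_simps)
    then have "w * r \<le> w * (w * r\<^sup>2 + inverse w)" using w by (simp add: algebra_simps)
    then have "r \<le> w * r\<^sup>2 + inverse w" using w by simp
    then show ?thesis by (simp add: w_def r_def powr_minus)
  qed
  note i2 = integrable_bessel_weight[OF s]
  show I: "integrable lborel (fourier f)"
  proof (rule Bochner_Integration.integrable_bound)
    show "integrable lborel (\<lambda>\<xi>. sobolev_density s (fourier f) \<xi> + (1 + (norm \<xi>)\<^sup>2) powr (- s))" using i i2 by simp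
    show "AE \<xi> in lborel. norm (fourier f \<xi>) \<le> norm (sobolev_density s (fourier f) \<xi> + (1 + (norm \<xi>)\<^sup>2) powr (- s))"
      using b by (auto intro!: AE_I2 order_trans[OF _ abs_ge_self])
  qed simp
  have "(LINT \<xi>|lborel. cmod (fourier f \<xi>)) \<le> (LINT \<xi>|lborel. sobolev_density s (fourier f) \<xi> + (1 + (norm \<xi>)\<^sup>2) powr (- s))"
    using b I i i2 by (intro integral_mono) auto
  also have "\<dots> = integral\<^sup>L lborel (sobolev_density s (fourier f)) + (LINT \<xi>|lborel. (1 + (norm (\<xi> :: real ^ 'd))\<^sup>2) powr (- s))"
    by (rule Bochner_Integration.integral_add[OF i i2])
  finally show "(LINT \<xi>|lborel. cmod (fourier f \<xi>)) \<le> M\<^sup>2 + (LINT \<xi>|lborel. (1 + (norm (\<xi> :: real ^ 'd))\<^sup>2) powr (- s))"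
    using iM by simp
qed

section \<open>Duhamel's formula at complex frequencies\<close>

text \<open>A Riemann sum involves finitely many times, so the almost-everywhere identities between
  Plancherel transforms and Fourier integrals hold simultaneously off one null set. Since the
  Sobolev weight is at least 1, convergence of the sums in the Sobolev norm gives mean-square
  convergence of these transforms. The factor \<open>sgn (t2 - t1)\<close> treats both orientations
  of the time interval.\<close>

lemma mild_riemann_L2:
  fixes u :: "real \<Rightarrow> real ^ 'd::finite \<Rightarrow> complex"
  assumes mild: "mild_solution \<omega> N s T u" and s: "s \<ge> 0"
    and t1: "t1 \<in> {-T..T}" and t2: "t2 \<in> {-T..T}" and ne: "t1 \<noteq> t2"
    and sob: "\<And>t. t \<in> {-T..T} \<Longrightarrow> u t \<in> sobolev_space s"
    and su: "\<And>t. t \<in> {-T..T} \<Longrightarrow> supported_in B (u t)"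
    and sN: "\<And>t. t \<in> {-T..T} \<Longrightarrow> supported_in B (N (u t))"
    and e: "e > 0"
  shows "\<exists>\<delta>>0. \<forall>p. p tagged_division_of {min t1 t2..max t1 t2} \<and> (\<forall>(\<tau>, J)\<in>p. measure lborel J < \<delta>) \<longrightarrow>
    (\<integral>\<^sup>+ \<xi>. ennreal ((cmod (fourier (u t2) \<xi> - propagator_symbol \<omega> (t2 - t1) \<xi> * fourier (u t1) \<xi> +
      \<i> * of_real (sgn (t2 - t1)) * (\<Sum>(\<tau>, J)\<in>p. of_real (measure lborel J) *
        (propagator_symbol \<omega> (t2 - \<tau>) \<xi> * fourier (N (u \<tau>)) \<xi>))))\<^sup>2) \<partial>lborel) \<le> ennreal (e\<^sup>2)"
proof -
  define a b where "a = min t1 t2" and "b = max t1 t2"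
  define \<sigma> where "\<sigma> = complex_of_real (sgn (t2 - t1))"
  have \<sigma>: "\<sigma> * \<sigma> = 1" "cmod \<sigma> = 1" using ne by (auto simp: \<sigma>_def sgn_real_def)
  have abT: "{a..b} \<subseteq> {-T..T}" using t1 t2 by (auto simp: a_def b_def)
  have seg: "closed_segment t1 t2 = {a..b}"
    by (auto simp: closed_segment_eq_real_ivl a_def b_def)
  obtain v w I where v: "has_fourier_multiplier (propagator_symbol \<omega> (t2 - t1)) (u t1) v"
    and w: "\<And>\<tau>. \<tau> \<in> {a..b} \<Longrightarrow> has_fourier_multiplier (propagator_symbol \<omega> (t2 - \<tau>)) (N (u \<tau>)) (w \<tau>)"
    and I: "has_sobolev_integral s w t1 t2 I" and eq: "AE x in lborel. u t2 x = v x - \<i> * I x"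
    using mild t1 t2 unfolding mild_solution_def seg[symmetric] by meson
  define J0 where "J0 = (\<lambda>x. \<sigma> * I x)"
  have ord: "has_sobolev_integral_ordered s w a b J0"
  proof (cases "t1 \<le> t2")
    case True
    then have "\<sigma> = 1" "a = t1" "b = t2" using ne by (auto simp: \<sigma>_def a_def b_def)
    then show ?thesis using I True by (simp add: has_sobolev_integral_def J0_def)
  next
    case False
    then have "\<sigma> = -1" "a = t2" "b = t1" by (auto simp: \<sigma>_def a_def b_def)
    then show ?thesis using I False by (simp add: has_sobolev_integral_def J0_def)
  qed
  have J0s: "J0 \<in> sobolev_space s" and ws: "\<And>\<tau>. \<tau> \<in> {a..b} \<Longrightarrow> w \<tau> \<in> sobolev_space s"
    using ord by (auto simp: has_sobolev_integral_ordered_def)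
  have J0m: "J0 \<in> borel_measurable borel"
    using J0s has_L2_fourier_measurable(2) by (auto simp: sobolev_space_def)
  obtain F1 where F1: "has_L2_fourier (u t1) F1" "has_L2_fourier v (\<lambda>\<xi>. propagator_symbol \<omega> (t2 - t1) \<xi> * F1 \<xi>)"
    using v by (auto simp: has_fourier_multiplier_def)
  obtain F2 where F2: "has_L2_fourier (u t2) F2"
    using sob[OF t2] by (auto simp: sobolev_space_def)
  have "\<forall>\<tau>\<in>{a..b}. \<exists>G. has_L2_fourier (N (u \<tau>)) G \<and> has_L2_fourier (w \<tau>) (\<lambda>\<xi>. propagator_symbol \<omega> (t2 - \<tau>) \<xi> * G \<xi>)"
    using w by (auto simp: has_fourier_multiplier_def)
  then obtain G where G: "\<And>\<tau>. \<tau> \<in> {a..b} \<Longrightarrow> has_L2_fourier (N (u \<tau>)) (G \<tau>)"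
    "\<And>\<tau>. \<tau> \<in> {a..b} \<Longrightarrow> has_L2_fourier (w \<tau>) (\<lambda>\<xi>. propagator_symbol \<omega> (t2 - \<tau>) \<xi> * G \<tau> \<xi>)"
    by metis
  \<comment> \<open>Solving \<open>u t2 = v - \<i> * I\<close> gives
    \<open>I = \<i> * (u t2 - v)\<close>, which expresses a transform of
    \<open>J0 = \<sigma> * I\<close> through the data.\<close>
  define FJ where "FJ = (\<lambda>\<xi>. \<sigma> * \<i> * (F2 \<xi> + (-1) * (propagator_symbol \<omega> (t2 - t1) \<xi> * F1 \<xi>)))"
  have h1: "has_L2_fourier (\<lambda>x. \<sigma> * \<i> * (u t2 x + (-1) * v x)) FJ"
    unfolding FJ_def by (intro has_L2_fourier_cmult has_L2_fourier_add F1 F2)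
  have h2: "AE x in lborel. \<sigma> * \<i> * (u t2 x + (-1) * v x) = J0 x"
    using eq
  proof eventually_elim
    case (elim x)
    show ?case unfolding elim J0_def by (simp add: algebra_simps)
  qed
  have "has_L2_fourier J0 FJ" by (rule has_L2_fourier_cong_AE[OF h1 J0m h2])
  then have J0F: "has_sobolev_fourier s J0 FJ" using J0s by (intro sobolev_space_fourier)
  have wF: "has_sobolev_fourier s (w \<tau>) (\<lambda>\<xi>. propagator_symbol \<omega> (t2 - \<tau>) \<xi> * G \<tau> \<xi>)" if "\<tau> \<in> {a..b}" for \<tau>
    using ws[OF that] G(2)[OF that] by (rule sobolev_space_fourier)
  obtain \<delta> where \<delta>: "\<delta> > 0" "\<And>p. p tagged_division_of {a..b} \<Longrightarrow> (\<forall>(\<tau>, J)\<in>p. measure lborel J < \<delta>) \<Longrightarrow>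
      sobolev_norm s (\<lambda>x. (\<Sum>(\<tau>, J)\<in>p. measure lborel J *\<^sub>R w \<tau> x) - J0 x) < e"
    using ord e unfolding has_sobolev_integral_ordered_def by blast
  have "(\<integral>\<^sup>+ \<xi>. ennreal ((cmod (fourier (u t2) \<xi> - propagator_symbol \<omega> (t2 - t1) \<xi> * fourier (u t1) \<xi> +
      \<i> * \<sigma> * (\<Sum>(\<tau>, J)\<in>p. of_real (measure lborel J) *
        (propagator_symbol \<omega> (t2 - \<tau>) \<xi> * fourier (N (u \<tau>)) \<xi>))))\<^sup>2) \<partial>lborel) \<le> ennreal (e\<^sup>2)"
    if p: "p tagged_division_of {a..b}" "\<forall>(\<tau>, J)\<in>p. measure lborel J < \<delta>" for p
  proof -
    have fin: "finite p" using p(1) by (rule tagged_division_ofD(1))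
    have tag: "fst q \<in> {a..b}" if "q \<in> p" for q
      using tagged_division_ofD(2,3)[OF p(1), of "fst q" "snd q"] that by auto
    define Fp where "Fp = (\<lambda>\<xi>. (\<Sum>q\<in>p. of_real (measure lborel (snd q)) * (propagator_symbol \<omega> (t2 - fst q) \<xi> * G (fst q) \<xi>)) + (-1) * FJ \<xi>)"
    have "has_sobolev_fourier s (\<lambda>x. (\<Sum>q\<in>p. of_real (measure lborel (snd q)) * w (fst q) x) + (-1) * J0 x) Fp"
      unfolding Fp_def
      by (intro has_sobolev_fourier_add has_sobolev_fourier_cmult has_sobolev_fourier_sum fin J0F wF tag)
    moreover have "sobolev_norm s (\<lambda>x. (\<Sum>q\<in>p. of_real (measure lborel (snd q)) * w (fst q) x) + (-1) * J0 x) < e"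
      using \<delta>(2)[OF p] by (simp add: case_prod_beta scaleR_conv_of_real[where 'a=complex])
    ultimately have "(\<integral>\<^sup>+ \<xi>. ennreal ((cmod (Fp \<xi>))\<^sup>2) \<partial>lborel) \<le> ennreal (e\<^sup>2)"
      using s by (intro sobolev_norm_L2_bound)
    also have "(\<integral>\<^sup>+ \<xi>. ennreal ((cmod (Fp \<xi>))\<^sup>2) \<partial>lborel) = (\<integral>\<^sup>+ \<xi>. ennreal ((cmod (fourier (u t2) \<xi> - propagator_symbol \<omega> (t2 - t1) \<xi> * fourier (u t1) \<xi> +
      \<i> * \<sigma> * (\<Sum>(\<tau>, J)\<in>p. of_real (measure lborel J) *
        (propagator_symbol \<omega> (t2 - \<tau>) \<xi> * fourier (N (u \<tau>)) \<xi>))))\<^sup>2) \<partial>lborel)"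
    proof (rule nn_integral_cong_AE)
      have "AE \<xi> in lborel. \<forall>q\<in>p. G (fst q) \<xi> = fourier (N (u (fst q))) \<xi>"
        by (intro AE_finite_allI fin has_L2_fourier_supported[OF G(1) sN] tag subsetD[OF abT])
      moreover have "AE \<xi> in lborel. F1 \<xi> = fourier (u t1) \<xi>" by (rule has_L2_fourier_supported[OF F1(1) su[OF t1]])
      moreover have "AE \<xi> in lborel. F2 \<xi> = fourier (u t2) \<xi>" by (rule has_L2_fourier_supported[OF F2 su[OF t2]])
      ultimately show "AE \<xi> in lborel. ennreal ((cmod (Fp \<xi>))\<^sup>2) = ennreal ((cmod (fourier (u t2) \<xi> - propagator_symbol \<omega> (t2 - t1) \<xi> * fourier (u t1) \<xi> +
        \<i> * \<sigma> * (\<Sum>(\<tau>, J)\<in>p. of_real (measure lborel J) *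
        (propagator_symbol \<omega> (t2 - \<tau>) \<xi> * fourier (N (u \<tau>)) \<xi>))))\<^sup>2)"
      proof eventually_elim
        case (elim \<xi>)
        define S where "S = (\<Sum>(\<tau>, J)\<in>p. of_real (measure lborel J) * (propagator_symbol \<omega> (t2 - \<tau>) \<xi> * fourier (N (u \<tau>)) \<xi>))"
        define X where "X = fourier (u t2) \<xi> - propagator_symbol \<omega> (t2 - t1) \<xi> * fourier (u t1) \<xi>"
        have fp: "Fp \<xi> = S - \<sigma> * \<i> * X"
          using elim by (simp add: Fp_def FJ_def S_def X_def case_prod_beta)
        \<comment> \<open>Multiplication by \<open>\<i> * \<sigma>\<close>, of modulus 1 and square
          -1, isolates \<open>X\<close> with coefficient 1.\<close>
        have "\<i> * \<sigma> * Fp \<xi> = \<i> * \<sigma> * S - (\<i> * \<i>) * (\<sigma> * \<sigma>) * X"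
          unfolding fp by (simp only: algebra_simps)
        then have "\<i> * \<sigma> * Fp \<xi> = X + \<i> * \<sigma> * S"
          by (simp add: \<sigma>(1))
        moreover have "cmod (\<i> * \<sigma> * Fp \<xi>) = cmod (Fp \<xi>)" using \<sigma>(2) by (simp add: norm_mult)
        ultimately have "cmod (Fp \<xi>) = cmod (X + \<i> * \<sigma> * S)" by simp
        then show ?case by (simp add: S_def X_def)
      qed
    qed
    finally show ?thesis .
  qed
  then show ?thesis using \<delta>(1) by (auto simp: a_def b_def \<sigma>_def)
qed

text \<open>If the value at \<open>\<xi>\<close> exceeded \<open>m\<close>, the modulus would be at
  least \<open>m / 2\<close> on the whole ball of radius \<rho>, which is more mean-square mass than
  \<open>e\<^sup>2\<close> allows.\<close>

lemma pointwise_bound_of_L2: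
  fixes D :: "real ^ 'd::finite \<Rightarrow> complex"
  assumes L2: "(\<integral>\<^sup>+ \<xi>. ennreal ((cmod (D \<xi>))\<^sup>2) \<partial>lborel) \<le> ennreal (e\<^sup>2)"
    and mod: "\<And>\<xi>'. \<xi>' \<in> ball \<xi> \<rho> \<Longrightarrow> cmod (D \<xi>' - D \<xi>) \<le> m / 2"
    and m: "m > 0" and \<rho>: "\<rho> > 0"
    and small: "e\<^sup>2 < (m / 2)\<^sup>2 * measure lborel (ball (0 :: real ^ 'd) \<rho>)"
  shows "cmod (D \<xi>) \<le> m"
proof (rule ccontr)
  assume "\<not> cmod (D \<xi>) \<le> m"
  then have big: "cmod (D \<xi>') \<ge> m / 2" if "\<xi>' \<in> ball \<xi> \<rho>" for \<xi>'
    using mod[OF that] norm_triangle_ineq2[of "D \<xi>" "D \<xi>'"] by (simp add: norm_minus_commute)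
  have em: "emeasure lborel (ball \<xi> \<rho>) = ennreal (measure lborel (ball (0 :: real ^ 'd) \<rho>))"
    using \<rho> emeasure_ball[of \<rho> \<xi>] by (simp add: content_ball)
  have "ennreal ((m / 2)\<^sup>2 * measure lborel (ball (0 :: real ^ 'd) \<rho>)) = ennreal ((m / 2)\<^sup>2) * emeasure lborel (ball \<xi> \<rho>)"
    unfolding em by (rule ennreal_mult) auto
  also have "\<dots> = (\<integral>\<^sup>+ \<xi>'. ennreal ((m / 2)\<^sup>2) * indicator (ball \<xi> \<rho>) \<xi>' \<partial>lborel)"
    by (rule nn_integral_cmult_indicator[symmetric]) simp
  also have "\<dots> \<le> (\<integral>\<^sup>+ \<xi>. ennreal ((cmod (D \<xi>))\<^sup>2) \<partial>lborel)"
  proof (intro nn_integral_mono)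
    fix \<xi>'
    show "ennreal ((m / 2)\<^sup>2) * indicator (ball \<xi> \<rho>) \<xi>' \<le> ennreal ((cmod (D \<xi>'))\<^sup>2)"
      using big[of \<xi>'] m by (cases "\<xi>' \<in> ball \<xi> \<rho>") (auto intro!: ennreal_leI power_mono simp del: power_divide mem_ball)
  qed
  also note L2
  finally have "(m / 2)\<^sup>2 * measure lborel (ball (0 :: real ^ 'd) \<rho>) \<le> e\<^sup>2"
    by (subst (asm) ennreal_le_iff) auto
  then show False using small by simp
qed

lemma norm_iexp_diff_le: "cmod (exp (- \<i> * of_real a) - exp (- \<i> * of_real b)) \<le> \<bar>a - b\<bar>"
proof -
  have "exp (- \<i> * of_real a) - exp (- \<i> * of_real b) = exp (- \<i> * of_real b) * (exp (\<i> * of_real (b - a)) - 1)"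
    by (simp add: algebra_simps exp_add[symmetric])
  then have "cmod (exp (- \<i> * of_real a) - exp (- \<i> * of_real b)) = cmod (exp (\<i> * of_real (b - a)) - 1)"
    by (simp only: norm_mult) simp
  also have "\<dots> \<le> \<bar>b - a\<bar>" using iexp_approx1[of "b - a" 0] by simp
  finally show ?thesis by simp
qed

text \<open>Compact support bounds the frequencies of the exponentials, so the transform is
  Lipschitz with a constant depending only on \<open>A\<close>, \<open>B\<close> and the dimension.
  This supplies equicontinuity uniformly in time.\<close>

lemma fourier_lipschitz:
  fixes f :: "real ^ 'd::finite \<Rightarrow> complex"
  assumes f: "supported_in B f" and A: "(LINT x|lborel. cmod (f x)) \<le> A" and B: "B \<ge> 0"
  shows "cmod (fourier f \<xi>' - fourier f \<xi>) \<le> A * (real CARD('d) * B * infnorm (\<xi>' - \<xi>))"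
proof -
  have fi: "integrable lborel f" using f by (simp add: supported_in_def)
  have "fourier f \<xi>' - fourier f \<xi> = (LINT x|lborel. f x * exp (- \<i> * of_real (x \<bullet> \<xi>')) - f x * exp (- \<i> * of_real (x \<bullet> \<xi>)))"
    unfolding fourier_def
    by (rule Bochner_Integration.integral_diff[symmetric]) (rule integrable_fourier_kernel[OF fi])+
  also have "cmod \<dots> \<le> (LINT x|lborel. cmod (f x * exp (- \<i> * of_real (x \<bullet> \<xi>')) - f x * exp (- \<i> * of_real (x \<bullet> \<xi>))))"
    by (rule integral_norm_bound)
  also have "\<dots> \<le> (LINT x|lborel. cmod (f x) * (real CARD('d) * B * infnorm (\<xi>' - \<xi>)))"
  proof (rule integral_mono_AE)
    show "AE x in lborel. cmod (f x * exp (- \<i> * of_real (x \<bullet> \<xi>')) - f x * exp (- \<i> * of_real (x \<bullet> \<xi>)))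
        \<le> cmod (f x) * (real CARD('d) * B * infnorm (\<xi>' - \<xi>))"
      using supported_inner_bound[OF f, of "\<xi>' - \<xi>"]
    proof eventually_elim
      case (elim x)
      show ?case
      proof (cases "f x = 0")
        case False
        then have "\<bar>x \<bullet> \<xi>' - x \<bullet> \<xi>\<bar> \<le> real CARD('d) * B * infnorm (\<xi>' - \<xi>)" using elim by (simp add: inner_diff_right)
        then have "cmod (exp (- \<i> * of_real (x \<bullet> \<xi>')) - exp (- \<i> * of_real (x \<bullet> \<xi>))) \<le> real CARD('d) * B * infnorm (\<xi>' - \<xi>)"
          using norm_iexp_diff_le order_trans by blast
        then have "cmod (f x) * cmod (exp (- \<i> * of_real (x \<bullet> \<xi>')) - exp (- \<i> * of_real (x \<bullet> \<xi>))) \<le> cmod (f x) * (real CARD('d) * B * infnorm (\<xi>' - \<xi>))"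
          by (intro mult_left_mono) auto
        then show ?thesis by (simp only: right_diff_distrib[symmetric] norm_mult)
      qed simp
    qed
    show "integrable lborel (\<lambda>x. cmod (f x * exp (- \<i> * of_real (x \<bullet> \<xi>')) - f x * exp (- \<i> * of_real (x \<bullet> \<xi>))))"
      by (intro integrable_norm Bochner_Integration.integrable_diff integrable_fourier_kernel fi)
  qed (use fi in simp)
  also have "\<dots> = (LINT x|lborel. cmod (f x)) * (real CARD('d) * B * infnorm (\<xi>' - \<xi>))" by simp
  also have "\<dots> \<le> A * (real CARD('d) * B * infnorm (\<xi>' - \<xi>))"
    using A B by (intro mult_right_mono) (auto simp: infnorm_pos_le)
  finally show ?thesis .
qed

section \<open>Duhamel's formula along complex lines\<close>

definition cslice :: "real ^ 'd::finite \<Rightarrow> real ^ 'd \<Rightarrow> complex \<Rightarrow> complex ^ 'd" where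
  "cslice \<xi> \<eta> z = (\<chi> j. of_real (\<xi> $ j) + z * of_real (\<eta> $ j))"

lemma cslice_real: "cslice \<xi> \<eta> (of_real s) = complexify (\<xi> + s *\<^sub>R \<eta>) 0"
  by (simp add: cslice_def complexify_def vec_eq_iff complex_eq_iff)

lemma cslice_i: "cslice \<xi> \<eta> \<i> = complexify \<xi> \<eta>"
  by (simp add: cslice_def complexify_def vec_eq_iff complex_eq_iff)

text \<open>Along the line the chain rule gives the derivative \<open>D\<close> on multiples of one
  fixed vector \<open>V\<close>; complex linearity of \<open>D\<close> turns this into
  multiplication by \<open>D V\<close>.\<close>

lemma entire_cslice_holomorphic:
  assumes "entire \<omega>"
  shows "(\<lambda>z. \<omega> (cslice \<xi> \<eta> z)) holomorphic_on UNIV"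
  unfolding holomorphic_on_open[OF open_UNIV]
proof
  fix z :: complex
  define V :: "complex ^ 'a" where "V = (\<chi> j. of_real (\<eta> $ j))"
  obtain D where D: "(\<omega> has_derivative D) (at (cslice \<xi> \<eta> z))" "\<And>c v. D (c *s v) = c * D v"
    using assms unfolding entire_def by blast
  define C0 where "C0 = cslice \<xi> \<eta> 0"
  have eq: "cslice \<xi> \<eta> = (\<lambda>w. C0 + w *s V)"
    by (simp add: cslice_def C0_def V_def vec_eq_iff fun_eq_iff)
  have bl: "bounded_linear (\<lambda>w. w *s V)"
    unfolding linear_conv_bounded_linear[symmetric]
    by (rule linearI) (simp_all add: vec_eq_iff algebra_simps)
  have "(cslice \<xi> \<eta> has_derivative (\<lambda>w. 0 + w *s V)) (at z)"
    unfolding eq by (intro has_derivative_add has_derivative_const bounded_linear_imp_has_derivative bl)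
  then have "((\<lambda>z. \<omega> (cslice \<xi> \<eta> z)) has_derivative (\<lambda>w. D (0 + w *s V))) (at z)"
    by (rule has_derivative_compose) (rule D)
  moreover have "(\<lambda>w. D (0 + w *s V)) = (*) (D V)"
    by (simp add: D(2) fun_eq_iff mult.commute)
  ultimately have "((\<lambda>z. \<omega> (cslice \<xi> \<eta> z)) has_derivative (*) (D V)) (at z)"
    by simp
  then show "\<exists>f'. ((\<lambda>z. \<omega> (cslice \<xi> \<eta> z)) has_field_derivative f') (at z)"
    by (auto simp: has_field_derivative_def)
qed

lemma entire_real_continuous:
  assumes "entire \<omega>"
  shows "continuous_on UNIV (\<lambda>\<xi>. \<omega> (complexify \<xi> 0))"
proof -
  have "continuous_on UNIV \<omega>"
    using assms unfolding entire_def by (meson continuous_at_imp_continuous_on has_derivative_continuous)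
  moreover have "continuous_on UNIV (\<lambda>\<xi> :: real ^ 'a. complexify \<xi> 0)"
    unfolding complexify_def Complex_eq by (intro continuous_intros)
  ultimately show ?thesis using continuous_on_compose2 by blast
qed

text \<open>The error in Duhamel's formula at the frequency \<open>\<xi> + z * \<eta>\<close> when
  the integral is replaced by the Riemann sum over \<open>p\<close>. Being a finite combination of
  entire functions of \<open>z\<close>, it is entire without any regularity in \<tau>.\<close>

definition duhamel_defect ::
  "(complex ^ 'd::finite \<Rightarrow> complex) \<Rightarrow> ((real ^ 'd \<Rightarrow> complex) \<Rightarrow> real ^ 'd \<Rightarrow> complex) \<Rightarrow>
    (real \<Rightarrow> real ^ 'd \<Rightarrow> complex) \<Rightarrow> real \<Rightarrow> real \<Rightarrow> (real \<times> real set) set \<Rightarrow> real ^ 'd \<Rightarrow> real ^ 'd \<Rightarrow> complex \<Rightarrow> complex" where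
  "duhamel_defect \<omega> N u t1 t2 p \<xi> \<eta> z = fourier (twist (u t2) \<eta> z) \<xi> -
    exp (- \<i> * of_real (t2 - t1) * \<omega> (cslice \<xi> \<eta> z)) * fourier (twist (u t1) \<eta> z) \<xi> +
    \<i> * of_real (sgn (t2 - t1)) * (\<Sum>(\<tau>, J)\<in>p. of_real (measure lborel J) *
      (exp (- \<i> * of_real (t2 - \<tau>) * \<omega> (cslice \<xi> \<eta> z)) * fourier (twist (N (u \<tau>)) \<eta> z) \<xi>))"

lemma tagged_division_lengths:
  fixes p :: "(real \<times> real set) set"
  assumes p: "p tagged_division_of {a..b}" and ab: "a \<le> b"
  shows "(\<Sum>q\<in>p. measure lborel (snd q)) = b - a"
  using additive_content_tagged_division[of p a b] p ab by (simp add: case_prod_beta)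

lemma propagator_mod:
  fixes g g' t :: real
  shows "cmod (exp (- \<i> * of_real t * of_real g') * X' - exp (- \<i> * of_real t * of_real g) * X) \<le> \<bar>t\<bar> * \<bar>g' - g\<bar> * cmod X' + cmod (X' - X)"
proof -
  have "exp (- \<i> * of_real t * of_real g') * X' - exp (- \<i> * of_real t * of_real g) * X =
      (exp (- \<i> * of_real (t * g')) - exp (- \<i> * of_real (t * g))) * X' + exp (- \<i> * of_real (t * g)) * (X' - X)"
    by (simp add: algebra_simps)
  also have "cmod \<dots> \<le> cmod (exp (- \<i> * of_real (t * g')) - exp (- \<i> * of_real (t * g))) * cmod X' + 1 * cmod (X' - X)"
    by (rule order_trans[OF norm_triangle_ineq]) (simp add: norm_mult)
  also have "\<dots> \<le> \<bar>t * g' - t * g\<bar> * cmod X' + 1 * cmod (X' - X)"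
    by (intro add_mono mult_right_mono norm_iexp_diff_le) auto
  also have "\<bar>t * g' - t * g\<bar> = \<bar>t\<bar> * \<bar>g' - g\<bar>" by (simp flip: abs_mult add: right_diff_distrib)
  finally show ?thesis by simp
qed

text \<open>
  The Riemann sums converge only in \<open>L\<^sup>2\<close>. They are equicontinuous in \<open>\<xi>\<close> uniformly in the partition, so
  the convergence is uniform on real segments; the two-constants bound carries it to \<open>\<xi> + \<i>\<eta>\<close>. No
  continuity of \<open>u\<close> in time is involved.
\<close>

lemma duhamel_defect_small:
  fixes u :: "real \<Rightarrow> real ^ 'd::finite \<Rightarrow> complex"
  assumes ent: "entire \<omega>" and real: "\<And>x. \<omega> (complexify x 0) \<in> \<real>"
    and mild: "mild_solution \<omega> N s T u" and s: "s \<ge> 0" and B: "B \<ge> 0"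
    and t1: "t1 \<in> {-T..T}" and t2: "t2 \<in> {-T..T}" and ne: "t1 \<noteq> t2"
    and sob: "\<And>t. t \<in> {-T..T} \<Longrightarrow> u t \<in> sobolev_space s"
    and su: "\<And>t. t \<in> {-T..T} \<Longrightarrow> supported_in B (u t)"
    and sN: "\<And>t. t \<in> {-T..T} \<Longrightarrow> supported_in B (N (u t))"
    and A1: "\<And>t. t \<in> {-T..T} \<Longrightarrow> (LINT x|lborel. cmod (u t x)) \<le> A"
    and A2: "\<And>t. t \<in> {-T..T} \<Longrightarrow> (LINT x|lborel. cmod (N (u t) x)) \<le> A"
    and A: "A \<ge> 1" and m: "m > 0"
  shows "\<exists>\<delta>>0. \<forall>p x. p tagged_division_of {min t1 t2..max t1 t2} \<and> (\<forall>(\<tau>, J)\<in>p. measure lborel J < \<delta>) \<and> \<bar>x\<bar> \<le> 5 \<longrightarrow>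
    cmod (duhamel_defect \<omega> N u t1 t2 p \<xi> \<eta> (of_real x)) \<le> m"
proof -
  define g where "g = (\<lambda>\<xi>. Re (\<omega> (complexify \<xi> 0)))"
  have g: "\<omega> (complexify \<xi> 0) = of_real (g \<xi>)" for \<xi>
    using real[of \<xi>] by (simp add: g_def of_real_Re)
  define D where "D = (\<lambda>(p :: (real \<times> real set) set) \<xi>. fourier (u t2) \<xi> - propagator_symbol \<omega> (t2 - t1) \<xi> * fourier (u t1) \<xi> +
      \<i> * of_real (sgn (t2 - t1)) * (\<Sum>(\<tau>, J)\<in>p. of_real (measure lborel J) *
        (propagator_symbol \<omega> (t2 - \<tau>) \<xi> * fourier (N (u \<tau>)) \<xi>)))"
  have defect: "duhamel_defect \<omega> N u t1 t2 p \<xi> \<eta> (of_real x) = D p (\<xi> + x *\<^sub>R \<eta>)" for p x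
    by (simp add: duhamel_defect_def D_def fourier_twist_real cslice_real propagator_symbol_def)
  \<comment> \<open>A ball containing the points \<open>\<xi> + x * \<eta>\<close> with
    \<open>\<bar>x\<bar> \<le> 5\<close> together with their neighbourhoods of radius
    \<open>\<rho> \<le> 1\<close>.\<close>
  define Rr where "Rr = norm \<xi> + 5 * norm \<eta> + 1"
  have gc: "continuous_on (cball 0 Rr) g"
    unfolding g_def using continuous_on_subset[OF entire_real_continuous[OF ent]] by (intro continuous_intros) auto
  define dB where "dB = real CARD('d) * B"
  have dB: "dB \<ge> 0" using B by (simp add: dB_def)
  have T: "T \<ge> 0" using t1 by auto
  \<comment> \<open>\<open>2 + 2 * T\<close> counts the two boundary terms and the total length of
    the partition, and \<open>A * (2 * T + dB)\<close> times \<open>e1\<close> bounds the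
    oscillation of one term. The summand 1 keeps \<open>KK\<close> positive.\<close>
  define KK where "KK = (2 + 2 * T) * A * (2 * T + dB + 1)"
  have KK: "KK > 0" using T A dB by (auto simp: KK_def intro!: mult_pos_pos)
  define e1 where "e1 = m / (2 * KK)"
  have e1: "e1 > 0" using m KK by (simp add: e1_def)
  obtain \<rho>0 where \<rho>0: "\<rho>0 > 0" "\<And>x y. x \<in> cball 0 Rr \<Longrightarrow> y \<in> cball 0 Rr \<Longrightarrow> dist y x < \<rho>0 \<Longrightarrow> dist (g y) (g x) < e1"
    using compact_uniformly_continuous[OF gc compact_cball] e1 unfolding uniformly_continuous_on_def by metis
  define \<rho> where "\<rho> = min (min \<rho>0 1) e1"
  have \<rho>: "\<rho> > 0" using \<rho>0 e1 by (simp add: \<rho>_def)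
  define V where "V = measure lborel (ball (0 :: real ^ 'd) \<rho>)"
  have V: "V > 0" unfolding V_def using \<rho> content_ball_pos by blast
  \<comment> \<open>Half of the critical mass, so that the inequality required by the pointwise
    bound is strict.\<close>
  define e where "e = (m / 2) * sqrt (V / 2)"
  have e: "e > 0" using m V by (simp add: e_def)
  have e2: "e\<^sup>2 < (m / 2)\<^sup>2 * V" 
  proof -
    have "e\<^sup>2 = (m / 2)\<^sup>2 * (V / 2)" unfolding e_def power_mult_distrib using V by simp
    also have "\<dots> < (m / 2)\<^sup>2 * V" using m V by (intro mult_strict_left_mono) auto
    finally show ?thesis .
  qed
  obtain \<delta> where \<delta>: "\<delta> > 0" "\<And>p. p tagged_division_of {min t1 t2..max t1 t2} \<Longrightarrow> (\<forall>(\<tau>, J)\<in>p. measure lborel J < \<delta>) \<Longrightarrow>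
    (\<integral>\<^sup>+ \<xi>. ennreal ((cmod (D p \<xi>))\<^sup>2) \<partial>lborel) \<le> ennreal (e\<^sup>2)"
    using mild_riemann_L2[OF mild s t1 t2 ne sob su sN e] unfolding D_def by blast
  have "cmod (D p (\<xi> + x *\<^sub>R \<eta>)) \<le> m"
    if p: "p tagged_division_of {min t1 t2..max t1 t2}" "\<forall>(\<tau>, J)\<in>p. measure lborel J < \<delta>" and x: "\<bar>x\<bar> \<le> 5" for p x
  proof (rule pointwise_bound_of_L2[OF \<delta>(2)[OF p] _ m \<rho>])
    show "e\<^sup>2 < (m / 2)\<^sup>2 * measure lborel (ball (0 :: real ^ 'd) \<rho>)" using e2 by (simp add: V_def)
    fix \<xi>' assume \<xi>': "\<xi>' \<in> ball (\<xi> + x *\<^sub>R \<eta>) \<rho>"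
    define \<xi>0 where "\<xi>0 = \<xi> + x *\<^sub>R \<eta>"
    have d: "norm (\<xi>' - \<xi>0) < \<rho>" using \<xi>' by (simp add: \<xi>0_def dist_norm norm_minus_commute)
    have "norm \<xi>0 \<le> norm \<xi> + 5 * norm \<eta>"
      unfolding \<xi>0_def by (rule order_trans[OF norm_triangle_ineq]) (use x in \<open>simp add: mult_right_mono\<close>)
    moreover have "norm \<xi>' \<le> norm \<xi>0 + norm (\<xi>' - \<xi>0)" using norm_triangle_ineq[of \<xi>0 "\<xi>' - \<xi>0"] by simp
    ultimately have "\<xi>0 \<in> cball 0 Rr" "\<xi>' \<in> cball 0 Rr" using d by (auto simp: Rr_def \<rho>_def)
    then have gd: "\<bar>g \<xi>' - g \<xi>0\<bar> \<le> e1"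
      using \<rho>0(2)[of \<xi>0 \<xi>'] d by (auto simp: dist_norm \<rho>_def less_imp_le)
    define Q where "Q = A * (2 * T * e1 + dB * e1)"
    have trm: "cmod (propagator_symbol \<omega> t \<xi>' * fourier f \<xi>' - propagator_symbol \<omega> t \<xi>0 * fourier f \<xi>0) \<le> Q"
      if "supported_in B f" "(LINT x|lborel. cmod (f x)) \<le> A" "\<bar>t\<bar> \<le> 2 * T" for f t
    proof -
      have "cmod (propagator_symbol \<omega> t \<xi>' * fourier f \<xi>' - propagator_symbol \<omega> t \<xi>0 * fourier f \<xi>0) \<le>
          \<bar>t\<bar> * \<bar>g \<xi>' - g \<xi>0\<bar> * cmod (fourier f \<xi>') + cmod (fourier f \<xi>' - fourier f \<xi>0)"
        unfolding propagator_symbol_def g by (rule propagator_mod)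
      also have "\<dots> \<le> 2 * T * e1 * A + A * (dB * e1)"
      proof (intro add_mono mult_mono)
        show "cmod (fourier f \<xi>') \<le> A" using fourier_bound[of f \<xi>'] that by simp
        have "cmod (fourier f \<xi>' - fourier f \<xi>0) \<le> A * (dB * infnorm (\<xi>' - \<xi>0))"
          unfolding dB_def using that B by (intro fourier_lipschitz)
        also have "\<dots> \<le> A * (dB * e1)"
          using A dB d infnorm_le_norm[of "\<xi>' - \<xi>0"] by (intro mult_left_mono) (auto simp: \<rho>_def)
        finally show "cmod (fourier f \<xi>' - fourier f \<xi>0) \<le> A * (dB * e1)" .
      qed (use that gd T e1 in auto)
      finally show ?thesis by (simp add: Q_def algebra_simps)
    qed
    have Q0: "Q \<ge> 0" using A T e1 dB by (simp add: Q_def)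
    have t12: "\<bar>t2 - t1\<bar> \<le> 2 * T" using t1 t2 by auto
    have tau: "fst q \<in> {-T..T}" "\<bar>t2 - fst q\<bar> \<le> 2 * T" if "q \<in> p" for q
    proof -
      have "fst q \<in> {min t1 t2..max t1 t2}"
        using tagged_division_ofD(2,3)[OF p(1), of "fst q" "snd q"] that by auto
      then show "fst q \<in> {-T..T}" "\<bar>t2 - fst q\<bar> \<le> 2 * T" using t1 t2 by auto
    qed
    define SS where "SS = (\<Sum>q\<in>p. of_real (measure lborel (snd q)) *
        (propagator_symbol \<omega> (t2 - fst q) \<xi>' * fourier (N (u (fst q))) \<xi>' - propagator_symbol \<omega> (t2 - fst q) \<xi>0 * fourier (N (u (fst q))) \<xi>0))"
    have "cmod SS \<le> (\<Sum>q\<in>p. measure lborel (snd q) * Q)"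
      unfolding SS_def
    proof (rule sum_norm_le)
      fix q assume q: "q \<in> p"
      show "cmod (of_real (measure lborel (snd q)) *
        (propagator_symbol \<omega> (t2 - fst q) \<xi>' * fourier (N (u (fst q))) \<xi>' - propagator_symbol \<omega> (t2 - fst q) \<xi>0 * fourier (N (u (fst q))) \<xi>0)) \<le> measure lborel (snd q) * Q"
        unfolding norm_mult[of "of_real _"] norm_of_real abs_of_nonneg[OF measure_nonneg]
        by (rule mult_left_mono[OF trm[OF sN[OF tau(1)[OF q]] A2[OF tau(1)[OF q]] tau(2)[OF q]] measure_nonneg])
    qed
    also have "\<dots> = (max t1 t2 - min t1 t2) * Q"
      unfolding sum_distrib_right[symmetric] by (subst tagged_division_lengths[OF p(1)]) auto
    also have "\<dots> \<le> 2 * T * Q" using t1 t2 Q0 by (intro mult_right_mono) auto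
    finally have SS: "cmod SS \<le> 2 * T * Q" .
    \<comment> \<open>The symbol at time 0 equals 1; it is inserted so that the oscillation bound
      \<open>trm\<close> covers this term as well.\<close>
    define X where "X = propagator_symbol \<omega> 0 \<xi>' * fourier (u t2) \<xi>' - propagator_symbol \<omega> 0 \<xi>0 * fourier (u t2) \<xi>0"
    define Y where "Y = propagator_symbol \<omega> (t2 - t1) \<xi>' * fourier (u t1) \<xi>' - propagator_symbol \<omega> (t2 - t1) \<xi>0 * fourier (u t1) \<xi>0"
    have X: "cmod X \<le> Q" unfolding X_def by (rule trm[OF su[OF t2] A1[OF t2]]) (use T in simp)
    have Y: "cmod Y \<le> Q" unfolding Y_def by (rule trm[OF su[OF t1] A1[OF t1] t12])
    have "D p \<xi>' - D p \<xi>0 = (X - Y) + \<i> * of_real (sgn (t2 - t1)) * SS"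
      by (simp add: D_def SS_def X_def Y_def case_prod_beta right_diff_distrib sum_subtractf propagator_symbol_def)
    then have "cmod (D p \<xi>' - D p \<xi>0) \<le> cmod (X - Y) + cmod (\<i> * of_real (sgn (t2 - t1)) * SS)"
      by (simp only: norm_triangle_ineq)
    moreover have "cmod (X - Y) \<le> cmod X + cmod Y" by (rule norm_triangle_ineq4)
    moreover have "cmod (\<i> * of_real (sgn (t2 - t1)) * SS) = cmod SS"
      using ne by (simp add: norm_mult sgn_real_def)
    ultimately have "cmod (D p \<xi>' - D p \<xi>0) \<le> (2 + 2 * T) * Q"
      unfolding distrib_right using X Y SS by linarith
    also have "\<dots> \<le> KK * e1"
    proof -
      have "2 * T * e1 + dB * e1 \<le> (2 * T + dB + 1) * e1" using e1 by (simp add: distrib_right)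
      then have "Q \<le> A * ((2 * T + dB + 1) * e1)" unfolding Q_def using A by (intro mult_left_mono) auto
      then have "(2 + 2 * T) * Q \<le> (2 + 2 * T) * (A * ((2 * T + dB + 1) * e1))" using T by (intro mult_left_mono) auto
      then show ?thesis by (simp add: KK_def mult.assoc)
    qed
    also have "\<dots> = m / 2" using KK by (simp add: e1_def)
    finally show "cmod (D p \<xi>' - D p (\<xi> + x *\<^sub>R \<eta>)) \<le> m / 2" by (simp add: \<xi>0_def)
  qed
  then show ?thesis unfolding defect using \<delta>(1) by blast
qed

text \<open>One partition has to serve two purposes: a mesh below \<delta>, for the defect, and a
  Riemann sum close to the gauge integral, for the modulus of the propagator. Intersecting the gauge
  with balls of radius \<open>\<delta> / 4\<close> achieves both.\<close>

lemma fine_riemann_sum: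
  fixes f :: "real \<Rightarrow> real"
  assumes I: "(f has_integral I) {a..b}" and \<delta>: "\<delta> > 0" and e: "e > 0"
  obtains p where "p tagged_division_of {a..b}" "\<forall>(\<tau>, J)\<in>p. measure lborel J < \<delta>"
    "(\<Sum>q\<in>p. measure lborel (snd q) * f (fst q)) \<le> I + e"
proof -
  obtain \<gamma> where \<gamma>: "gauge \<gamma>" "\<And>p. p tagged_division_of {a..b} \<Longrightarrow> \<gamma> fine p \<Longrightarrow>
      norm ((\<Sum>(x, k)\<in>p. measure lborel k *\<^sub>R f x) - I) < e"
    using I e unfolding has_integral_real by metis
  have "gauge (\<lambda>x. \<gamma> x \<inter> ball x (\<delta> / 4))"
    using \<gamma>(1) \<delta> by (intro gauge_Int gauge_ball) auto
  then obtain p where p: "p tagged_division_of {a..b}" "(\<lambda>x. \<gamma> x \<inter> ball x (\<delta> / 4)) fine p"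
    using fine_division_exists_real by blast
  have f: "\<gamma> fine p" "(\<lambda>x. ball x (\<delta> / 4)) fine p" using p(2) by (auto simp: fine_Int)
  have "measure lborel J < \<delta>" if tJ: "(\<tau>, J) \<in> p" for \<tau> J
  proof -
    have "J \<subseteq> ball \<tau> (\<delta> / 4)" using f(2) tJ by (auto simp: fine_def)
    moreover obtain c d where "J = cbox c d" using tagged_division_ofD(4)[OF p(1) tJ] by blast
    ultimately have "measure lborel J \<le> measure lborel (ball \<tau> (\<delta> / 4))"
      using emeasure_lborel_ball_finite[of \<tau> "\<delta> / 4"]
      by (intro measure_mono_fmeasurable fmeasurableI) auto
    also have "\<dots> = \<delta> / 2" using \<delta> by (simp add: ball_eq_greaterThanLessThan)
    finally show ?thesis using \<delta> by simp
  qed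
  moreover have "norm ((\<Sum>(x, k)\<in>p. measure lborel k *\<^sub>R f x) - I) < e" by (rule \<gamma>(2)[OF p(1) f(1)])
  then have "(\<Sum>q\<in>p. measure lborel (snd q) * f (fst q)) \<le> I + e"
    by (simp add: case_prod_beta abs_less_iff)
  ultimately show ?thesis using p(1) that by blast
qed

text \<open>The defect is at most \<open>m\<close> on the real segment and at most \<Lambda> on the
  circle of radius 5, with \<Lambda> independent of the partition, so its value at
  \<open>\<i>\<close> is at most \<open>sqrt (m * \<Lambda>)\<close> and can be made arbitrarily
  small. The Riemann sum at \<open>\<i>\<close> is bounded by \<open>Nb\<close> times a Riemann sum
  of the real exponential, hence nearly by \<open>Nb * I\<close>.\<close>

lemma duhamel_complex:
  fixes u :: "real \<Rightarrow> real ^ 'd::finite \<Rightarrow> complex"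
  assumes ent: "entire \<omega>" and real: "\<And>x. \<omega> (complexify x 0) \<in> \<real>"
    and mild: "mild_solution \<omega> N s T u" and s: "s \<ge> 0" and B: "B \<ge> 0"
    and t1: "t1 \<in> {-T..T}" and t2: "t2 \<in> {-T..T}" and ne: "t1 \<noteq> t2"
    and sob: "\<And>t. t \<in> {-T..T} \<Longrightarrow> u t \<in> sobolev_space s"
    and su: "\<And>t. t \<in> {-T..T} \<Longrightarrow> supported_in B (u t)"
    and sN: "\<And>t. t \<in> {-T..T} \<Longrightarrow> supported_in B (N (u t))"
    and A1: "\<And>t. t \<in> {-T..T} \<Longrightarrow> (LINT x|lborel. cmod (u t x)) \<le> A"
    and A2: "\<And>t. t \<in> {-T..T} \<Longrightarrow> (LINT x|lborel. cmod (N (u t) x)) \<le> A"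
    and A: "A \<ge> 1"
    and Nb: "\<And>t. t \<in> {-T..T} \<Longrightarrow> cmod (fourier (twist (N (u t)) \<eta> \<i>) \<xi>) \<le> Nb"
    and W: "W = Im (\<omega> (complexify \<xi> \<eta>))"
    and I: "((\<lambda>\<tau>. exp ((t2 - \<tau>) * W)) has_integral I) {min t1 t2..max t1 t2}"
  shows "exp ((t2 - t1) * W) * cmod (fourier (twist (u t1) \<eta> \<i>) \<xi>) \<le>
    cmod (fourier (twist (u t2) \<eta> \<i>) \<xi>) + Nb * I"
proof (rule field_le_epsilon)
  fix \<epsilon> :: real assume \<epsilon>: "\<epsilon> > 0"
  define ws where "ws = (\<lambda>z. \<omega> (cslice \<xi> \<eta> z))"
  have T: "T \<ge> 0" using t1 by auto
  have Nb0: "Nb \<ge> 0" using Nb[OF t1] norm_ge_zero order_trans by blast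
  have wsh: "ws holomorphic_on UNIV" unfolding ws_def by (rule entire_cslice_holomorphic[OF ent])
  have "bounded (ws ` cball 0 5)"
    by (intro compact_imp_bounded compact_continuous_image holomorphic_on_imp_continuous_on holomorphic_on_subset[OF wsh]) auto
  then obtain \<Omega> where "\<forall>y\<in>ws ` cball 0 5. cmod y \<le> \<Omega>" unfolding bounded_iff by blast
  then have \<Omega>: "cmod (ws z) \<le> \<Omega>" if "cmod z \<le> 5" for z using that by simp
  define E where "E = exp (2 * T * \<Omega>)"
  define A5 where "A5 = A * exp (real CARD('d) * B * infnorm \<eta> * 5)"
  \<comment> \<open>The three terms bound the final value, the free evolution and the Riemann sum on
    the circle; the lengths of the partition add up to at most \<open>2 * T\<close>. The summand 1
    ensures \<open>m \<le> \<Lambda>\<close> for the \<open>m\<close> chosen below.\<close>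
  define \<Lambda> where "\<Lambda> = A5 + E * A5 + 2 * T * (E * A5) + 1"
  have A5: "A5 \<ge> 0" using A by (simp add: A5_def)
  have EA: "E * A5 \<ge> 0" using A5 by (simp add: E_def)
  have \<Lambda>: "\<Lambda> \<ge> 1" using A5 EA T by (simp add: \<Lambda>_def)
  define m where "m = min 1 ((\<epsilon> / 2)\<^sup>2 / \<Lambda>)"
  have m: "m > 0" "m \<le> \<Lambda>" using \<epsilon> \<Lambda> by (auto simp: m_def)
  have "m * \<Lambda> \<le> (\<epsilon> / 2)\<^sup>2" using \<Lambda> by (simp add: m_def min_def field_simps)
  then have mL: "sqrt (m * \<Lambda>) \<le> \<epsilon> / 2" using \<epsilon> by (intro real_le_lsqrt) auto
  obtain \<delta> where \<delta>: "\<delta> > 0" "\<And>p x. p tagged_division_of {min t1 t2..max t1 t2} \<Longrightarrow> (\<forall>(\<tau>, J)\<in>p. measure lborel J < \<delta>) \<Longrightarrow> \<bar>x\<bar> \<le> 5 \<Longrightarrow>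
    cmod (duhamel_defect \<omega> N u t1 t2 p \<xi> \<eta> (of_real x)) \<le> m"
    using duhamel_defect_small[OF ent real mild s B t1 t2 ne sob su sN A1 A2 A m(1), of \<xi> \<eta>] by meson
  \<comment> \<open>This tolerance, multiplied by \<open>Nb\<close>, costs at most
    \<open>\<epsilon> / 2\<close>; the summand 1 covers \<open>Nb = 0\<close>.\<close>
  have "\<epsilon> / (2 * (Nb + 1)) > 0" using \<epsilon> Nb0 by simp
  then obtain p where p: "p tagged_division_of {min t1 t2..max t1 t2}" "\<forall>(\<tau>, J)\<in>p. measure lborel J < \<delta>"
    and pI: "(\<Sum>q\<in>p. measure lborel (snd q) * exp ((t2 - fst q) * W)) \<le> I + \<epsilon> / (2 * (Nb + 1))"
    by (rule fine_riemann_sum[OF I \<delta>(1)])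
  have tau: "fst q \<in> {-T..T}" "\<bar>t2 - fst q\<bar> \<le> 2 * T" if "q \<in> p" for q
  proof -
    have "fst q \<in> {min t1 t2..max t1 t2}"
      using tagged_division_ofD(2,3)[OF p(1), of "fst q" "snd q"] that by auto
    then show "fst q \<in> {-T..T}" "\<bar>t2 - fst q\<bar> \<le> 2 * T" using t1 t2 by auto
  qed
  define h where "h = duhamel_defect \<omega> N u t1 t2 p \<xi> \<eta>"
  define S where "S = (\<lambda>z. \<Sum>q\<in>p. of_real (measure lborel (snd q)) *
      (exp (- \<i> * of_real (t2 - fst q) * ws z) * fourier (twist (N (u (fst q))) \<eta> z) \<xi>))"
  have h: "h z = fourier (twist (u t2) \<eta> z) \<xi> - exp (- \<i> * of_real (t2 - t1) * ws z) * fourier (twist (u t1) \<eta> z) \<xi> +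
    \<i> * of_real (sgn (t2 - t1)) * S z" for z
    by (simp add: h_def duhamel_defect_def S_def ws_def case_prod_beta)
  have "h holomorphic_on UNIV"
    unfolding h[abs_def] S_def
    by (intro holomorphic_intros wsh fourier_twist_holomorphic[OF su] fourier_twist_holomorphic[OF sN] t1 t2 tau)
  moreover have "cmod (h (of_real x)) \<le> m" if "\<bar>x\<bar> \<le> 5" for x
    unfolding h_def by (rule \<delta>(2)[OF p that])
  moreover have "cmod (h z) \<le> \<Lambda>" if z: "cmod z = 5" for z
  proof -
    have ex: "cmod (exp (- \<i> * of_real t * ws z)) \<le> E" if "\<bar>t\<bar> \<le> 2 * T" for t
    proof -
      have "t * Im (ws z) \<le> \<bar>t\<bar> * \<bar>Im (ws z)\<bar>" by (simp flip: abs_mult)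
      also have "\<dots> \<le> 2 * T * \<Omega>"
        using that \<Omega>[of z] z T abs_Im_le_cmod[of "ws z"] by (intro mult_mono) auto
      finally show ?thesis by (simp add: E_def)
    qed
    have tw: "cmod (fourier (twist f \<eta> z) \<xi>) \<le> A5" if "supported_in B f" "(LINT x|lborel. cmod (f x)) \<le> A" for f
    proof -
      have "cmod (fourier (twist f \<eta> z) \<xi>) \<le> A * exp (real CARD('d) * B * infnorm \<eta> * \<bar>Im z\<bar>)"
        by (rule fourier_twist_bound[OF that])
      also have "\<dots> \<le> A5"
        unfolding A5_def using A B z abs_Im_le_cmod[of z]
        by (intro mult_left_mono iffD2[OF exp_le_cancel_iff]) (auto simp: infnorm_pos_le)
      finally show ?thesis .
    qed
    have "cmod (S z) \<le> (\<Sum>q\<in>p. measure lborel (snd q) * (E * A5))"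
      unfolding S_def
    proof (rule sum_norm_le)
      fix q assume q: "q \<in> p"
      show "cmod (of_real (measure lborel (snd q)) *
        (exp (- \<i> * of_real (t2 - fst q) * ws z) * fourier (twist (N (u (fst q))) \<eta> z) \<xi>)) \<le> measure lborel (snd q) * (E * A5)"
        unfolding norm_mult using ex[OF tau(2)[OF q]] tw[OF sN A2] tau(1)[OF q] A5
        by (intro mult_mono) (auto simp: E_def)
    qed
    also have "\<dots> = (max t1 t2 - min t1 t2) * (E * A5)"
      unfolding sum_distrib_right[symmetric] by (subst tagged_division_lengths[OF p(1)]) auto
    also have "\<dots> \<le> 2 * T * (E * A5)" using t1 t2 EA by (intro mult_right_mono) auto
    finally have S: "cmod (S z) \<le> 2 * T * (E * A5)" .
    have "cmod (h z) \<le> cmod (fourier (twist (u t2) \<eta> z) \<xi>) + cmod (exp (- \<i> * of_real (t2 - t1) * ws z) * fourier (twist (u t1) \<eta> z) \<xi>) +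
        cmod (\<i> * of_real (sgn (t2 - t1)) * S z)"
      unfolding h by (intro order_trans[OF norm_triangle_ineq] add_right_mono norm_triangle_ineq4)
    also have "\<dots> \<le> A5 + E * A5 + 2 * T * (E * A5)"
    proof (intro add_mono)
      show "cmod (exp (- \<i> * of_real (t2 - t1) * ws z) * fourier (twist (u t1) \<eta> z) \<xi>) \<le> E * A5"
        unfolding norm_mult using t1 t2 A5 by (intro mult_mono ex tw su A1) (auto simp: E_def)
      show "cmod (\<i> * of_real (sgn (t2 - t1)) * S z) \<le> 2 * T * (E * A5)"
        using S by (auto simp: norm_mult sgn_real_def EA T)
    qed (intro tw su A1 t2)
    finally show ?thesis by (simp add: \<Lambda>_def)
  qed
  ultimately have "cmod (h \<i>) \<le> sqrt (m * \<Lambda>)"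
    using m by (intro two_constants_bound) auto
  then have hi: "cmod (h \<i>) \<le> \<epsilon> / 2" using mL by simp
  have ei: "cmod (exp (- \<i> * of_real t * ws \<i>)) = exp (t * W)" for t
    by (simp add: ws_def cslice_i W)
  have Si: "cmod (S \<i>) \<le> Nb * (I + \<epsilon> / (2 * (Nb + 1)))"
  proof -
    have "cmod (S \<i>) \<le> (\<Sum>q\<in>p. (measure lborel (snd q) * exp ((t2 - fst q) * W)) * Nb)"
      unfolding S_def
    proof (rule sum_norm_le)
      fix q assume q: "q \<in> p"
      show "cmod (of_real (measure lborel (snd q)) *
        (exp (- \<i> * of_real (t2 - fst q) * ws \<i>) * fourier (twist (N (u (fst q))) \<eta> \<i>) \<xi>)) \<le> (measure lborel (snd q) * exp ((t2 - fst q) * W)) * Nb"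
        unfolding norm_mult ei norm_of_real abs_of_nonneg[OF measure_nonneg] unfolding mult.assoc
        by (intro mult_left_mono Nb tau(1)[OF q] measure_nonneg exp_ge_zero)
    qed
    also have "\<dots> = (\<Sum>q\<in>p. measure lborel (snd q) * exp ((t2 - fst q) * W)) * Nb" by (simp add: sum_distrib_right)
    also have "\<dots> \<le> (I + \<epsilon> / (2 * (Nb + 1))) * Nb" using pI Nb0 by (intro mult_right_mono)
    finally show ?thesis by (simp add: mult.commute)
  qed
  have "Nb * (\<epsilon> / (2 * (Nb + 1))) \<le> \<epsilon> / 2" using Nb0 \<epsilon> by (simp add: field_simps)
  then have Si': "cmod (S \<i>) \<le> Nb * I + \<epsilon> / 2" using Si unfolding distrib_left by linarith
  have "exp ((t2 - t1) * W) * cmod (fourier (twist (u t1) \<eta> \<i>) \<xi>) = cmod (exp (- \<i> * of_real (t2 - t1) * ws \<i>) * fourier (twist (u t1) \<eta> \<i>) \<xi>)"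
    unfolding norm_mult ei ..
  also have "exp (- \<i> * of_real (t2 - t1) * ws \<i>) * fourier (twist (u t1) \<eta> \<i>) \<xi> =
      fourier (twist (u t2) \<eta> \<i>) \<xi> + \<i> * of_real (sgn (t2 - t1)) * S \<i> - h \<i>"
    unfolding h by simp
  also have "cmod \<dots> \<le> cmod (fourier (twist (u t2) \<eta> \<i>) \<xi>) + cmod (\<i> * of_real (sgn (t2 - t1)) * S \<i>) + cmod (h \<i>)"
    by (intro order_trans[OF norm_triangle_ineq4] add_right_mono norm_triangle_ineq)
  also have "cmod (\<i> * of_real (sgn (t2 - t1)) * S \<i>) = cmod (S \<i>)"
    using ne by (simp add: norm_mult sgn_real_def)
  finally show "exp ((t2 - t1) * W) * cmod (fourier (twist (u t1) \<eta> \<i>) \<xi>) \<le>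
      cmod (fourier (twist (u t2) \<eta> \<i>) \<xi>) + Nb * I + \<epsilon>"
    using Si' hi by linarith
qed

text \<open>The sign condition makes the exponential largest at \<open>\<tau> = t1\<close>, in
  either orientation. Integration therefore costs only a factor \<open>1 / \<bar>W\<bar>\<close>
  against the growth of the free term.\<close>

lemma exp_integral_le:
  fixes W t1 t2 :: real
  assumes "(t2 - t1) * W > 0"
  shows "\<exists>I. ((\<lambda>\<tau>. exp ((t2 - \<tau>) * W)) has_integral I) {min t1 t2..max t1 t2} \<and> I \<le> exp ((t2 - t1) * W) / \<bar>W\<bar>"
proof -
  define F where "F = (\<lambda>\<tau>. - exp ((t2 - \<tau>) * W) / W)"
  have W: "W \<noteq> 0" using assms by auto
  have "((\<lambda>\<tau>. exp ((t2 - \<tau>) * W)) has_integral (F (max t1 t2) - F (min t1 t2))) {min t1 t2..max t1 t2}"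
  proof (rule fundamental_theorem_of_calculus)
    fix x
    have "(F has_field_derivative exp ((t2 - x) * W)) (at x within {min t1 t2..max t1 t2})"
      unfolding F_def using W by (auto intro!: derivative_eq_intros)
    then show "(F has_vector_derivative exp ((t2 - x) * W)) (at x within {min t1 t2..max t1 t2})"
      by (simp add: has_real_derivative_iff_has_vector_derivative)
  qed simp
  moreover have "F (max t1 t2) - F (min t1 t2) \<le> exp ((t2 - t1) * W) / \<bar>W\<bar>"
  proof (cases "t1 < t2")
    case True
    then have "W > 0" using assms by (simp add: zero_less_mult_iff)
    then show ?thesis using True by (simp add: F_def divide_right_mono max_def min_def)
  next
    case False
    then have "W < 0" using assms by (auto simp: zero_less_mult_iff)
    then show ?thesis using False by (auto simp: F_def max_def min_def field_simps)
  qed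
  ultimately show ?thesis by blast
qed

section \<open>Comparison with the majorant\<close>

lemma twist_minus: "twist f (- \<eta>) z = twist f \<eta> (- z)"
  by (simp add: twist_def fun_eq_iff)

text \<open>The half-line is selected by a coordinate at which \<open>infnorm \<zeta>\<close> is
  attained: moving that coordinate away from 0 cannot decrease the norm. If \<open>\<eta>\<close>
  points the wrong way there, \<open>- \<eta>\<close> and \<open>- \<i>\<close> are used instead,
  because a twist depends only on the product of parameter and direction.\<close>

lemma twist_variation:
  fixes f :: "real ^ 'd::finite \<Rightarrow> complex"
  assumes f: "supported_in B f" and A: "(LINT x|lborel. cmod (f x)) \<le> A" and B: "B \<ge> 0"
    and bd: "\<And>\<xi>'. infnorm \<xi>' \<ge> infnorm \<zeta> \<Longrightarrow> cmod (fourier f \<xi>') \<le> m"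
    and R: "R \<ge> 9" and m: "m \<ge> 0" and L: "L \<ge> 0"
    and circ: "A * exp (real CARD('d) * B * infnorm \<eta> * R) \<le> m * exp L"
    and small: "L * (9 / R + 2 * sqrt (9 / R)) \<le> 1 / 2"
  shows "cmod (fourier (twist f \<eta> \<i>) \<zeta>) \<le> 2 * m"
    and "cmod (fourier (twist f \<eta> \<i>) \<zeta> - fourier f \<zeta>) \<le> m / 4"
proof -
  have A0: "A \<ge> 0" using A by (rule order_trans[rotated]) simp
  have *: "cmod (fourier (twist f \<eta>' z) \<zeta>) \<le> 2 * m \<and> cmod (fourier (twist f \<eta>' z) \<zeta> - fourier (twist f \<eta>' 0) \<zeta>) \<le> m / 4"
    if i: "infnorm \<zeta> = \<bar>\<zeta> $ i\<bar>" "\<zeta> $ i * \<eta>' $ i \<ge> 0" and e: "infnorm \<eta>' = infnorm \<eta>" and z: "cmod z \<le> 1" for \<eta>' i z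
  proof -
    have hol: "(\<lambda>z. fourier (twist f \<eta>' z) \<zeta>) holomorphic_on UNIV" by (rule fourier_twist_holomorphic[OF f])
    have slit: "cmod (fourier (twist f \<eta>' (of_real x)) \<zeta>) \<le> m" if "x \<ge> 0" for x
      unfolding fourier_twist_real
    proof (rule bd)
      have "(\<zeta> $ i) * (x * \<eta>' $ i) \<ge> 0"
        using mult_nonneg_nonneg[OF that i(2)] by (simp add: mult_ac)
      then have "\<bar>\<zeta> $ i\<bar> \<le> \<bar>\<zeta> $ i + x * \<eta>' $ i\<bar>" by (auto simp: zero_le_mult_iff)
      then show "infnorm \<zeta> \<le> infnorm (\<zeta> + x *\<^sub>R \<eta>')"
        using component_le_infnorm_cart[of "\<zeta> + x *\<^sub>R \<eta>'" i] i(1) by simp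
    qed
    have circ': "cmod (fourier (twist f \<eta>' z) \<zeta>) \<le> m * exp L" if z: "cmod z = R" for z
    proof -
      have "cmod (fourier (twist f \<eta>' z) \<zeta>) \<le> A * exp (real CARD('d) * B * infnorm \<eta>' * \<bar>Im z\<bar>)"
        by (rule fourier_twist_bound[OF f A])
      also have "\<dots> \<le> A * exp (real CARD('d) * B * infnorm \<eta> * R)"
        unfolding e using A0 B z abs_Im_le_cmod[of z]
        by (intro mult_left_mono iffD2[OF exp_le_cancel_iff]) (auto simp: infnorm_pos_le)
      finally show ?thesis using circ by simp
    qed
    show ?thesis
      using slit_variation[OF hol R m L slit circ' small] z by simp
  qed
  obtain i where i: "infnorm \<zeta> = \<bar>\<zeta> $ i\<bar>" using infnorm_attained by blast
  have z0: "fourier (twist f \<eta>' 0) \<zeta> = fourier f \<zeta>" for \<eta>'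
    using fourier_twist_real[of f \<eta>' 0 \<zeta>] by simp
  have "cmod (fourier (twist f \<eta> \<i>) \<zeta>) \<le> 2 * m \<and> cmod (fourier (twist f \<eta> \<i>) \<zeta> - fourier f \<zeta>) \<le> m / 4"
  proof (cases "\<zeta> $ i * \<eta> $ i \<ge> 0")
    case True
    then show ?thesis using *[OF i, of \<eta> \<i>] by (simp add: z0)
  next
    case False
    then show ?thesis using *[OF i, of "-\<eta>" "-\<i>"] by (simp add: z0 twist_minus infnorm_neg)
  qed
  then show "cmod (fourier (twist f \<eta> \<i>) \<zeta>) \<le> 2 * m" "cmod (fourier (twist f \<eta> \<i>) \<zeta> - fourier f \<zeta>) \<le> m / 4"
    by auto
qed

text \<open>
  With \<open>b \<le> P / x\<close> the radius \<open>R\<close> balances the exponential type against \<open>ln (A / m)\<close>, and then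
  \<open>2 L sqrt (9 / R) = 18 sqrt (P / Q)\<close>, which is at most \<open>1 / 4\<close> because \<open>5184 = 72\<^sup>2\<close>.
\<close>

lemma radius_choice:
  fixes P Q x A b m :: real
  assumes P: "P > 0" and Q: "Q \<ge> 5184 * P" and x: "x \<ge> 108 * P" "x\<^sup>2 \<ge> 9 * (P * Q)" "x > 0"
    and A: "A \<le> exp (x / Q)" "A \<ge> 0" and b: "b * x \<le> P" and m: "m \<ge> exp (- x / Q)"
  defines "R \<equiv> x\<^sup>2 / (P * Q)" and "L \<equiv> 3 * x / Q"
  shows "R \<ge> 9" "L \<ge> 0" "A * exp (b * R) \<le> m * exp L" "L * (9 / R + 2 * sqrt (9 / R)) \<le> 1 / 2"
proof -
  have Q0: "Q > 0" using P Q by simp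
  show "R \<ge> 9" using P Q0 x by (simp add: R_def pos_le_divide_eq)
  show "L \<ge> 0" using Q0 x by (simp add: L_def)
  have "b * R = (b * x) * (x / (P * Q))" by (simp add: R_def power2_eq_square)
  also have "\<dots> \<le> P * (x / (P * Q))" using b P Q0 x by (intro mult_right_mono) auto
  also have "\<dots> = x / Q" using P by simp
  finally have bR: "b * R \<le> x / Q" .
  \<comment> \<open>Of the three shares \<open>x / Q\<close> that make up \<open>L\<close>, one pays
    for \<open>A\<close>, one for \<open>exp (b * R)\<close> and one for the lower bound on
    \<open>m\<close>.\<close>
  have "A * exp (b * R) \<le> exp (x / Q) * exp (x / Q)" using A bR by (intro mult_mono) auto
  also have "\<dots> = exp (- x / Q) * exp L" by (simp add: L_def exp_add[symmetric])
  also have "\<dots> \<le> m * exp L" using m by (intro mult_right_mono) auto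
  finally show "A * exp (b * R) \<le> m * exp L" .
  have s: "sqrt (9 / R) \<le> Q / (24 * x)"
  proof (rule real_le_lsqrt)
    have "P * Q \<le> Q / 5184 * Q" using Q Q0 by (intro mult_right_mono) auto
    then have "9 * (P * Q) / x\<^sup>2 \<le> (Q * Q / 576) / x\<^sup>2" by (intro divide_right_mono) auto
    then show "9 / R \<le> (Q / (24 * x))\<^sup>2" by (simp add: R_def power2_eq_square)
  qed (use Q0 x in auto)
  have "L * (9 / R + 2 * sqrt (9 / R)) \<le> L * (9 / R + 2 * (Q / (24 * x)))"
    using s \<open>L \<ge> 0\<close> by (intro mult_left_mono add_left_mono) auto
  also have "\<dots> = 27 * P / x + 1 / 4" using Q0 x P by (simp add: L_def R_def field_simps power2_eq_square)
  also have "\<dots> \<le> 1 / 2" using x by (simp add: field_simps)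
  finally show "L * (9 / R + 2 * sqrt (9 / R)) \<le> 1 / 2" .
qed

section \<open>Conjugates, the nonlinearity and the majorant\<close>

lemma fourier_cnj: "fourier (\<lambda>x. cnj (f x)) \<xi> = cnj (fourier f (- \<xi>))"
  unfolding fourier_def by (subst Bochner_Integration.integral_cnj[symmetric]) (simp add: exp_cnj)

lemma supported_in_cnj:
  "supported_in B f \<Longrightarrow> supported_in B (\<lambda>x. cnj (f x))"
  unfolding supported_in_def by simp

lemma fourier_cnj_integrable:
  assumes F: "integrable lborel (fourier f)"
  shows "integrable lborel (fourier (\<lambda>x. cnj (f x)))"
    and "(LINT \<xi>|lborel. cmod (fourier (\<lambda>x. cnj (f x)) \<xi>)) = (LINT \<xi>|lborel. cmod (fourier f \<xi>))"
proof -
  have [measurable]: "fourier f \<in> borel_measurable borel" using F by simp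
  have eq: "fourier (\<lambda>x. cnj (f x)) = (\<lambda>\<xi>. cnj (fourier f (0 - \<xi>)))" by (simp add: fun_eq_iff fourier_cnj)
  show "integrable lborel (fourier (\<lambda>x. cnj (f x)))"
    unfolding eq using lborel_integral_reflect(2)[of "fourier f" 0] F by simp
  show "(LINT \<xi>|lborel. cmod (fourier (\<lambda>x. cnj (f x)) \<xi>)) = (LINT \<xi>|lborel. cmod (fourier f \<xi>))"
    unfolding eq using lborel_integral_reflect(1)[of "\<lambda>\<xi>. cmod (fourier f \<xi>)" 0] by simp
qed

lemma nonlinearity_prod:
  assumes "j \<le> k"
  shows "nonlinearity k j v = (\<lambda>x. \<Prod>i<k. (if i < k - j then v x else cnj (v x)))"
proof
  fix x
  have "{..<k} \<inter> {i. i < k - j} = {..<k - j}" "{..<k} \<inter> - {i. i < k - j} = {k - j..<k}" by auto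
  then show "nonlinearity k j v x = (\<Prod>i<k. (if i < k - j then v x else cnj (v x)))"
    using assms by (simp add: nonlinearity_def prod.If_cases)
qed

lemma fourier_le_majorant:
  "t \<in> {-T..T} \<Longrightarrow> ennreal (cmod (fourier (u t) \<xi>)) \<le> u_majorant T u \<xi>"
proof -
  assume "t \<in> {-T..T}"
  then have "ennreal (cmod (fourier (u t) \<xi>)) \<le> u_star T u \<xi>"
    unfolding u_star_def by (rule SUP_upper)
  also have "\<dots> \<le> u_majorant T u \<xi>" unfolding u_majorant_def by (rule SUP_upper) simp
  finally show ?thesis .
qed

lemma majorant_antimono: "infnorm \<xi> \<le> infnorm \<xi>' \<Longrightarrow> u_majorant T u \<xi>' \<le> u_majorant T u \<xi>"
  unfolding u_majorant_def by (rule SUP_subset_mono) auto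

text \<open>Dividing by \<open>a\<close>, the inequality reads
  \<open>(3/4) * exp \<theta> \<le> 2 + (1/4) * exp \<theta>\<close>, so
  \<open>exp \<theta> \<le> 4\<close>, against
  \<open>exp \<theta> \<ge> 1 + \<theta> \<ge> 5\<close>.\<close>

lemma growth_contradiction:
  fixes \<theta> a y z w C I :: real
  assumes ineq: "exp \<theta> * y \<le> z + C * a * I" and y: "y \<ge> 3 / 4 * a" and z: "z \<le> 2 * a" and a: "a > 0"
    and I: "I \<le> exp \<theta> / w" and w: "w > 0" "4 * C \<le> w" and C: "C \<ge> 0" and th: "\<theta> \<ge> 4"
  shows False
proof -
  have "C * a * I \<le> C * a * (exp \<theta> / w)" using I C a by (intro mult_left_mono) auto
  also have "\<dots> = (C / w) * (a * exp \<theta>)" by simp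
  also have "\<dots> \<le> (1 / 4) * (a * exp \<theta>)" using w a by (intro mult_right_mono) (auto simp: field_simps)
  finally have "exp \<theta> * y \<le> 2 * a + (1 / 4) * (a * exp \<theta>)" using ineq z by linarith
  moreover have "exp \<theta> * (3 / 4 * a) \<le> exp \<theta> * y" using y by (intro mult_left_mono) auto
  moreover have "exp \<theta> * (3 / 4 * a) = 3 / 4 * (a * exp \<theta>)" by simp
  ultimately have "a * exp \<theta> \<le> a * 4" by linarith
  then have "exp \<theta> \<le> 4" using a by simp
  moreover have "exp \<theta> \<ge> 1 + \<theta>" by (rule exp_ge_add_one_self)
  ultimately show False using th by linarith
qed

text \<open>A single index \<open>n\<close> yields the contradiction: it suffices that
  \<open>infnorm (\<xi> n)\<close> exceeds a threshold that may depend on all the data, including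
  \<open>u\<close>.\<close>

lemma no_large_frequencies:
  fixes u :: "real \<Rightarrow> real ^ 'd::finite \<Rightarrow> complex"
  assumes C: "C1 > 0" "C2 > 0" "C3 > 0"
    and B: "B > 0" and T: "T > 0" and s: "s > real CARD('d)" and c: "c > 0" and k: "k \<ge> 2" and j: "j \<le> k"
    and Q: "Q \<ge> 5184 * real CARD('d) * C2 * B" and \<epsilon>: "\<epsilon>0 > 0"
    and ent: "entire \<omega>" and real: "\<forall>x. \<omega> (complexify x 0) \<in> \<real>"
    and cont: "sobolev_continuous_on s {-T..T} u"
    and mild: "mild_solution \<omega> (nonlinearity k j) s T u"
    and M: "\<forall>t\<in>{-T..T}. sobolev_norm s (u t) \<le> M"
    and supp: "\<forall>t\<in>{-T..T}. ess_support (u t) \<subseteq> {x. infnorm x < B}"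
    and ts: "\<forall>x. t1 x \<in> {-T..T} \<and> u_star T u x = ennreal (cmod (fourier (u (t1 x)) x)) \<and>
           t2 x \<in> {-T..T} \<and> \<bar>t2 x - t1 x\<bar> \<ge> \<epsilon>0 * T"
    and E: "\<forall>n. \<xi> n \<in> E_set T k u Q c"
    and lim: "filterlim (\<lambda>n. infnorm (\<xi> n)) at_top sequentially"
    and ev: "\<forall>\<^sub>F n in sequentially.
         C1 * inverse (infnorm (\<xi> n)) \<le> infnorm (\<eta> n) \<and>
         infnorm (\<eta> n) \<le> C2 * inverse (infnorm (\<xi> n)) \<and>
         (t2 (\<xi> n) - t1 (\<xi> n)) * Im (\<omega> (complexify (\<xi> n) (\<eta> n))) > 0 \<and>
         \<bar>Im (\<omega> (complexify (\<xi> n) (\<eta> n)))\<bar> \<ge> C3 * (infnorm (\<xi> n) / T)"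
  shows False
proof -
  let ?a = "u_majorant T u"
  let ?N = "nonlinearity k j"
  have sob: "u t \<in> sobolev_space s" if "t \<in> {-T..T}" for t
    using cont that by (simp add: sobolev_continuous_on_def)
  have su: "supported_in B (u t)" if "t \<in> {-T..T}" for t
  proof (rule square_integrable_supported)
    show "square_integrable (u t)" using sob[OF that] by (auto simp: sobolev_space_def has_L2_fourier_def)
    show "AE x in lborel. infnorm x \<ge> B \<longrightarrow> u t x = 0" using supp that by (intro ess_support_AE) auto
  qed
  define L where "L = M\<^sup>2 + (LINT \<xi>|lborel. (1 + (norm (\<xi> :: real ^ 'd))\<^sup>2) powr (- s))"
  have L0: "L \<ge> 0" unfolding L_def by (intro add_nonneg_nonneg Bochner_Integration.integral_nonneg) auto
  have uF: "integrable lborel (fourier (u t))" "(LINT \<xi>|lborel. cmod (fourier (u t) \<xi>)) \<le> L" if "t \<in> {-T..T}" for t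
    using sobolev_fourier_L1[OF sob[OF that] su[OF that] s] M that by (auto simp: L_def)
  define f where "f = (\<lambda>t i x. if i < k - j then u t x else cnj (u t x))"
  have fcase: "f t i = u t \<or> f t i = (\<lambda>x. cnj (u t x))" for t i by (cases "i < k - j") (auto simp: f_def)
  have fs: "supported_in B (f t i)" if "t \<in> {-T..T}" for t i
    using fcase[of t i] su[OF that] supported_in_cnj[OF su[OF that]] by auto
  have fF: "integrable lborel (fourier (f t i))" if "t \<in> {-T..T}" for t i
    using fcase[of t i] uF(1)[OF that] fourier_cnj_integrable(1)[OF uF(1)[OF that]] by auto
  have fL: "(LINT \<xi>|lborel. cmod (fourier (f t i) \<xi>)) \<le> L" if "t \<in> {-T..T}" for t i
    using fcase[of t i] uF(2)[OF that] fourier_cnj_integrable(2)[OF uF(1)[OF that]] by auto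
  have fa: "ennreal (cmod (fourier (f t i) \<xi>)) \<le> ?a \<xi>" if "t \<in> {-T..T}" for t i \<xi>
  proof (cases "i < k - j")
    case True
    then show ?thesis using fourier_le_majorant[OF that] by (simp add: f_def)
  next
    case False
    \<comment> \<open>Conjugation reflects the frequency, which is harmless because the majorant
      depends on the frequency only through its norm.\<close>
    then have "ennreal (cmod (fourier (f t i) \<xi>)) \<le> ?a (- \<xi>)"
      using fourier_le_majorant[OF that, of u "-\<xi>"] by (simp add: f_def fourier_cnj)
    also have "\<dots> \<le> ?a \<xi>" by (rule majorant_antimono) (simp add: infnorm_neg)
    finally show ?thesis .
  qed
  have Nf: "?N (u t) = (\<lambda>x. \<Prod>i<k. f t i x)" for t
    unfolding nonlinearity_prod[OF j] f_def ..
  define V where "V = band_volume TYPE('d) B"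
  have V0: "V \<ge> 0" by (simp add: V_def)
  have Np: "supported_in B (?N (u t)) \<and> integrable lborel (fourier (?N (u t))) \<and>
      (LINT \<xi>|lborel. cmod (fourier (?N (u t)) \<xi>)) \<le> L ^ k" if "t \<in> {-T..T}" for t
    unfolding Nf using product_fourier[where f="f t" and m=k, OF _ fs fF fL fa] k that by auto
  have sN: "supported_in B (?N (u t))" if "t \<in> {-T..T}" for t using Np[OF that] by simp
  \<comment> \<open>One constant bounding the integrals of \<open>u t\<close>, of its conjugate and
    of the nonlinearity, uniformly in time.\<close>
  define A where "A = 1 + L * V + L ^ k * V"
  have A: "A \<ge> 1" using L0 V0 by (simp add: A_def)
  have A1: "(LINT x|lborel. cmod (u t x)) \<le> A" if "t \<in> {-T..T}" for t
    using L1_bound_of_fourier[OF su[OF that] uF[OF that]] L0 V0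
    by (auto simp: A_def V_def intro: order_trans)
  have A2: "(LINT x|lborel. cmod (?N (u t) x)) \<le> A" if "t \<in> {-T..T}" for t
    using L1_bound_of_fourier[of B "?N (u t)" "L ^ k"] Np[OF that] L0 V0
    by (auto simp: A_def V_def intro: order_trans)
  have A3: "(LINT x|lborel. cmod (f t i x)) \<le> A" if "t \<in> {-T..T}" for t i
    using fcase[of t i] A1[OF that] by auto
  have aA: "?a \<xi> \<le> ennreal A" for \<xi>
    unfolding u_majorant_def u_star_def
  proof (intro SUP_least ennreal_leI)
    fix \<xi>' t assume "t \<in> {-T..T}"
    then show "cmod (fourier (u t) \<xi>') \<le> A" using fourier_bound[of "u t" \<xi>'] A1 by (meson order_trans)
  qed
  define \<alpha> where "\<alpha> = (\<lambda>\<xi>. enn2real (?a \<xi>))"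
  have \<alpha>: "?a \<xi> = ennreal (\<alpha> \<xi>)" "\<alpha> \<xi> \<ge> 0" for \<xi>
    unfolding \<alpha>_def using order_le_less_trans[OF aA ennreal_less_top] by simp_all
  have \<alpha>mono: "\<alpha> \<xi>' \<le> \<alpha> \<xi>" if "infnorm \<xi> \<le> infnorm \<xi>'" for \<xi> \<xi>'
    using majorant_antimono[OF that, of T u] \<alpha> by (simp add: ennreal_le_iff)
  have f\<alpha>: "cmod (fourier (f t i) \<xi>) \<le> \<alpha> \<xi>" if "t \<in> {-T..T}" for t i \<xi>
    using fa[OF that, of i \<xi>] \<alpha> by (simp add: ennreal_le_iff)
  have u\<alpha>: "cmod (fourier (u t) \<xi>) \<le> \<alpha> \<xi>" if "t \<in> {-T..T}" for t \<xi>
    using fourier_le_majorant[OF that, of u \<xi>] \<alpha> by (simp add: ennreal_le_iff)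
  define P where "P = real CARD('d) * B * C2"
  have P: "P > 0" using B C by (simp add: P_def)
  have QP: "Q \<ge> 5184 * P" using Q by (simp add: P_def mult_ac)
  have Q0: "Q > 0" using P QP by simp
  define q where "q = k - 1"
  have q: "k = Suc q" "q \<ge> 1" using k by (auto simp: q_def)
  \<comment> \<open>\<open>2 / c\<close> comes from the first condition of \<open>E_set\<close>,
    which bounds the convolution by \<open>a / c\<close>; \<open>2 * L ^ q\<close> comes from the
    frequencies where the value \<open>a\<close> replaces the majorant.\<close>
  define CN where "CN = 2 / c + 2 * L ^ q"
  have CN: "CN \<ge> 0" using c L0 by (simp add: CN_def)
  \<comment> \<open>The summands serve in turn: \<open>108 * P\<close> and
    \<open>9 * (P * Q)\<close> for the radius of the slit disc, 1 to pass from \<open>x\<close> to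
    its square, \<open>Q * A\<close> for \<open>A \<le> exp (x / Q)\<close>,
    \<open>4 / (\<epsilon>0 * C3)\<close> for an exponent of at least 4, and the last for
    \<open>4 * CN \<le> \<bar>W\<bar>\<close>.\<close>
  define X where "X = 108 * P + 9 * (P * Q) + 1 + Q * A + 4 / (\<epsilon>0 * C3) + 4 * CN * T / C3"
  have "\<forall>\<^sub>F n in sequentially. infnorm (\<xi> n) \<ge> X" using lim by (simp add: filterlim_at_top)
  then obtain n where n: "infnorm (\<xi> n) \<ge> X"
    and n2: "infnorm (\<eta> n) \<le> C2 * inverse (infnorm (\<xi> n))"
      "(t2 (\<xi> n) - t1 (\<xi> n)) * Im (\<omega> (complexify (\<xi> n) (\<eta> n))) > 0"
      "\<bar>Im (\<omega> (complexify (\<xi> n) (\<eta> n)))\<bar> \<ge> C3 * (infnorm (\<xi> n) / T)"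
    using eventually_happens[OF eventually_conj[OF _ ev]] by (metis (no_types, lifting) sequentially_bot)
  define \<xi>n where "\<xi>n = \<xi> n"
  define \<eta>n where "\<eta>n = \<eta> n"
  define x where "x = infnorm \<xi>n"
  define W where "W = Im (\<omega> (complexify \<xi>n \<eta>n))"
  define t t' where "t = t1 \<xi>n" and "t' = t2 \<xi>n"
  have PQ: "P * Q > 0" "Q * A > 0" "4 / (\<epsilon>0 * C3) > 0" "4 * CN * T / C3 \<ge> 0"
    using P Q0 A \<epsilon> C CN T by auto
  have xX: "x \<ge> X" using n by (simp add: x_def \<xi>n_def)
  have x: "x \<ge> 108 * P" "x \<ge> 9 * (P * Q)" "x \<ge> 1" "x \<ge> Q * A" "x \<ge> 4 / (\<epsilon>0 * C3)" "x \<ge> 4 * CN * T / C3"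
    using xX PQ P unfolding X_def by linarith+
  have x2: "x\<^sup>2 \<ge> 9 * (P * Q)"
  proof -
    have "x * 1 \<le> x * x" using x(3) by (intro mult_left_mono) auto
    then show ?thesis using x(2) unfolding power2_eq_square by linarith
  qed
  have tT: "t \<in> {-T..T}" "t' \<in> {-T..T}" and us: "u_star T u \<xi>n = ennreal (cmod (fourier (u t) \<xi>n))"
    and gap: "\<bar>t' - t\<bar> \<ge> \<epsilon>0 * T"
    using ts by (auto simp: t_def t'_def)
  have W1: "(t' - t) * W > 0" and W2: "\<bar>W\<bar> \<ge> C3 * (x / T)"
    using n2 by (auto simp: W_def t_def t'_def \<xi>n_def \<eta>n_def x_def)
  have ne: "t \<noteq> t'" using W1 by auto
  define a where "a = \<alpha> \<xi>n"
  have En: "ennreal c * convolution_power k ?a \<xi>n < ?a \<xi>n" "ennreal (exp (- x / Q)) < ?a \<xi>n" "?a \<xi>n = u_star T u \<xi>n"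
    using E[rule_format, of n] by (auto simp: E_set_def \<xi>n_def x_def)
  have ae: "exp (- x / Q) \<le> a"
    using En(2) \<alpha> by (simp add: a_def ennreal_less_iff)
  have a0: "a > 0" using ae exp_gt_zero[of "- x / Q"] by linarith
  \<comment> \<open>The third condition of \<open>E_set\<close> and the maximizing choice of
    \<open>t1\<close> together: the majorant is attained at \<open>\<xi>n\<close> itself, at time
    \<open>t\<close>.\<close>
  have au: "cmod (fourier (u t) \<xi>n) = a"
    using En(3) us \<alpha> by (simp add: a_def)
  have Ax: "A \<le> exp (x / Q)"
  proof -
    have "A \<le> x / Q" using x(4) Q0 by (simp add: pos_le_divide_eq mult.commute)
    also have "\<dots> \<le> exp (x / Q)" using exp_ge_add_one_self[of "x / Q"] by linarith
    finally show ?thesis .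
  qed
  define b where "b = real CARD('d) * B * infnorm \<eta>n"
  have bx: "b * x \<le> P"
  proof -
    have "infnorm \<eta>n * x \<le> C2" using n2(1) x(3) by (simp add: \<eta>n_def \<xi>n_def x_def field_simps)
    then have "real CARD('d) * B * (infnorm \<eta>n * x) \<le> real CARD('d) * B * C2" using B by (intro mult_left_mono) auto
    then show ?thesis by (simp add: b_def P_def mult_ac)
  qed
  have rad: "x\<^sup>2 / (P * Q) \<ge> 9" "3 * x / Q \<ge> 0" "m \<ge> exp (- x / Q) \<Longrightarrow> A * exp (b * (x\<^sup>2 / (P * Q))) \<le> m * exp (3 * x / Q)"
    "3 * x / Q * (9 / (x\<^sup>2 / (P * Q)) + 2 * sqrt (9 / (x\<^sup>2 / (P * Q)))) \<le> 1 / 2" for m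
    using radius_choice[OF P QP x(1) x2 _ Ax _ bx] x(3) A ae by auto
  \<comment> \<open>The maximum with \<open>a\<close> keeps the bound above
    \<open>exp (- x / Q)\<close> at every \<zeta>, which the choice of radius requires; for \<zeta>
    beyond \<open>\<xi>n\<close> the majorant alone might be smaller. At
    \<open>\<zeta> = \<xi>n\<close> both entries coincide.\<close>
  have var: "cmod (fourier (twist g \<eta>n \<i>) \<zeta>) \<le> 2 * max (\<alpha> \<zeta>) a \<and>
      cmod (fourier (twist g \<eta>n \<i>) \<zeta> - fourier g \<zeta>) \<le> max (\<alpha> \<zeta>) a / 4"
    if g: "supported_in B g" "(LINT x|lborel. cmod (g x)) \<le> A" "\<And>\<xi>'. cmod (fourier g \<xi>') \<le> \<alpha> \<xi>'" for g \<zeta>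
  proof -
    have bd: "cmod (fourier g \<xi>') \<le> max (\<alpha> \<zeta>) a" if "infnorm \<zeta> \<le> infnorm \<xi>'" for \<xi>'
      using g(3)[of \<xi>'] \<alpha>mono[OF that] by linarith
    have mm: "max (\<alpha> \<zeta>) a \<ge> exp (- x / Q)" "max (\<alpha> \<zeta>) a \<ge> 0" using ae a0 by linarith+
    show ?thesis
      using twist_variation[OF g(1,2) less_imp_le[OF B] bd rad(1) mm(2) rad(2) rad(3)[OF mm(1), unfolded b_def] rad(4)]
      by blast
  qed
  have tw1: "cmod (fourier (twist (u t) \<eta>n \<i>) \<xi>n) \<ge> 3 / 4 * a"
  proof -
    have "cmod (fourier (twist (u t) \<eta>n \<i>) \<xi>n - fourier (u t) \<xi>n) \<le> a / 4"
      using var[of "u t" \<xi>n, OF su[OF tT(1)] A1[OF tT(1)] u\<alpha>[OF tT(1)]] by (simp add: a_def)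
    then show ?thesis
      using norm_triangle_ineq2[of "fourier (u t) \<xi>n" "fourier (twist (u t) \<eta>n \<i>) \<xi>n"] au by (simp add: norm_minus_commute)
  qed
  have tw2: "cmod (fourier (twist (u t') \<eta>n \<i>) \<xi>n) \<le> 2 * a"
    using var[of "u t'" \<xi>n, OF su[OF tT(2)] A1[OF tT(2)] u\<alpha>[OF tT(2)]] by (simp add: a_def)
  \<comment> \<open>The strict inequality in \<open>E_set\<close> also rules out the value
    \<open>top\<close> for the convolution.\<close>
  have conv: "convolution_power k ?a \<xi>n \<le> ennreal (a / c)"
  proof (cases "convolution_power k ?a \<xi>n")
    case (real v)
    then have "ennreal (c * v) < ennreal a" using En(1) \<alpha>(1)[of \<xi>n] c by (simp add: a_def ennreal_mult)
    then have "c * v < a" using c real by (subst (asm) ennreal_less_iff) auto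
    then show ?thesis using real c by (auto simp: pos_le_divide_eq mult.commute intro!: ennreal_leI)
  next
    case top
    then show ?thesis using En(1) c by (simp add: ennreal_mult_top)
  qed
  have Nb: "cmod (fourier (twist (?N (u \<tau>)) \<eta>n \<i>) \<xi>n) \<le> CN * a" if \<tau>: "\<tau> \<in> {-T..T}" for \<tau>
  proof -
    have tw: "ennreal (cmod (fourier (twist (f \<tau> q) \<eta>n \<i>) \<zeta>)) \<le> 2 * ?a \<zeta> + ennreal (2 * a)" for \<zeta>
    proof -
      have "cmod (fourier (twist (f \<tau> q) \<eta>n \<i>) \<zeta>) \<le> 2 * max (\<alpha> \<zeta>) a"
        using var[of "f \<tau> q" \<zeta>, OF fs[OF \<tau>] A3[OF \<tau>] f\<alpha>[OF \<tau>]] by blast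
      also have "\<dots> \<le> 2 * \<alpha> \<zeta> + 2 * a" using \<alpha>(2)[of \<zeta>] a0 by linarith
      finally have "ennreal (cmod (fourier (twist (f \<tau> q) \<eta>n \<i>) \<zeta>)) \<le> ennreal (2 * \<alpha> \<zeta> + 2 * a)" by (rule ennreal_leI)
      also have "\<dots> = 2 * ?a \<zeta> + ennreal (2 * a)" using \<alpha>[of \<zeta>] a0 by (simp add: ennreal_mult)
      finally show ?thesis .
    qed
    have "ennreal (cmod (fourier (twist (?N (u \<tau>)) \<eta>n \<i>) \<xi>n)) \<le> 2 * convolution_power k ?a \<xi>n + ennreal (2 * a * L ^ q)"
      unfolding Nf unfolding q(1)
      by (rule fourier_twist_product_bound[where f="f \<tau>" and \<alpha>=a and a="?a", OF q(2) fs[OF \<tau>] fF[OF \<tau>] fL[OF \<tau>] fa[OF \<tau>] less_imp_le[OF a0] tw])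
    also have "\<dots> \<le> 2 * ennreal (a / c) + ennreal (2 * a * L ^ q)"
      using conv by (intro add_right_mono mult_left_mono) auto
    also have "2 * ennreal (a / c) = ennreal (2 * (a / c))"
      using a0 c by (subst ennreal_mult) auto
    also have "ennreal (2 * (a / c)) + ennreal (2 * a * L ^ q) = ennreal (2 * (a / c) + 2 * a * L ^ q)"
      by (rule ennreal_plus[symmetric]) (use a0 c L0 in auto)
    finally have "cmod (fourier (twist (?N (u \<tau>)) \<eta>n \<i>) \<xi>n) \<le> 2 * (a / c) + 2 * a * L ^ q"
      using a0 c L0 by (subst (asm) ennreal_le_iff) auto
    then show ?thesis by (simp add: CN_def algebra_simps)
  qed
  obtain I where I: "((\<lambda>\<tau>. exp ((t' - \<tau>) * W)) has_integral I) {min t t'..max t t'}" "I \<le> exp ((t' - t) * W) / \<bar>W\<bar>"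
    using exp_integral_le[OF W1] by blast
  have "exp ((t' - t) * W) * cmod (fourier (twist (u t) \<eta>n \<i>) \<xi>n) \<le>
      cmod (fourier (twist (u t') \<eta>n \<i>) \<xi>n) + CN * a * I"
    by (rule duhamel_complex[OF ent real[rule_format] mild _ less_imp_le[OF B] tT ne sob su sN A1 A2 A Nb W_def I(1)])
      (use s in auto)
  moreover have "\<bar>W\<bar> > 0" using W1 by auto
  moreover have "4 * CN \<le> \<bar>W\<bar>"
  proof -
    have "4 * CN \<le> C3 * (x / T)" using x(6) C T by (simp add: field_simps)
    then show ?thesis using W2 by linarith
  qed
  moreover have "(t' - t) * W \<ge> 4"
  proof -
    have "4 \<le> \<epsilon>0 * C3 * x" using x(5) \<epsilon> C by (simp add: field_simps)
    also have "\<dots> = (\<epsilon>0 * T) * (C3 * (x / T))" using T by simp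
    also have "\<dots> \<le> \<bar>t' - t\<bar> * \<bar>W\<bar>" using gap W2 C T \<epsilon> x(3) by (intro mult_mono) auto
    also have "\<dots> = (t' - t) * W" using W1 by (simp flip: abs_mult)
    finally show ?thesis .
  qed
  ultimately show False
    using growth_contradiction[OF _ tw1 tw2 a0 I(2) _ _ CN] by blast
qed

theorem theorem3p1:
  fixes C\<^sub>1 C\<^sub>2 C\<^sub>3 :: real
  assumes "C\<^sub>1 > 0" "C\<^sub>2 > 0" "C\<^sub>3 > 0"
  shows "\<exists>K>0. \<exists>e>0.
    \<forall>(B::real) (T::real) (M::real) (s::real) (c::real) (Q::real) (\<epsilon>\<^sub>0::real) (k::nat) (j::nat)
      (\<omega> :: complex ^ 'd::finite \<Rightarrow> complex) (u :: real \<Rightarrow> real ^ 'd \<Rightarrow> complex)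
      (t\<^sub>1 :: real ^ 'd \<Rightarrow> real) (t\<^sub>2 :: real ^ 'd \<Rightarrow> real)
      (\<xi> :: nat \<Rightarrow> real ^ 'd) (\<eta> :: nat \<Rightarrow> real ^ 'd).
      B > 0 \<and> T > 0 \<and> s > real CARD('d) \<and> c > 0 \<and> k \<ge> 2 \<and> j \<le> k \<and>
      Q \<ge> K * B \<and> 0 < \<epsilon>\<^sub>0 \<and> \<epsilon>\<^sub>0 \<le> e \<and>
      entire \<omega> \<and> (\<forall>x. \<omega> (complexify x 0) \<in> \<real>) \<and>
      sobolev_continuous_on s {-T..T} u \<and>
      mild_solution \<omega> (nonlinearity k j) s T u \<and>
      (\<forall>t\<in>{-T..T}. sobolev_norm s (u t) \<le> M) \<and>
      (\<forall>t\<in>{-T..T}. ess_support (u t) \<subseteq> {x. infnorm x < B}) \<and>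
      (\<forall>x. t\<^sub>1 x \<in> {-T..T} \<and> u_star T u x = ennreal (cmod (fourier (u (t\<^sub>1 x)) x)) \<and>
           t\<^sub>2 x \<in> {-T..T} \<and> \<bar>t\<^sub>2 x - t\<^sub>1 x\<bar> \<ge> \<epsilon>\<^sub>0 * T) \<and>
      (\<forall>n. \<xi> n \<in> E_set T k u Q c) \<and>
      filterlim (\<lambda>n. infnorm (\<xi> n)) at_top sequentially \<and>
      (\<forall>\<^sub>F n in sequentially.
         C\<^sub>1 * inverse (infnorm (\<xi> n)) \<le> infnorm (\<eta> n) \<and>
         infnorm (\<eta> n) \<le> C\<^sub>2 * inverse (infnorm (\<xi> n)) \<and>
         (t\<^sub>2 (\<xi> n) - t\<^sub>1 (\<xi> n)) * Im (\<omega> (complexify (\<xi> n) (\<eta> n))) > 0 \<and>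
         \<bar>Im (\<omega> (complexify (\<xi> n) (\<eta> n)))\<bar> \<ge> C\<^sub>3 * (infnorm (\<xi> n) / T))
      \<longrightarrow> (\<forall>t\<in>{-T..T}. AE x in lborel. u t x = 0)"
\<comment> \<open>With \<open>P = d * B * C2\<close>, the condition \<open>Q \<ge> K * B\<close>
  says \<open>Q \<ge> 5184 * P\<close>, as the radius of the slit disc demands. The value 1 for
  \<open>e\<close> is a default: \<open>\<epsilon>\<^sub>0\<close> enters through the threshold for
  the frequency, which may depend on it.\<close>
proof (rule exI[of _ "5184 * real CARD('d) * C\<^sub>2"], rule conjI)
  show "5184 * real CARD('d) * C\<^sub>2 > 0" using assms by simp
qed (rule exI[of _ 1], rule conjI, simp, intro allI impI, elim conjE, rule FalseE,
  rule no_large_frequencies[OF assms], assumption+)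

end
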